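(* Let $t=g(x,y)$ be a real analytic solution to the zero mean curvature equation $$(1-g_y^2)g_{xx}+2g_xg_yg_{xy}+(1-g_x^2)g_{yy}=0$$ whose graph has a lightlike line segment $L$ which contains the origin in $\mathbb{L}^3(t,x,y)$. (i) If $g$ is even with respect to the $x$-axis, i.e. $g(-x,y)=g(x,y)$, then the solution $\tilde y=h(\tilde t,\tilde x)=g(i\tilde x,\tilde t)$ in $\mathbb{L}^3(\tilde t,\tilde x,\tilde y)$ to the Born-Infeld equation $$(1-h_{\tilde t}^2)h_{\tilde x\tilde x}+2h_{\tilde t}h_{\tilde x}h_{\tilde t\tilde x}-(1+h_{\tilde x}^2)h_{\tilde t\tilde t}=0$$ also has a lightlike line segment $\tilde L$. Moreover these two solutions belong, along $L$ and $\tilde L$, to the same class among the six classes $\alpha^+,\alpha^0_{I},\alpha^0_{II},\alpha^-_{I},\alpha^-_{II},\alpha^-_{III}$. Here $\tilde t=y$, $\tilde x=x$, $\tilde y=t$. (ii) If $g$ is odd with respect to the $x$-axis, i.e. $g(-x,y)=-g(x,y)$, then the solution $\tilde y=h(\tilde t,\tilde x)=-ig(i\tilde t,\tilde x)$ in $\mathbb{L}^3(\tilde t,\tilde x,\tilde y)$ to the Born-Infeld equation also has a lightlike line segment $\tilde L$, where $\tilde t=x$, $\tilde x=y$, $\tilde y=t$. Moreover each of the two solutions belongs to the class $\alpha^+$, $\alpha^0_{I}$ or $\alpha^-_{I}$. A solution of type $\alpha^+$ (resp. $\alpha^-_{I}$) is transformed to a solution of type $\alpha^-_{I}$ (resp.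 $\alpha^+$), and a graph of type $\alpha^0_{I}$ is transformed to a graph of type $\alpha^0_{I}$.
   Context: $\mathbb{L}^3(t,x,y)$ is Lorentz-Minkowski 3-space with metric $-(dt)^2+(dx)^2+(dy)^2$. A surface is lightlike at a point if its induced metric is degenerate there. A lightlike line segment on a surface is a straight line segment with null direction, contained in the surface and consisting of lightlike points of the surface. Wick rotations: $g$ is real analytic on a (connected) domain containing the origin and symmetric under $x\mapsto -x$. For real $s$ near $0$, $g(is,y)$ denotes the value obtained by substituting $is$ for $x$ in the Taylor expansion $g(x,y)=\sum_n a_n(y)x^n$ (analytic continuation). Rotated solutions are considered near the line where the rotated variable vanishes, locally near the origin. Classes. A surface in $\mathbb{L}^3$ has zero mean curvature if it is locally (after a rigid motion) the graph of a solution to the zero mean curvature equation or to the Born-Infeld equation. If such a surface contains a lightlike line segment $L$ through the origin, then after an isometry of $\mathbb{L}^3$ fixing the origin one may assume $L\subset\{(y,0,y)\mid y\in\mathbb{R}\}$, and near $L$ the surface is a graph $$t=G(x,y)=y+\frac{\alpha(y)}{2}x^2+\beta(x,y)x^3$$ with $\alpha,\beta$ real analytic; $\alpha(y)=G_{xx}(0,y)$ is called the approximation function. It satisfies $\alpha'+\alpha^2+\mu=0$ for a real constant $\mu$ (the characteristic). By a homothety one normalizes $\mu\in\{1,0,-1\}$, and the class of the surface along $L$ is given by which of the following solutions $\alpha$ is: $\alpha^+$: $\alpha=-\tan(y+c)$ with $|c|<\pi/2$ ($\mu=1$); $\alpha^0_{I}$: $\alpha=0$, and $\alpha^0_{II}$: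 $\alpha=(y+c)^{-1}$ with $c\neq0$ ($\mu=0$); $\alpha^-_{I}$: $\alpha=\tanh(y+c)$ with $c\in\mathbb{R}$, $\alpha^-_{II}$: $\alpha=\coth(y+c)$ with $c\ne0$, and $\alpha^-_{III}$: $\alpha=\pm1$ ($\mu=-1$). *)

theory Defs
  imports "HOL-Analysis.Analysis"
begin

section \<open>Real analyticity\<close>

definition real_analytic_on :: "(real \<Rightarrow> real) \<Rightarrow> real set \<Rightarrow> bool" where
  "real_analytic_on f S \<longleftrightarrow> (\<forall>x\<in>S. \<exists>F. (\<lambda>u. f (x + u)) has_fps_expansion F)"

definition real_analytic2_on :: "(real \<Rightarrow> real \<Rightarrow> real) \<Rightarrow> (real \<times> real) set \<Rightarrow> bool" where
  "real_analytic2_on f S \<longleftrightarrow>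
     (\<forall>(x, y)\<in>S. \<exists>c. \<exists>r>0. \<forall>u v. \<bar>u\<bar> < r \<longrightarrow> \<bar>v\<bar> < r \<longrightarrow>
        ((\<lambda>(m, n). c m n * u ^ m * v ^ n) has_sum f (x + u) (y + v)) (UNIV :: (nat \<times> nat) set))"


section \<open>The two differential equations\<close>

definition D1 :: "(real \<Rightarrow> real \<Rightarrow> real) \<Rightarrow> real \<Rightarrow> real \<Rightarrow> real" where
  "D1 f = (\<lambda>x y. deriv (\<lambda>s. f s y) x)"

definition D2 :: "(real \<Rightarrow> real \<Rightarrow> real) \<Rightarrow> real \<Rightarrow> real \<Rightarrow> real" where
  "D2 f = (\<lambda>x y. deriv (\<lambda>s. f x s) y)"

definition zero_mean_curvature_on :: "(real \<Rightarrow> real \<Rightarrow> real) \<Rightarrow> (real \<times> real) set \<Rightarrow> bool" where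
  "zero_mean_curvature_on g \<Omega> \<longleftrightarrow>
     (\<forall>(x, y)\<in>\<Omega>.
        (1 - (D2 g x y)\<^sup>2) * D1 (D1 g) x y
        + 2 * D1 g x y * D2 g x y * D2 (D1 g) x y
        + (1 - (D1 g x y)\<^sup>2) * D2 (D2 g) x y = 0)"

text \<open>The arguments of \<open>h\<close> are ordered as \<open>(t, x)\<close>: the partial derivative in \<open>t\<close> is
  \<open>D1\<close>, the one in \<open>x\<close> is \<open>D2\<close>.\<close>

definition born_infeld_on :: "(real \<Rightarrow> real \<Rightarrow> real) \<Rightarrow> (real \<times> real) set \<Rightarrow> bool" where
  "born_infeld_on h U \<longleftrightarrow>
     (\<forall>(t, x)\<in>U.
        (1 - (D1 h t x)\<^sup>2) * D2 (D2 h) t x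
        + 2 * D1 h t x * D2 h t x * D2 (D1 h) t x
        - (1 + (D2 h t x)\<^sup>2) * D1 (D1 h) t x = 0)"


section \<open>Surfaces in Lorentz-Minkowski 3-space\<close>

text \<open>A point of \<open>L3\<close> is a triple \<open>(t, x, y)\<close>.\<close>

type_synonym L3 = "real \<times> real \<times> real"

fun lorentz :: "L3 \<Rightarrow> L3 \<Rightarrow> real" where
  "lorentz (t, x, y) (t', x', y') = - t * t' + x * x' + y * y'"

definition linear_isometry_L3 :: "(L3 \<Rightarrow> L3) \<Rightarrow> bool" where
  "linear_isometry_L3 T \<longleftrightarrow> linear T \<and> (\<forall>p q. lorentz (T p) (T q) = lorentz p q)"

definition graph_t :: "(real \<Rightarrow> real \<Rightarrow> real) \<Rightarrow> real \<Rightarrow> real \<Rightarrow> L3" where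
  "graph_t g = (\<lambda>x y. (g x y, x, y))"

definition graph_y :: "(real \<Rightarrow> real \<Rightarrow> real) \<Rightarrow> real \<Rightarrow> real \<Rightarrow> L3" where
  "graph_y h = (\<lambda>t x. (t, x, h t x))"

definition surface :: "(real \<Rightarrow> real \<Rightarrow> L3) \<Rightarrow> (real \<times> real) set \<Rightarrow> L3 set" where
  "surface F U = (\<lambda>(u, v). F u v) ` U"

definition tangent_map :: "(real \<Rightarrow> real \<Rightarrow> L3) \<Rightarrow> real \<Rightarrow> real \<Rightarrow> real \<times> real \<Rightarrow> L3" where
  "tangent_map F u v w =
     fst w *\<^sub>R vector_derivative (\<lambda>s. F s v) (at u) + snd w *\<^sub>R vector_derivative (\<lambda>s. F u s) (at v)"

definition induced_metric ::
  "(real \<Rightarrow> real \<Rightarrow> L3) \<Rightarrow> real \<Rightarrow> real \<Rightarrow> real \<times> real \<Rightarrow> real \<times> real \<Rightarrow> real" where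
  "induced_metric F u v w z = lorentz (tangent_map F u v w) (tangent_map F u v z)"

definition lightlike_at :: "(real \<Rightarrow> real \<Rightarrow> L3) \<Rightarrow> real \<Rightarrow> real \<Rightarrow> bool" where
  "lightlike_at F u v \<longleftrightarrow> (\<exists>w. w \<noteq> 0 \<and> (\<forall>z. induced_metric F u v w z = 0))"

definition lightlike_segment ::
  "(real \<Rightarrow> real \<Rightarrow> L3) \<Rightarrow> (real \<times> real) set \<Rightarrow> L3 set \<Rightarrow> bool" where
  "lightlike_segment F U L \<longleftrightarrow>
     (\<exists>p q. p \<noteq> q \<and> lorentz (q - p) (q - p) = 0 \<and> L = closed_segment p q) \<and>
     L \<subseteq> surface F U \<and>
     (\<forall>(u, v)\<in>U. F u v \<in> L \<longrightarrow> lightlike_at F u v)"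


section \<open>Approximation functions and the six classes\<close>

text \<open>\<open>approximation_function S L \<alpha>\<close>: the segment \<open>L\<close> lies on the line of all \<open>(y, 0, y)\<close> and,
  in a neighbourhood \<open>W\<close> of \<open>L\<close>, the surface \<open>S\<close> is the graph of
  \<open>t = y + \<alpha>(y)/2 x^2 + \<beta>(x,y) x^3\<close> over a planar domain \<open>V\<close>. The open set \<open>I\<close> is the domain of
  \<open>\<alpha>\<close>; it contains the projection of \<open>L\<close> because \<open>L \<subseteq> S \<inter> W\<close>.\<close>

definition approximation_function :: "L3 set \<Rightarrow> L3 set \<Rightarrow> (real \<Rightarrow> real) \<Rightarrow> bool" where
  "approximation_function S L \<alpha> \<longleftrightarrow>
     L \<subseteq> S \<and> L \<subseteq> {(y, 0, y) | y. True} \<and>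
     (\<exists>W V I \<beta>. open W \<and> L \<subseteq> W \<and> open V \<and> open I \<and> V \<subseteq> UNIV \<times> I \<and>
        real_analytic_on \<alpha> I \<and> real_analytic2_on \<beta> V \<and>
        S \<inter> W = surface (graph_t (\<lambda>x y. y + \<alpha> y / 2 * x\<^sup>2 + \<beta> x y * x ^ 3)) V)"

datatype zmc_class =
  Alpha_plus | Alpha_zero_I | Alpha_zero_II | Alpha_minus_I | Alpha_minus_II | Alpha_minus_III

fun class_solution :: "zmc_class \<Rightarrow> (real \<Rightarrow> real) \<Rightarrow> real set \<Rightarrow> bool" where
  "class_solution Alpha_plus \<alpha> J \<longleftrightarrow> (\<exists>c. \<bar>c\<bar> < pi / 2 \<and> (\<forall>y\<in>J. \<alpha> y = - tan (y + c)))"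
| "class_solution Alpha_zero_I \<alpha> J \<longleftrightarrow> (\<forall>y\<in>J. \<alpha> y = 0)"
| "class_solution Alpha_zero_II \<alpha> J \<longleftrightarrow> (\<exists>c. c \<noteq> 0 \<and> (\<forall>y\<in>J. \<alpha> y = 1 / (y + c)))"
| "class_solution Alpha_minus_I \<alpha> J \<longleftrightarrow> (\<exists>c. \<forall>y\<in>J. \<alpha> y = tanh (y + c))"
| "class_solution Alpha_minus_II \<alpha> J \<longleftrightarrow>
     (\<exists>c. c \<noteq> 0 \<and> (\<forall>y\<in>J. \<alpha> y = cosh (y + c) / sinh (y + c)))"
| "class_solution Alpha_minus_III \<alpha> J \<longleftrightarrow> (\<forall>y\<in>J. \<alpha> y = 1) \<or> (\<forall>y\<in>J. \<alpha> y = - 1)"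

text \<open>The class along \<open>L\<close> is read off after an isometry \<open>T\<close> fixing the origin, which moves \<open>L\<close>
  into the line of all \<open>(y, 0, y)\<close>, and a homothety of ratio \<open>k\<close>, which normalizes the
  characteristic to \<open>1\<close>, \<open>0\<close> or \<open>-1\<close>.\<close>

definition class_along :: "L3 set \<Rightarrow> L3 set \<Rightarrow> zmc_class \<Rightarrow> bool" where
  "class_along S L C \<longleftrightarrow>
     (\<exists>T k \<alpha>. linear_isometry_L3 T \<and> k > 0 \<and>
        approximation_function ((\<lambda>p. k *\<^sub>R T p) ` S) ((\<lambda>p. k *\<^sub>R T p) ` L) \<alpha> \<and>
        class_solution C \<alpha> {y. (y, 0, y) \<in> (\<lambda>p. k *\<^sub>R T p) ` L})"


section \<open>Wick rotation\<close>

text \<open>The value \<open>g(is, y)\<close>, obtained by substituting \<open>is\<close> for \<open>x\<close> in the Taylor expansion of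
  \<open>g(x, y)\<close> in \<open>x\<close> at \<open>0\<close>.\<close>

definition x_taylor_coeff :: "(real \<Rightarrow> real \<Rightarrow> real) \<Rightarrow> nat \<Rightarrow> real \<Rightarrow> real" where
  "x_taylor_coeff g n y = (deriv ^^ n) (\<lambda>x. g x y) 0 / fact n"

definition wick_term :: "(real \<Rightarrow> real \<Rightarrow> real) \<Rightarrow> real \<Rightarrow> real \<Rightarrow> nat \<Rightarrow> complex" where
  "wick_term g s y n = complex_of_real (x_taylor_coeff g n y) * (\<i> * complex_of_real s) ^ n"

definition wick :: "(real \<Rightarrow> real \<Rightarrow> real) \<Rightarrow> real \<Rightarrow> real \<Rightarrow> complex" where
  "wick g s y = (\<Sum>n. wick_term g s y n)"

end

theory Submission
  imports Defs "HOL-Complex_Analysis.Complex_Analysis"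
begin

text \<open>
  The rotated function solves the Born-Infeld equation for a formal reason. The Taylor series of
  \<open>g\<close> at the origin extends \<open>g\<close> to a holomorphic function \<open>F\<close> of two complex variables, and by the
  identity theorem \<open>F\<close> solves the zero mean curvature equation at complex \<open>x\<close> as well
  (\<open>complex_zero_mean_curvature\<close>). Substituting \<open>\<i>x\<close> for \<open>x\<close> multiplies every \<open>x\<close>-derivative by \<open>\<i>\<close>,
  which turns one equation into the other (\<open>rotated_pde_square_one\<close>,
  \<open>rotated_pde_square_minus_one\<close>); the parity of \<open>g\<close> makes \<open>F\<close>, respectively \<open>-\<i>F\<close>, real there.

  The work lies in the classes. If the segment is \<open>t = y, x = 0\<close> and the surface is
  \<open>t = y + \<alpha>(y)/2 x^2 + \<dots>\<close>, the coefficient of \<open>x^2\<close> in the equation says \<open>\<alpha>'' + 2 \<alpha> \<alpha>' = 0\<close>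
  (\<open>pde_coefficient_relation\<close>), hence \<open>\<alpha>' + \<alpha>^2 + \<mu> = 0\<close> with a constant \<open>\<mu>\<close>
  (\<open>riccati_of_pde\<close>). A solution of this Riccati equation on an interval around 0 is determined by
  \<open>\<alpha>(0)\<close> and \<open>\<mu>\<close>, and after normalizing \<open>\<mu>\<close> its class depends only on the sign of \<open>\<mu>\<close> and on the
  comparison of \<open>\<alpha>(0)^2\<close> with \<open>-\<mu>\<close> (\<open>class_cond\<close>). An isometry followed by a homothety replaces
  \<open>\<alpha>(y)\<close> by \<open>\<alpha>(y/l)/l\<close> and \<open>\<mu>\<close> by \<open>\<mu>/l^2\<close> (\<open>approximation_function_transport\<close>), so this
  criterion does not depend on the chosen position: \<open>class_along_iff_class_cond\<close>.

  It remains to compare the pairs \<open>(\<alpha>(0), \<mu>)\<close>. The rotated surface \<open>y = h(t, x)\<close> has to be written as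
  a graph over the \<open>(x, y)\<close>-plane first; this is an analytic implicit function theorem
  (\<open>implicit_graph\<close>), obtained from Picard iteration over the complex numbers and Osgood's lemma.
  For even \<open>g\<close> the rotation leaves \<open>\<alpha>(0)^2\<close> and \<open>\<mu>\<close> unchanged. For odd \<open>g\<close> the line is the
  \<open>x\<close>-direction, \<open>\<alpha>\<close> is odd, thus \<open>\<alpha>(0) = 0\<close> on both sides, and \<open>\<mu>\<close> changes its sign.
\<close>

section \<open>Convergent power series in two variables\<close>

text \<open>
  One predicate covers real and complex functions, so that passing to complex arguments only changes
  the type of the coefficients. The sum is unconditional over all pairs of exponents, which for
  real and complex terms is absolute convergence.
\<close>
definition pseries2 ::
  "(nat \<Rightarrow> nat \<Rightarrow> 'a::real_normed_field) \<Rightarrow> real \<Rightarrow> ('a \<Rightarrow> 'a \<Rightarrow> 'a) \<Rightarrow> bool" where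
  "pseries2 c r f \<longleftrightarrow>
     (\<forall>z w. norm z < r \<longrightarrow> norm w < r \<longrightarrow>
        ((\<lambda>(m, n). c m n * z ^ m * w ^ n) has_sum f z w) UNIV)"

definition dcoeff1 :: "(nat \<Rightarrow> nat \<Rightarrow> 'a::real_normed_field) \<Rightarrow> nat \<Rightarrow> nat \<Rightarrow> 'a" where
  "dcoeff1 c = (\<lambda>m n. of_nat (Suc m) * c (Suc m) n)"

definition dcoeff2 :: "(nat \<Rightarrow> nat \<Rightarrow> 'a::real_normed_field) \<Rightarrow> nat \<Rightarrow> nat \<Rightarrow> 'a" where
  "dcoeff2 c = (\<lambda>m n. of_nat (Suc n) * c m (Suc n))"

lemma pseries2D:
  "pseries2 c r f \<Longrightarrow> norm z < r \<Longrightarrow> norm w < r \<Longrightarrow>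
     ((\<lambda>(m, n). c m n * z ^ m * w ^ n) has_sum f z w) UNIV"
  by (simp add: pseries2_def)

lemma pseries2_mono: "pseries2 c r f \<Longrightarrow> s \<le> r \<Longrightarrow> pseries2 c s f"
  by (auto simp: pseries2_def)

lemma pseries2_cong:
  assumes "pseries2 c r f" "\<And>z w. norm z < r \<Longrightarrow> norm w < r \<Longrightarrow> f z w = g z w"
  shows "pseries2 c r g"
  using assms by (auto simp: pseries2_def)

lemma pseries2_swap:
  assumes "pseries2 c r f"
  shows "pseries2 (\<lambda>m n. c n m) r (\<lambda>z w. f w z)"
  unfolding pseries2_def
proof (intro allI impI)
  fix z w :: 'a assume zw: "norm z < r" "norm w < r"
  have "((\<lambda>(m, n). c m n * w ^ m * z ^ n) has_sum f w z) (prod.swap ` UNIV)"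
    using pseries2D[OF assms zw(2,1)] by (simp add: surj_swap)
  then have "(((\<lambda>(m, n). c m n * w ^ m * z ^ n) \<circ> prod.swap) has_sum f w z) UNIV"
    by (subst (asm) has_sum_reindex) (auto simp: inj_swap)
  then show "((\<lambda>(m, n). c n m * z ^ m * w ^ n) has_sum f w z) UNIV"
    by (simp add: o_def case_prod_unfold mult_ac)
qed

lemma pseries2_at_0:
  assumes "pseries2 c r f" "r > 0"
  shows "f 0 0 = c 0 0"
proof -
  have "((\<lambda>(m, n). c m n * 0 ^ m * 0 ^ n) has_sum f 0 0) UNIV"
    using assms by (intro pseries2D) auto
  moreover have "((\<lambda>(m, n). c m n * 0 ^ m * 0 ^ n) has_sum c 0 0) UNIV"
  proof -
    have "((\<lambda>(m, n). c m n * 0 ^ m * 0 ^ n) has_sum c 0 0) {(0::nat,0::nat)}"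
      by (rule has_sum_finiteI) auto
    then show ?thesis
      by (rule has_sum_cong_neutral[THEN iffD1, rotated -1]) (auto simp: power_0_left split: if_splits)
  qed
  ultimately show ?thesis by (rule has_sum_unique)
qed

lemma pseries2_unique_value:
  assumes "pseries2 c r f" "pseries2 c r g" "norm z < r" "norm w < r"
  shows "f z w = g z w"
  using has_sum_unique[OF pseries2D[OF assms(1,3,4)] pseries2D[OF assms(2,3,4)]] .

lemma pseries2_section0:
  fixes f :: "'a::real_normed_field \<Rightarrow> 'a \<Rightarrow> 'a"
  assumes f: "pseries2 c r f" and w: "norm w < r"
  shows "((\<lambda>n. c 0 n * w ^ n) has_sum f 0 w) UNIV"
proof -
  have "0 < r" using w norm_ge_zero[of w] by linarith
  then have "((\<lambda>(m, n). c m n * 0 ^ m * w ^ n) has_sum f 0 w) UNIV"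
    using w by (intro pseries2D[OF f]) auto
  then have "((\<lambda>(m, n). c m n * 0 ^ m * w ^ n) has_sum f 0 w) (range (Pair 0))"
  proof (rule has_sum_cong_neutral[THEN iffD1, rotated -1])
    show "(\<lambda>(m, n). c m n * 0 ^ m * w ^ n) p = 0" if "p \<in> UNIV - range (Pair 0)" for p
    proof (cases p)
      case (Pair m n)
      then have "m \<noteq> 0" using that by auto
      then show ?thesis by (simp add: Pair)
    qed
  qed auto
  then show ?thesis
    by (subst (asm) has_sum_reindex) (auto simp: inj_on_def o_def)
qed

lemma pseries2_scale:
  fixes f :: "real \<Rightarrow> real \<Rightarrow> real"
  assumes f: "pseries2 c r f" and k: "\<bar>k\<bar> * s \<le> r" "\<bar>l\<bar> * s \<le> r" "k \<noteq> 0" "l \<noteq> 0"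
  shows "pseries2 (\<lambda>m n. b * (c m n * k ^ m * l ^ n)) s (\<lambda>x y. b * f (k * x) (l * y))"
  unfolding pseries2_def
proof (intro allI impI)
  fix x y :: real assume "norm x < s" "norm y < s"
  then have "\<bar>k\<bar> * \<bar>x\<bar> < \<bar>k\<bar> * s" "\<bar>l\<bar> * \<bar>y\<bar> < \<bar>l\<bar> * s" using k by auto
  then have "norm (k * x) < r" "norm (l * y) < r" using k(1,2) unfolding real_norm_def abs_mult by linarith+
  then have "((\<lambda>p. b * (\<lambda>(m, n). c m n * (k * x) ^ m * (l * y) ^ n) p) has_sum b * f (k * x) (l * y)) UNIV"
    by (intro has_sum_cmult_right pseries2D[OF f])
  then show "((\<lambda>(m, n). b * (c m n * k ^ m * l ^ n) * x ^ m * y ^ n) has_sum b * f (k * x) (l * y)) UNIV"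
    by (simp add: case_prod_unfold power_mult_distrib mult_ac)
qed

lemma pseries2_reflect:
  fixes f :: "real \<Rightarrow> real \<Rightarrow> real"
  assumes f: "pseries2 c r f" and \<sigma>: "\<bar>\<sigma>\<bar> = 1"
  shows "pseries2 (\<lambda>m n. c m n * \<sigma> ^ n) r (\<lambda>x y. f x (\<sigma> * y))"
proof -
  have "\<sigma> \<noteq> 0" using \<sigma> by auto
  from pseries2_scale[OF f, of 1 r \<sigma> 1] this \<sigma> show ?thesis by simp
qed

lemma pseries2_abs_summable_real:
  fixes f :: "real \<Rightarrow> real \<Rightarrow> real"
  assumes "pseries2 c r f" "0 \<le> \<rho>" "\<rho> < r"
  shows "(\<lambda>(m, n). \<bar>c m n\<bar> * \<rho> ^ m * \<rho> ^ n) summable_on UNIV"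
proof -
  have "(\<lambda>(m, n). c m n * \<rho> ^ m * \<rho> ^ n) summable_on UNIV"
    using pseries2D[OF assms(1), of \<rho> \<rho>] assms by (auto intro: has_sum_imp_summable)
  then have "(\<lambda>p. norm ((\<lambda>(m, n). c m n * \<rho> ^ m * \<rho> ^ n) p)) summable_on UNIV"
    using summable_on_iff_abs_summable_on_real by blast
  then show ?thesis
    using assms(2) by (simp add: case_prod_unfold abs_mult)
qed

lemma pseries2_abs_summable_complex:
  fixes f :: "complex \<Rightarrow> complex \<Rightarrow> complex"
  assumes "pseries2 c r f" "0 \<le> \<rho>" "\<rho> < r"
  shows "(\<lambda>(m, n). norm (c m n) * \<rho> ^ m * \<rho> ^ n) summable_on UNIV"
proof -
  have "(\<lambda>(m, n). c m n * of_real \<rho> ^ m * of_real \<rho> ^ n) summable_on UNIV"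
    using pseries2D[OF assms(1), of "of_real \<rho>" "of_real \<rho>"] assms
    by (auto intro: has_sum_imp_summable)
  then have "(\<lambda>p. norm ((\<lambda>(m, n). c m n * of_real \<rho> ^ m * of_real \<rho> ^ n) p)) summable_on UNIV"
    using summable_on_iff_abs_summable_on_complex by blast
  then show ?thesis
    using assms(2) by (simp add: case_prod_unfold norm_mult norm_power)
qed

lemma pseries2_complexI:
  fixes c :: "nat \<Rightarrow> nat \<Rightarrow> complex"
  assumes "\<And>\<rho>. 0 \<le> \<rho> \<Longrightarrow> \<rho> < r \<Longrightarrow> (\<lambda>(m, n). norm (c m n) * \<rho> ^ m * \<rho> ^ n) summable_on UNIV"
  shows "pseries2 c r (\<lambda>z w. \<Sum>\<^sub>\<infinity>(m, n)\<in>UNIV. c m n * z ^ m * w ^ n)"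
  unfolding pseries2_def
proof (intro allI impI)
  fix z w :: complex assume zw: "norm z < r" "norm w < r"
  define \<rho> where "\<rho> = max (norm z) (norm w)"
  have \<rho>: "0 \<le> \<rho>" "\<rho> < r" "norm z \<le> \<rho>" "norm w \<le> \<rho>"
    using zw by (auto simp: \<rho>_def le_max_iff_disj)
  have "(\<lambda>p. norm ((\<lambda>(m, n). c m n * z ^ m * w ^ n) p)) summable_on UNIV"
    using assms[OF \<rho>(1,2)]
  proof (rule Infinite_Sum.abs_summable_on_comparison_test')
    fix p :: "nat \<times> nat"
    obtain m n where p: "p = (m, n)" by (cases p)
    show "norm ((\<lambda>(m, n). c m n * z ^ m * w ^ n) p) \<le> (\<lambda>(m, n). norm (c m n) * \<rho> ^ m * \<rho> ^ n) p"
      using \<rho> by (auto simp: p norm_mult norm_power intro!: mult_mono power_mono)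
  qed
  then have "(\<lambda>(m, n). c m n * z ^ m * w ^ n) summable_on UNIV"
    by (rule abs_summable_summable)
  then show "((\<lambda>(m, n). c m n * z ^ m * w ^ n) has_sum (\<Sum>\<^sub>\<infinity>(m, n)\<in>UNIV. c m n * z ^ m * w ^ n)) UNIV"
    by (rule has_sum_infsum)
qed

text \<open>
  Absolute convergence at the real point \<open>(\<rho>, \<rho>)\<close> makes the same coefficients converge at all \<open>(z, w)\<close>
  in the bidisc of radius \<open>\<rho>\<close>. Since they are real, the extension commutes with conjugation.
\<close>
lemma pseries2_complexification:
  fixes f :: "real \<Rightarrow> real \<Rightarrow> real"
  assumes f: "pseries2 c r f"
  obtains F where "pseries2 (\<lambda>m n. complex_of_real (c m n)) r F"
    "\<And>x y. \<bar>x\<bar> < r \<Longrightarrow> \<bar>y\<bar> < r \<Longrightarrow> F (of_real x) (of_real y) = of_real (f x y)"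
    "\<And>z w. norm z < r \<Longrightarrow> norm w < r \<Longrightarrow> F (cnj z) (cnj w) = cnj (F z w)"
proof -
  define F where "F = (\<lambda>z w. \<Sum>\<^sub>\<infinity>(m, n)\<in>UNIV. complex_of_real (c m n) * z ^ m * w ^ n)"
  have F: "pseries2 (\<lambda>m n. complex_of_real (c m n)) r F"
    unfolding F_def using pseries2_abs_summable_real[OF f] by (intro pseries2_complexI) simp
  moreover have "F (of_real x) (of_real y) = of_real (f x y)" if "\<bar>x\<bar> < r" "\<bar>y\<bar> < r" for x y
  proof -
    have "((\<lambda>(m, n). complex_of_real (c m n) * of_real x ^ m * of_real y ^ n) has_sum
        F (of_real x) (of_real y)) UNIV"
      using that by (intro pseries2D[OF F]) auto
    moreover have "((\<lambda>p. complex_of_real ((\<lambda>(m, n). c m n * x ^ m * y ^ n) p)) has_sum of_real (f x y)) UNIV"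
      using that by (intro has_sum_of_real pseries2D[OF f]) auto
    ultimately show ?thesis
      by (auto simp: case_prod_unfold dest: has_sum_unique)
  qed
  moreover have "F (cnj z) (cnj w) = cnj (F z w)" if "norm z < r" "norm w < r" for z w
  proof -
    have "((\<lambda>p. cnj ((\<lambda>(m, n). complex_of_real (c m n) * z ^ m * w ^ n) p)) has_sum cnj (F z w)) UNIV"
      unfolding has_sum_cnj_iff using that by (intro pseries2D[OF F])
    moreover have "((\<lambda>(m, n). complex_of_real (c m n) * cnj z ^ m * cnj w ^ n) has_sum
        F (cnj z) (cnj w)) UNIV"
      using that by (intro pseries2D[OF F]) auto
    ultimately show ?thesis
      by (auto simp: case_prod_unfold dest: has_sum_unique)
  qed
  ultimately show ?thesis using that by blast
qed

lemma pseries2_complexification_value: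
  fixes f :: "real \<Rightarrow> real \<Rightarrow> real"
  assumes F: "pseries2 (\<lambda>m n. complex_of_real (c m n)) r F" and f: "pseries2 c r f"
    and xy: "\<bar>x\<bar> < r" "\<bar>y\<bar> < r"
  shows "F (of_real x) (of_real y) = of_real (f x y)"
proof -
  obtain G where G: "pseries2 (\<lambda>m n. complex_of_real (c m n)) r G"
    and Gf: "\<And>x y. \<bar>x\<bar> < r \<Longrightarrow> \<bar>y\<bar> < r \<Longrightarrow> G (of_real x) (of_real y) = of_real (f x y)"
    using pseries2_complexification[OF f] by metis
  show ?thesis
    using pseries2_unique_value[OF F G, of "of_real x" "of_real y"] Gf[OF xy] xy by simp
qed

section \<open>Holomorphy and termwise differentiation\<close>

lemma holomorphic_on_uniform_limit:
  assumes lim: "uniform_limit A f g F" and hol: "\<forall>\<^sub>F n in F. f n holomorphic_on A"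
    and F: "F \<noteq> bot" and A: "open A"
  shows "g holomorphic_on A"
proof -
  have "g field_differentiable (at z)" if z: "z \<in> A" for z
  proof -
    obtain r where r: "r > 0" "cball z r \<subseteq> A"
      using A z by (meson open_contains_cball)
    have "\<forall>\<^sub>F n in F. continuous_on (cball z r) (f n) \<and> f n holomorphic_on ball z r"
      using hol by eventually_elim
        (meson r(2) ball_subset_cball holomorphic_on_imp_continuous_on holomorphic_on_subset order_trans)
    moreover have "uniform_limit (cball z r) f g F"
      using lim r(2) by (rule uniform_limit_on_subset)
    ultimately have "g holomorphic_on ball z r"
      using F by (metis holomorphic_uniform_limit)
    then show ?thesis
      using r(1) by (simp add: holomorphic_on_imp_differentiable_at)
  qed
  then show ?thesis
    by (simp add: holomorphic_on_def field_differentiable_at_within)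
qed

text \<open>
  The Weierstrass majorant is the absolute series at \<open>(\<rho>, \<rho>)\<close>. Both arguments may be functions of one
  parameter; this will make compositions holomorphic without differentiating them.
\<close>
lemma pseries2_uniform_limit:
  fixes f :: "complex \<Rightarrow> complex \<Rightarrow> complex"
  assumes f: "pseries2 c r f" and \<rho>: "0 \<le> \<rho>" "\<rho> < r"
    and bd: "\<And>x. x \<in> A \<Longrightarrow> norm (\<phi> x) \<le> \<rho>" "\<And>x. x \<in> A \<Longrightarrow> norm (\<psi> x) \<le> \<rho>"
  shows "uniform_limit A (\<lambda>X x. \<Sum>(m, n)\<in>X. c m n * \<phi> x ^ m * \<psi> x ^ n) (\<lambda>x. f (\<phi> x) (\<psi> x))
           (finite_subsets_at_top UNIV)"
proof -
  have "uniform_limit A (\<lambda>X x. \<Sum>p\<in>X. (\<lambda>p x. (\<lambda>(m, n). c m n * \<phi> x ^ m * \<psi> x ^ n) p) p x)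
      (\<lambda>x. f (\<phi> x) (\<psi> x)) (finite_subsets_at_top UNIV)"
  proof (rule Weierstrass_m_test_general')
    show "(\<lambda>(m, n). norm (c m n) * \<rho> ^ m * \<rho> ^ n) summable_on UNIV"
      using f \<rho> by (rule pseries2_abs_summable_complex)
    show "((\<lambda>p. (\<lambda>(m, n). c m n * \<phi> x ^ m * \<psi> x ^ n) p) has_sum f (\<phi> x) (\<psi> x)) UNIV"
      if "x \<in> A" for x
      using bd[OF that] \<rho> by (intro pseries2D[OF f]) auto
    show "norm ((\<lambda>(m, n). c m n * \<phi> x ^ m * \<psi> x ^ n) p) \<le>
        (\<lambda>(m, n). norm (c m n) * \<rho> ^ m * \<rho> ^ n) p" if "x \<in> A" for p x
      using bd[OF that] \<rho>
      by (cases p) (auto simp: norm_mult norm_power intro!: mult_mono power_mono)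
  qed
  then show ?thesis by simp
qed

lemma pseries2_compose_holomorphic:
  fixes f :: "complex \<Rightarrow> complex \<Rightarrow> complex"
  assumes f: "pseries2 c r f" and \<rho>: "0 \<le> \<rho>" "\<rho> < r" and A: "open A"
    and hol: "\<phi> holomorphic_on A" "\<psi> holomorphic_on A"
    and bd: "\<And>x. x \<in> A \<Longrightarrow> norm (\<phi> x) \<le> \<rho>" "\<And>x. x \<in> A \<Longrightarrow> norm (\<psi> x) \<le> \<rho>"
  shows "(\<lambda>x. f (\<phi> x) (\<psi> x)) holomorphic_on A"
proof (rule holomorphic_on_uniform_limit[OF pseries2_uniform_limit[OF f \<rho> bd]])
  show "\<forall>\<^sub>F X in finite_subsets_at_top UNIV.
      (\<lambda>x. \<Sum>(m, n)\<in>X. c m n * \<phi> x ^ m * \<psi> x ^ n) holomorphic_on A"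
    unfolding case_prod_unfold by (intro always_eventually allI holomorphic_intros hol)
qed (use A in auto)

lemma pseries2_holomorphic1:
  fixes f :: "complex \<Rightarrow> complex \<Rightarrow> complex"
  assumes f: "pseries2 c r f" and w: "norm w < r"
  shows "(\<lambda>z. f z w) holomorphic_on ball 0 r"
proof -
  have "(\<lambda>z. f z w) field_differentiable (at z)" if z: "norm z < r" for z
  proof -
    obtain \<rho> where \<rho>: "max (norm z) (norm w) < \<rho>" "\<rho> < r"
      using z w dense[of "max (norm z) (norm w)" r] by (metis max_less_iff_conj)
    have \<rho>0: "0 \<le> \<rho>"
      using \<rho>(1) norm_ge_zero[of z] by linarith
    have "(\<lambda>z. f z w) holomorphic_on ball 0 \<rho>"
      using \<rho> \<rho>0 by (intro pseries2_compose_holomorphic[OF f, of \<rho>]) auto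
    then show ?thesis
      using \<rho> by (simp add: holomorphic_on_imp_differentiable_at)
  qed
  then show ?thesis
    by (simp add: holomorphic_on_def field_differentiable_at_within)
qed

lemma pseries2_holomorphic2:
  fixes f :: "complex \<Rightarrow> complex \<Rightarrow> complex"
  assumes f: "pseries2 c r f" and z: "norm z < r"
  shows "(\<lambda>w. f z w) holomorphic_on ball 0 r"
  using pseries2_holomorphic1[OF pseries2_swap[OF f] z] .

lemma pseries2_bounded:
  fixes f :: "complex \<Rightarrow> complex \<Rightarrow> complex"
  assumes f: "pseries2 c r f" and \<rho>: "0 \<le> \<rho>" "\<rho> < r"
  obtains M where "M \<ge> 0" "\<And>z w. norm z \<le> \<rho> \<Longrightarrow> norm w \<le> \<rho> \<Longrightarrow> norm (f z w) \<le> M"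
proof -
  define M where "M = (\<Sum>\<^sub>\<infinity>(m, n)\<in>UNIV. norm (c m n) * \<rho> ^ m * \<rho> ^ n)"
  have M: "((\<lambda>(m, n). norm (c m n) * \<rho> ^ m * \<rho> ^ n) has_sum M) UNIV"
    unfolding M_def using pseries2_abs_summable_complex[OF f \<rho>] by (rule has_sum_infsum)
  have "norm (f z w) \<le> M" if "norm z \<le> \<rho>" "norm w \<le> \<rho>" for z w
  proof -
    have fs: "((\<lambda>(m, n). c m n * z ^ m * w ^ n) has_sum f z w) UNIV"
      using that \<rho> by (intro pseries2D[OF f]) auto
    have le: "norm ((\<lambda>(m, n). c m n * z ^ m * w ^ n) p) \<le>
        (\<lambda>(m, n). norm (c m n) * \<rho> ^ m * \<rho> ^ n) p" for p
      using that \<rho> by (cases p) (auto simp: norm_mult norm_power intro!: mult_mono power_mono)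
    then show ?thesis
      by (intro norm_infsum_le[OF fs M])
  qed
  moreover have "M \<ge> 0"
    using \<rho> by (intro has_sum_nonneg[OF M]) auto
  ultimately show ?thesis using that by blast
qed

lemma pseries2_bounded_real:
  fixes f :: "real \<Rightarrow> real \<Rightarrow> real"
  assumes f: "pseries2 c r f" and \<rho>: "0 \<le> \<rho>" "\<rho> < r"
  obtains M where "M \<ge> 0" "\<And>x y. \<bar>x\<bar> \<le> \<rho> \<Longrightarrow> \<bar>y\<bar> \<le> \<rho> \<Longrightarrow> \<bar>f x y\<bar> \<le> M"
proof -
  obtain F where F: "pseries2 (\<lambda>m n. complex_of_real (c m n)) r F"
    and Ff: "\<And>x y. \<bar>x\<bar> < r \<Longrightarrow> \<bar>y\<bar> < r \<Longrightarrow> F (of_real x) (of_real y) = of_real (f x y)"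
    using pseries2_complexification[OF f] by metis
  obtain M where M: "M \<ge> 0" "\<And>z w. norm z \<le> \<rho> \<Longrightarrow> norm w \<le> \<rho> \<Longrightarrow> norm (F z w) \<le> M"
    using pseries2_bounded[OF F \<rho>] by metis
  have "\<bar>f x y\<bar> \<le> M" if xy: "\<bar>x\<bar> \<le> \<rho>" "\<bar>y\<bar> \<le> \<rho>" for x y
  proof -
    have "norm (F (of_real x) (of_real y)) \<le> M" using xy by (intro M(2)) auto
    then show ?thesis using Ff[of x y] xy \<rho> by simp
  qed
  with M(1) show ?thesis using that by blast
qed

text \<open>
  By Weierstrass' theorem derivatives of a locally uniformly convergent net of holomorphic functions
  converge. Applied to the finite partial sums, this says that the termwise
  differentiated series converges and has the derivative as its sum.
\<close>
lemma pseries2_deriv1_complex: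
  fixes f :: "complex \<Rightarrow> complex \<Rightarrow> complex"
  assumes f: "pseries2 c r f"
  shows "pseries2 (dcoeff1 c) r (\<lambda>z w. deriv (\<lambda>s. f s w) z)"
  unfolding pseries2_def
proof (intro allI impI)
  fix z w :: complex assume zw: "norm z < r" "norm w < r"
  obtain \<rho> where \<rho>: "max (norm z) (norm w) < \<rho>" "\<rho> < r"
    using zw dense[of "max (norm z) (norm w)" r] by (metis max_less_iff_conj)
  have \<rho>0: "0 \<le> \<rho>" using \<rho>(1) norm_ge_zero[of z] by linarith
  have lim: "uniform_limit (ball 0 \<rho>) (\<lambda>X s. \<Sum>(m, n)\<in>X. c m n * s ^ m * w ^ n) (\<lambda>s. f s w)
      (finite_subsets_at_top UNIV)"
    using \<rho> \<rho>0 by (intro pseries2_uniform_limit[OF f, of \<rho>]) auto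
  have "((\<lambda>X. (deriv ^^ 1) (\<lambda>s. \<Sum>(m, n)\<in>X. c m n * s ^ m * w ^ n) z) \<longlongrightarrow>
      (deriv ^^ 1) (\<lambda>s. f s w) z) (finite_subsets_at_top UNIV)"
  proof (rule higher_deriv_complex_uniform_limit[OF lim])
    show "\<forall>\<^sub>F X in finite_subsets_at_top UNIV.
        (\<lambda>s. \<Sum>(m, n)\<in>X. c m n * s ^ m * w ^ n) holomorphic_on ball 0 \<rho>"
      unfolding case_prod_unfold by (intro always_eventually allI holomorphic_intros)
  qed (use \<rho> in auto)
  moreover have "deriv (\<lambda>s. \<Sum>(m, n)\<in>X. c m n * s ^ m * w ^ n) z =
      (\<Sum>(m, n)\<in>X. c m n * (of_nat m * z ^ (m - 1)) * w ^ n)" for X :: "(nat \<times> nat) set"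
    unfolding case_prod_unfold
    by (rule DERIV_imp_deriv) (auto intro!: derivative_eq_intros sum.cong)
  ultimately have *: "((\<lambda>(m, n). c m n * (of_nat m * z ^ (m - 1)) * w ^ n) has_sum
      deriv (\<lambda>s. f s w) z) UNIV"
    by (simp add: has_sum_def)
  \<comment> \<open>the terms with exponent 0 vanish; the others are reindexed by lowering the exponent\<close>
  define h :: "nat \<times> nat \<Rightarrow> nat \<times> nat" where "h = (\<lambda>(m, n). (Suc m, n))"
  have "((\<lambda>(m, n). c m n * (of_nat m * z ^ (m - 1)) * w ^ n) has_sum
      deriv (\<lambda>s. f s w) z) (range h)"
  proof (rule has_sum_cong_neutral[THEN iffD1, rotated -1, OF *])
    fix p :: "nat \<times> nat" assume "p \<in> UNIV - range h"
    then have "fst p = 0"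
      by (cases p; cases "fst p") (auto simp: h_def image_iff)
    then show "(\<lambda>(m, n). c m n * (of_nat m * z ^ (m - 1)) * w ^ n) p = 0"
      by (cases p) auto
  qed auto
  then have "(((\<lambda>(m, n). c m n * (of_nat m * z ^ (m - 1)) * w ^ n) \<circ> h) has_sum
      deriv (\<lambda>s. f s w) z) UNIV"
    by (subst (asm) has_sum_reindex) (auto simp: h_def inj_on_def)
  then show "((\<lambda>(m, n). dcoeff1 c m n * z ^ m * w ^ n) has_sum deriv (\<lambda>s. f s w) z) UNIV"
    by (simp add: o_def h_def dcoeff1_def case_prod_unfold mult_ac)
qed

lemma pseries2_deriv2_complex:
  fixes f :: "complex \<Rightarrow> complex \<Rightarrow> complex"
  assumes f: "pseries2 c r f"
  shows "pseries2 (dcoeff2 c) r (\<lambda>z w. deriv (f z) w)"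
  using pseries2_swap[OF pseries2_deriv1_complex[OF pseries2_swap[OF f]]]
  by (simp add: dcoeff1_def dcoeff2_def)

lemma pseries2_lipschitz2:
  fixes f :: "complex \<Rightarrow> complex \<Rightarrow> complex"
  assumes f: "pseries2 c r f" and s: "0 \<le> s" "s < r"
  obtains N where "N \<ge> 0"
    "\<And>z w w'. norm z \<le> s \<Longrightarrow> norm w \<le> s \<Longrightarrow> norm w' \<le> s \<Longrightarrow> norm (f z w - f z w') \<le> N * norm (w - w')"
proof -
  obtain N where N: "N \<ge> 0" "\<And>z w. norm z \<le> s \<Longrightarrow> norm w \<le> s \<Longrightarrow> norm (deriv (f z) w) \<le> N"
    using pseries2_bounded[OF pseries2_deriv2_complex[OF f] s] by metis
  have "norm (f z w - f z w') \<le> N * norm (w - w')" if "norm z \<le> s" "norm w \<le> s" "norm w' \<le> s" for z w w'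
  proof (rule field_differentiable_bound[of "cball 0 s" "f z" "deriv (f z)"])
    fix v :: complex assume v: "v \<in> cball 0 s"
    have "(f z has_field_derivative deriv (f z) v) (at v)"
      using v s that by (intro holomorphic_derivI[OF pseries2_holomorphic2[OF f, of z]]) auto
    then show "(f z has_field_derivative deriv (f z) v) (at v within cball 0 s)"
      by (rule has_field_derivative_at_within)
  qed (use that N(2) in auto)
  with N(1) show ?thesis using that by blast
qed

text \<open>
  Obtained from the complex statement by restricting to real arguments.
\<close>
lemma pseries2_deriv1:
  fixes f :: "real \<Rightarrow> real \<Rightarrow> real"
  assumes f: "pseries2 c r f"
  shows "pseries2 (dcoeff1 c) r (D1 f)"
    and "\<bar>x\<bar> < r \<Longrightarrow> \<bar>y\<bar> < r \<Longrightarrow> ((\<lambda>s. f s y) has_real_derivative D1 f x y) (at x)"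
proof -
  obtain F where F: "pseries2 (\<lambda>m n. complex_of_real (c m n)) r F"
    and Ff: "\<And>x y. \<bar>x\<bar> < r \<Longrightarrow> \<bar>y\<bar> < r \<Longrightarrow> F (of_real x) (of_real y) = of_real (f x y)"
    using pseries2_complexification[OF f] by metis
  have der: "((\<lambda>s. f s y) has_real_derivative Re (deriv (\<lambda>s. F s (of_real y)) (of_real x))) (at x)"
    if xy: "\<bar>x\<bar> < r" "\<bar>y\<bar> < r" for x y
  proof -
    have "((\<lambda>s. F s (of_real y)) has_field_derivative deriv (\<lambda>s. F s (of_real y)) (of_real x))
        (at (of_real x))"
      using xy by (intro holomorphic_derivI[OF pseries2_holomorphic1[OF F]]) auto
    then have "((\<lambda>s. F (of_real s) (of_real y)) has_vector_derivative
        deriv (\<lambda>s. F s (of_real y)) (of_real x)) (at x)"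
      by (rule has_vector_derivative_real_field)
    then have "((\<lambda>s. Re (F (of_real s) (of_real y))) has_real_derivative
        Re (deriv (\<lambda>s. F s (of_real y)) (of_real x))) (at x)"
      by (rule has_field_derivative_Re)
    moreover have "open {-r<..<r}" "x \<in> {-r<..<r}" using xy by auto
    ultimately show ?thesis
      by (rule has_field_derivative_transform_within_open) (use xy Ff in auto)
  qed
  then have D: "D1 f x y = Re (deriv (\<lambda>s. F s (of_real y)) (of_real x))"
    if "\<bar>x\<bar> < r" "\<bar>y\<bar> < r" for x y
    unfolding D1_def using that by (intro DERIV_imp_deriv)
  show "\<bar>x\<bar> < r \<Longrightarrow> \<bar>y\<bar> < r \<Longrightarrow> ((\<lambda>s. f s y) has_real_derivative D1 f x y) (at x)"
    using der D by simp
  show "pseries2 (dcoeff1 c) r (D1 f)"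
    unfolding pseries2_def
  proof (intro allI impI)
    fix x y :: real assume xy: "norm x < r" "norm y < r"
    have "((\<lambda>(m, n). dcoeff1 (\<lambda>m n. complex_of_real (c m n)) m n * of_real x ^ m * of_real y ^ n) has_sum
        deriv (\<lambda>s. F s (of_real y)) (of_real x)) UNIV"
      using xy by (intro pseries2D[OF pseries2_deriv1_complex[OF F]]) auto
    then have "((\<lambda>p. Re ((\<lambda>(m, n). dcoeff1 (\<lambda>m n. complex_of_real (c m n)) m n * of_real x ^ m * of_real y ^ n) p)) has_sum
        D1 f x y) UNIV"
      using xy by (subst D) (auto intro: has_sum_Re)
    moreover have "Re ((\<lambda>(m, n). dcoeff1 (\<lambda>m n. complex_of_real (c m n)) m n * of_real x ^ m * of_real y ^ n) p)
        = (\<lambda>(m, n). dcoeff1 c m n * x ^ m * y ^ n) p" for p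
    proof -
      obtain m n where p: "p = (m, n)" by (cases p)
      have "dcoeff1 (\<lambda>m n. complex_of_real (c m n)) m n = complex_of_real (dcoeff1 c m n)"
        by (simp add: dcoeff1_def)
      then have "(\<lambda>(m, n). dcoeff1 (\<lambda>m n. complex_of_real (c m n)) m n * of_real x ^ m * of_real y ^ n) p =
          complex_of_real ((\<lambda>(m, n). dcoeff1 c m n * x ^ m * y ^ n) p)"
        by (simp add: p)
      then show ?thesis by (metis Re_complex_of_real)
    qed
    ultimately show "((\<lambda>(m, n). dcoeff1 c m n * x ^ m * y ^ n) has_sum D1 f x y) UNIV"
      by simp
  qed
qed

lemma pseries2_deriv2:
  fixes f :: "real \<Rightarrow> real \<Rightarrow> real"
  assumes f: "pseries2 c r f"
  shows "pseries2 (dcoeff2 c) r (D2 f)"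
    and "\<bar>x\<bar> < r \<Longrightarrow> \<bar>y\<bar> < r \<Longrightarrow> ((\<lambda>s. f x s) has_real_derivative D2 f x y) (at y)"
proof -
  have f': "pseries2 (\<lambda>m n. c n m) r (\<lambda>x y. f y x)"
    using f by (rule pseries2_swap)
  have D: "D1 (\<lambda>x y. f y x) = (\<lambda>x y. D2 f y x)"
    by (simp add: D1_def D2_def)
  show "\<bar>x\<bar> < r \<Longrightarrow> \<bar>y\<bar> < r \<Longrightarrow> ((\<lambda>s. f x s) has_real_derivative D2 f x y) (at y)"
    using pseries2_deriv1(2)[OF f', of y x] unfolding D by simp
  show "pseries2 (dcoeff2 c) r (D2 f)"
    using pseries2_swap[OF pseries2_deriv1(1)[OF f']] unfolding D
    by (simp add: dcoeff1_def dcoeff2_def)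
qed

lemma pseries2_mixed_partials:
  fixes f :: "real \<Rightarrow> real \<Rightarrow> real"
  assumes f: "pseries2 c r f" and xy: "\<bar>x\<bar> < r" "\<bar>y\<bar> < r"
  shows "D1 (D2 f) x y = D2 (D1 f) x y"
proof -
  have A: "pseries2 (dcoeff1 (dcoeff2 c)) r (D1 (D2 f))"
    by (rule pseries2_deriv1(1)[OF pseries2_deriv2(1)[OF f]])
  have "dcoeff2 (dcoeff1 c) = dcoeff1 (dcoeff2 c)"
    by (simp add: dcoeff1_def dcoeff2_def fun_eq_iff)
  then have B: "pseries2 (dcoeff1 (dcoeff2 c)) r (D2 (D1 f))"
    using pseries2_deriv2(1)[OF pseries2_deriv1(1)[OF f]] by simp
  show ?thesis using pseries2_unique_value[OF A B, of x y] xy by simp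
qed

text \<open>
  Splitting off the terms without the first variable; iterating it gives Taylor expansions in the
  first variable whose remainder is again a double series.
\<close>
lemma pseries2_shift:
  fixes f :: "real \<Rightarrow> real \<Rightarrow> real"
  assumes f: "pseries2 c r f"
  obtains f1 where "pseries2 (\<lambda>m. c (Suc m)) r f1"
    "\<And>x y. \<bar>x\<bar> < r \<Longrightarrow> \<bar>y\<bar> < r \<Longrightarrow> f x y = f 0 y + x * f1 x y"
proof -
  define f1 where "f1 = (\<lambda>x y. \<Sum>\<^sub>\<infinity>(m, n)\<in>UNIV. c (Suc m) n * x ^ m * y ^ n)"
  have f1: "pseries2 (\<lambda>m. c (Suc m)) r f1"
    unfolding pseries2_def
  proof (intro allI impI)
    fix x y :: real assume xy: "norm x < r" "norm y < r"
    obtain \<rho> where \<rho>: "max \<bar>x\<bar> \<bar>y\<bar> < \<rho>" "\<rho> < r"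
      using xy dense[of "max \<bar>x\<bar> \<bar>y\<bar>" r]
      by (metis max_less_iff_conj real_norm_def)
    then have \<rho>0: "0 < \<rho>" by auto
    have inj: "inj (\<lambda>(m::nat, n::nat). (Suc m, n))" by (auto simp: inj_on_def)
    have "(\<lambda>(m, n). \<bar>c m n\<bar> * \<rho> ^ m * \<rho> ^ n) summable_on range (\<lambda>(m::nat, n::nat). (Suc m, n))"
      by (rule summable_on_subset_banach[OF pseries2_abs_summable_real[OF f less_imp_le[OF \<rho>0] \<rho>(2)]]) auto
    then have "(\<lambda>(m, n). \<bar>c (Suc m) n\<bar> * \<rho> ^ (Suc m) * \<rho> ^ n) summable_on UNIV"
      by (subst (asm) summable_on_reindex[OF inj]) (simp add: o_def case_prod_unfold)
    then have "(\<lambda>p. (1 / \<rho>) * (\<lambda>(m, n). \<bar>c (Suc m) n\<bar> * \<rho> ^ (Suc m) * \<rho> ^ n) p) summable_on UNIV"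
      by (rule summable_on_cmult_right)
    then have "(\<lambda>p. norm ((\<lambda>(m, n). c (Suc m) n * x ^ m * y ^ n) p)) summable_on UNIV"
    proof (rule Infinite_Sum.abs_summable_on_comparison_test')
      fix p :: "nat \<times> nat"
      obtain m n where p: "p = (m, n)" by (cases p)
      have "norm (c (Suc m) n * x ^ m * y ^ n) \<le> \<bar>c (Suc m) n\<bar> * \<rho> ^ m * \<rho> ^ n"
        using \<rho> \<rho>0 by (auto simp: abs_mult power_abs intro!: mult_mono power_mono)
      then show "norm ((\<lambda>(m, n). c (Suc m) n * x ^ m * y ^ n) p) \<le>
          (1 / \<rho>) * (\<lambda>(m, n). \<bar>c (Suc m) n\<bar> * \<rho> ^ (Suc m) * \<rho> ^ n) p"
        using \<rho>0 by (simp add: p field_simps)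
    qed
    then have "(\<lambda>(m, n). c (Suc m) n * x ^ m * y ^ n) summable_on UNIV"
      by (rule abs_summable_summable)
    then show "((\<lambda>(m, n). c (Suc m) n * x ^ m * y ^ n) has_sum f1 x y) UNIV"
      unfolding f1_def by (rule has_sum_infsum)
  qed
  moreover have "f x y = f 0 y + x * f1 x y" if xy: "\<bar>x\<bar> < r" "\<bar>y\<bar> < r" for x y
  proof -
    define h :: "nat \<times> nat \<Rightarrow> nat \<times> nat" where "h = (\<lambda>(m, n). (Suc m, n))"
    define Z :: "(nat \<times> nat) set" where "Z = {0} \<times> UNIV"
    have UN: "UNIV = Z \<union> range h"
    proof -
      have "p \<in> Z \<union> range h" for p
        by (cases p; cases "fst p") (auto simp: Z_def h_def image_iff)
      then show ?thesis by auto
    qed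
    have "((\<lambda>(m, n). c m n * 0 ^ m * y ^ n) has_sum f 0 y) UNIV"
      using xy by (intro pseries2D[OF f]) auto
    then have "((\<lambda>(m, n). c m n * x ^ m * y ^ n) has_sum f 0 y) Z"
      by (rule has_sum_cong_neutral[THEN iffD1, rotated -1]) (auto simp: Z_def)
    moreover have "((\<lambda>(m, n). c m n * x ^ m * y ^ n) has_sum x * f1 x y) (range h)"
    proof (subst has_sum_reindex)
      have "((\<lambda>p. x * (\<lambda>(m, n). c (Suc m) n * x ^ m * y ^ n) p) has_sum x * f1 x y) UNIV"
        using xy by (intro has_sum_cmult_right pseries2D[OF f1]) auto
      then show "(((\<lambda>(m, n). c m n * x ^ m * y ^ n) \<circ> h) has_sum x * f1 x y) UNIV"
        by (simp add: h_def o_def case_prod_unfold mult_ac)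
    qed (auto simp: h_def inj_on_def)
    ultimately have split: "((\<lambda>(m, n). c m n * x ^ m * y ^ n) has_sum (f 0 y + x * f1 x y)) (Z \<union> range h)"
      by (rule has_sum_Un_disjoint) (auto simp: Z_def h_def)
    have "((\<lambda>(m, n). c m n * x ^ m * y ^ n) has_sum f x y) UNIV"
      using xy by (intro pseries2D[OF f]) auto
    from this split[folded UN] show ?thesis
      by (rule has_sum_unique)
  qed
  ultimately show ?thesis using that by blast
qed

section \<open>Osgood's lemma\<close>

lemma uniform_limit_null_bound:
  fixes f :: "nat \<Rightarrow> 'a \<Rightarrow> complex"
  assumes bd: "\<And>n x. x \<in> A \<Longrightarrow> norm (f n x - g x) \<le> b n" and lim: "b \<longlonglongrightarrow> 0"
  shows "uniform_limit A f g sequentially"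
proof (rule uniform_limitI)
  fix e :: real assume e: "e > 0"
  have "\<forall>\<^sub>F n in sequentially. b n < e"
    using lim e by (rule order_tendstoD)
  then show "\<forall>\<^sub>F n in sequentially. \<forall>x\<in>A. dist (f n x) (g x) < e"
    by eventually_elim (use bd in \<open>auto simp: dist_norm intro: le_less_trans\<close>)
qed

text \<open>
  The coefficient bound is the one given by Cauchy's inequality, and the tail is compared with a
  geometric series of ratio \<open>norm z / s\<close>.
\<close>
lemma power_series_remainder_bound:
  fixes a :: "nat \<Rightarrow> complex"
  assumes sums: "(\<lambda>m. a m * z ^ m) sums S" and bd: "\<And>m. norm (a m) \<le> M / s ^ m"
    and s: "0 < s" "norm z < s"
  shows "norm (S - (\<Sum>j<k. a j * z ^ j)) \<le> M * (norm z / s) ^ k / (1 - norm z / s)"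
proof -
  define q where "q = norm z / s"
  have q: "0 \<le> q" "q < 1" using s by (auto simp: q_def)
  have t: "norm (a (m + k) * z ^ (m + k)) \<le> M * q ^ k * q ^ m" for m
  proof -
    have "norm (a (m + k) * z ^ (m + k)) \<le> M / s ^ (m + k) * norm z ^ (m + k)"
      unfolding norm_mult norm_power using bd by (rule mult_right_mono) simp
    also have "\<dots> = M * q ^ k * q ^ m"
      by (simp add: q_def power_add power_divide mult_ac)
    finally show ?thesis .
  qed
  have g: "(\<lambda>m. M * q ^ k * q ^ m) sums (M * q ^ k * (1 / (1 - q)))"
    using q by (intro sums_mult geometric_sums) auto
  have "(\<lambda>m. a (m + k) * z ^ (m + k)) sums (S - (\<Sum>j<k. a j * z ^ j))"
    using sums by (rule sums_split_initial_segment)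
  then have "S - (\<Sum>j<k. a j * z ^ j) = (\<Sum>m. a (m + k) * z ^ (m + k))"
    by (rule sums_unique)
  moreover have "norm (\<Sum>m. a (m + k) * z ^ (m + k)) \<le> (\<Sum>m. M * q ^ k * q ^ m)"
    using t sums_summable[OF g] by (rule norm_suminf_le)
  ultimately show ?thesis
    using sums_unique[OF g] by (simp add: q_def)
qed

lemma geometric_summable_on:
  fixes p q :: real
  assumes "0 \<le> p" "p < 1" "0 \<le> q" "q < 1"
  shows "(\<lambda>(m, n). p ^ m * q ^ n) summable_on (UNIV :: (nat \<times> nat) set)"
proof -
  have g: "((\<lambda>n. x ^ n) has_sum (1 / (1 - x))) UNIV" if "0 \<le> x" "x < 1" for x :: real
    using that geometric_sums[of x] by (intro norm_summable_imp_has_sum) (auto intro: summable_geometric)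
  have "(\<lambda>(m, n). p ^ m * q ^ n) summable_on (Sigma UNIV (\<lambda>_. UNIV))"
  proof (rule summable_on_SigmaI)
    show "((\<lambda>n. (\<lambda>(m, n). p ^ m * q ^ n) (m, n)) has_sum p ^ m * (1 / (1 - q))) UNIV" for m :: nat
      using has_sum_cmult_right[OF g[OF assms(3,4)], of "p ^ m"] by simp
    show "(\<lambda>m. p ^ m * (1 / (1 - q))) summable_on UNIV"
      using g[OF assms(1,2)] by (intro summable_on_cmult_left) (auto simp: summable_on_def)
  qed (use assms in auto)
  then show ?thesis by simp
qed

text \<open>
  A bounded separately holomorphic function has a double power series. Let \<open>a m w\<close> be the Taylor
  coefficients of \<open>f\<close> in the first variable. They are holomorphic in \<open>w\<close>, by induction on \<open>m\<close>:
  \<open>a m\<close> is the uniform limit of \<open>(f z w - (\<Sum>j<m. a j w * z ^ j)) / z ^ m\<close> as \<open>z\<close> tends to 0.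
  Expanding each \<open>a m\<close> in turn yields the coefficients \<open>c m n\<close>, and two applications of Cauchy's
  inequality give the bound \<open>M / s ^ m / s ^ n\<close>, which makes the double series converge.
\<close>
lemma osgood:
  fixes f :: "complex \<Rightarrow> complex \<Rightarrow> complex"
  assumes hol1: "\<And>w. norm w < r \<Longrightarrow> (\<lambda>z. f z w) holomorphic_on ball 0 r"
    and hol2: "\<And>z. norm z < r \<Longrightarrow> (\<lambda>w. f z w) holomorphic_on ball 0 r"
    and bd: "\<And>z w. norm z < r \<Longrightarrow> norm w < r \<Longrightarrow> norm (f z w) \<le> M"
    and s: "0 < s" "s < r"
  obtains c where "pseries2 c s f"
proof -
  define a where "a = (\<lambda>m w. (deriv ^^ m) (\<lambda>z. f z w) 0 / fact m)"
  define c where "c = (\<lambda>m n. (deriv ^^ n) (a m) 0 / fact n)"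
  have cball_sub: "cball 0 s \<subseteq> ball (0::complex) r" and ball_sub: "ball 0 s \<subseteq> ball (0::complex) r"
    using s by auto
  have M0: "0 \<le> M"
    using order_trans[OF norm_ge_zero bd[of 0 0]] s by simp
  have a_sums: "(\<lambda>m. a m w * z ^ m) sums f z w" if "norm z < r" "norm w < r" for z w
    using holomorphic_power_series[OF hol1[OF that(2)], of z] that(1) by (simp add: a_def)
  have cauchy: "norm ((deriv ^^ m) h 0 / fact m) \<le> B / s ^ m"
    if "h holomorphic_on ball 0 r" "\<And>z. norm z < r \<Longrightarrow> norm (h z) \<le> B" for h :: "complex \<Rightarrow> complex" and m B
  proof -
    have "norm ((deriv ^^ m) h 0) \<le> fact m * B / s ^ m"
    proof (rule Cauchy_inequality)
      show "h holomorphic_on ball 0 s" using that(1) ball_sub by (rule holomorphic_on_subset)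
      show "continuous_on (cball 0 s) h"
        using that(1) cball_sub by (meson holomorphic_on_imp_continuous_on holomorphic_on_subset)
    qed (use s that(2) in auto)
    then have "norm ((deriv ^^ m) h 0) / fact m \<le> fact m * B / s ^ m / fact m"
      by (rule divide_right_mono) simp
    then show ?thesis by (simp add: norm_divide)
  qed
  have a_bd: "norm (a m w) \<le> M / s ^ m" if "norm w < r" for m w
    unfolding a_def using hol1[OF that] bd that by (intro cauchy) auto
  have a_hol: "a m holomorphic_on ball 0 r" for m
  proof (induction m rule: less_induct)
    case (less m)
    \<comment> \<open>a null sequence on which the ratio in the remainder bound is \<open>q N\<close>\<close>
    define z where "z = (\<lambda>N. complex_of_real (s / (2 + real N)))"
    define q where "q = (\<lambda>N. 1 / (2 + real N))"
    have nz: "norm (z N) = s / (2 + real N)" for N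
      unfolding z_def norm_of_real using s by simp
    have z: "z N \<noteq> 0" "norm (z N) < s" "norm (z N) / s = q N" for N
    proof -
      have pos: "0 < s / (2 + real N)" using s by simp
      then show "z N \<noteq> 0" using nz[of N] by auto
      have "s * 1 < s * (2 + real N)" using s by (intro mult_strict_left_mono) auto
      then show "norm (z N) < s" unfolding nz by (simp add: divide_less_eq)
      show "norm (z N) / s = q N" unfolding nz q_def using s by simp
    qed
    have "uniform_limit (ball 0 r) (\<lambda>N w. (f (z N) w - (\<Sum>j<m. a j w * z N ^ j)) / z N ^ m) (a m) sequentially"
    proof (rule uniform_limit_null_bound)
      fix N w assume w: "w \<in> ball (0::complex) r"
      then have "norm (f (z N) w - (\<Sum>j<Suc m. a j w * z N ^ j)) \<le>
          M * (norm (z N) / s) ^ Suc m / (1 - norm (z N) / s)"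
        using z[of N] s a_bd by (intro power_series_remainder_bound a_sums) auto
      then have "norm (f (z N) w - (\<Sum>j<Suc m. a j w * z N ^ j)) / norm (z N ^ m) \<le>
          M * (norm (z N) / s) ^ Suc m / (1 - norm (z N) / s) / norm (z N ^ m)"
        by (rule divide_right_mono) simp
      also have "\<dots> = M / s ^ m * (q N / (1 - q N))"
        using z(1)[of N] by (simp add: z(3)[symmetric] power_divide norm_power)
      finally have "norm ((f (z N) w - (\<Sum>j<Suc m. a j w * z N ^ j)) / z N ^ m) \<le> M / s ^ m * (q N / (1 - q N))"
        by (simp only: norm_divide)
      moreover have "(f (z N) w - (\<Sum>j<Suc m. a j w * z N ^ j)) / z N ^ m =
          (f (z N) w - (\<Sum>j<m. a j w * z N ^ j)) / z N ^ m - a m w"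
        using z(1)[of N] by (simp add: field_simps)
      ultimately show "norm ((f (z N) w - (\<Sum>j<m. a j w * z N ^ j)) / z N ^ m - a m w) \<le>
          M / s ^ m * (q N / (1 - q N))"
        by simp
    next
      have "(\<lambda>N. 1 / (1 + real N)) \<longlonglongrightarrow> 0"
        using LIMSEQ_inverse_real_of_nat by (simp add: inverse_eq_divide add.commute)
      moreover have "q N / (1 - q N) = 1 / (1 + real N)" for N
        by (simp add: q_def field_simps)
      ultimately show "(\<lambda>N. M / s ^ m * (q N / (1 - q N))) \<longlonglongrightarrow> 0"
        by (simp only: tendsto_mult_right_zero)
    qed
    then show ?case
    proof (rule holomorphic_on_uniform_limit)
      show "\<forall>\<^sub>F N in sequentially. (\<lambda>w. (f (z N) w - (\<Sum>j<m. a j w * z N ^ j)) / z N ^ m) holomorphic_on ball 0 r"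
      proof (intro always_eventually allI)
        fix N
        have "(\<lambda>w. f (z N) w) holomorphic_on ball 0 r"
          using z(2)[of N] s by (intro hol2) auto
        then show "(\<lambda>w. (f (z N) w - (\<Sum>j<m. a j w * z N ^ j)) / z N ^ m) holomorphic_on ball 0 r"
          using less z(1) by (intro holomorphic_intros) auto
      qed
    qed auto
  qed
  have c_sums: "(\<lambda>n. c m n * w ^ n) sums a m w" if "norm w < r" for m w
    using holomorphic_power_series[OF a_hol, of w] that by (simp add: c_def)
  have c_bd: "norm (c m n) \<le> M / s ^ m / s ^ n" for m n
    unfolding c_def using a_hol a_bd by (rule cauchy)
  define G where "G = (\<lambda>z w. \<Sum>\<^sub>\<infinity>(m, n)\<in>UNIV. c m n * z ^ m * w ^ n)"
  have G: "pseries2 c s G"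
    unfolding G_def
  proof (rule pseries2_complexI)
    fix \<rho> :: real assume \<rho>: "0 \<le> \<rho>" "\<rho> < s"
    have "(\<lambda>(m, n). (\<rho> / s) ^ m * (\<rho> / s) ^ n) summable_on (UNIV :: (nat \<times> nat) set)"
      using \<rho> s by (intro geometric_summable_on) auto
    then have "(\<lambda>p. M * (\<lambda>(m, n). (\<rho> / s) ^ m * (\<rho> / s) ^ n) p) summable_on (UNIV :: (nat \<times> nat) set)"
      by (rule summable_on_cmult_right)
    then show "(\<lambda>(m, n). norm (c m n) * \<rho> ^ m * \<rho> ^ n) summable_on UNIV"
    proof (rule summable_on_comparison_test)
      fix p :: "nat \<times> nat"
      obtain m n where p: "p = (m, n)" by (cases p)
      have "norm (c m n) * (\<rho> ^ m * \<rho> ^ n) \<le> M / s ^ m / s ^ n * (\<rho> ^ m * \<rho> ^ n)"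
        using c_bd \<rho> by (intro mult_right_mono) auto
      then show "(\<lambda>(m, n). norm (c m n) * \<rho> ^ m * \<rho> ^ n) p \<le> M * (\<lambda>(m, n). (\<rho> / s) ^ m * (\<rho> / s) ^ n) p"
        by (simp add: p power_divide mult_ac)
      show "0 \<le> (\<lambda>(m, n). norm (c m n) * \<rho> ^ m * \<rho> ^ n) p"
        using \<rho> by (simp add: p)
    qed
  qed
  have "G z w = f z w" if zw: "norm z < s" "norm w < s" for z w
  proof -
    have tot: "((\<lambda>(m, n). c m n * z ^ m * w ^ n) has_sum G z w) (Sigma UNIV (\<lambda>_. UNIV))"
      using pseries2D[OF G zw] by simp
    have "((\<lambda>m. a m w * z ^ m) has_sum G z w) UNIV"
    proof (rule has_sum_SigmaD[OF tot])
      fix m :: nat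
      have "(\<lambda>(m, n). c m n * z ^ m * w ^ n) summable_on (Sigma UNIV (\<lambda>_. UNIV))"
        using tot by (rule has_sum_imp_summable)
      then have "(\<lambda>n. c m n * z ^ m * w ^ n) summable_on UNIV"
        by (rule summable_on_SigmaD1) auto
      then have 1: "((\<lambda>n. c m n * z ^ m * w ^ n) has_sum (\<Sum>\<^sub>\<infinity>n. c m n * z ^ m * w ^ n)) UNIV"
        by (rule has_sum_infsum)
      have "(\<lambda>n. c m n * w ^ n * z ^ m) sums (a m w * z ^ m)"
        using zw s by (intro sums_mult2 c_sums) auto
      then have "(\<lambda>n. c m n * z ^ m * w ^ n) sums (a m w * z ^ m)"
        by (simp add: mult_ac)
      with has_sum_imp_sums[OF 1] have "(\<Sum>\<^sub>\<infinity>n. c m n * z ^ m * w ^ n) = a m w * z ^ m"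
        by (rule sums_unique2)
      with 1 show "((\<lambda>n. (\<lambda>(m, n). c m n * z ^ m * w ^ n) (m, n)) has_sum a m w * z ^ m) UNIV"
        by simp
    qed
    then have "(\<lambda>m. a m w * z ^ m) sums G z w"
      by (rule has_sum_imp_sums)
    moreover have "(\<lambda>m. a m w * z ^ m) sums f z w"
      using zw s by (intro a_sums) auto
    ultimately show ?thesis by (rule sums_unique2)
  qed
  with G have "pseries2 c s f" by (rule pseries2_cong)
  then show ?thesis by (rule that)
qed

text \<open>
  At real arguments the real parts of the complex coefficients already sum to the real value.
\<close>
lemma osgood_real:
  fixes f :: "real \<Rightarrow> real \<Rightarrow> real" and F :: "complex \<Rightarrow> complex \<Rightarrow> complex"
  assumes hol1: "\<And>w. norm w < r \<Longrightarrow> (\<lambda>z. F z w) holomorphic_on ball 0 r"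
    and hol2: "\<And>z. norm z < r \<Longrightarrow> (\<lambda>w. F z w) holomorphic_on ball 0 r"
    and bd: "\<And>z w. norm z < r \<Longrightarrow> norm w < r \<Longrightarrow> norm (F z w) \<le> M"
    and Ff: "\<And>x y. \<bar>x\<bar> < r \<Longrightarrow> \<bar>y\<bar> < r \<Longrightarrow> F (of_real x) (of_real y) = of_real (f x y)"
    and s: "0 < s" "s < r"
  obtains c where "pseries2 c s f"
proof -
  obtain c where c: "pseries2 c s F"
    using osgood[OF hol1 hol2 bd s] by blast
  have "pseries2 (\<lambda>m n. Re (c m n)) s f"
    unfolding pseries2_def
  proof (intro allI impI)
    fix x y :: real assume xy: "norm x < s" "norm y < s"
    have "((\<lambda>(m, n). c m n * of_real x ^ m * of_real y ^ n) has_sum F (of_real x) (of_real y)) UNIV"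
      using xy by (intro pseries2D[OF c]) auto
    then have "((\<lambda>p. Re ((\<lambda>(m, n). c m n * of_real x ^ m * of_real y ^ n) p)) has_sum Re (F (of_real x) (of_real y))) UNIV"
      by (rule has_sum_Re)
    moreover have "Re ((\<lambda>(m, n). c m n * of_real x ^ m * of_real y ^ n) p) = (\<lambda>(m, n). Re (c m n) * x ^ m * y ^ n) p" for p
    proof (cases p)
      case (Pair m n)
      have "c m n * of_real x ^ m * of_real y ^ n = c m n * of_real (x ^ m * y ^ n)" by simp
      then show ?thesis by (simp add: Pair del: of_real_mult of_real_power)
    qed
    moreover have "Re (F (of_real x) (of_real y)) = f x y"
      using xy s by (subst Ff) auto
    ultimately show "((\<lambda>(m, n). Re (c m n) * x ^ m * y ^ n) has_sum f x y) UNIV"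
      by simp
  qed
  then show ?thesis by (rule that)
qed

text \<open>
  The complex extension is bounded and separately holomorphic around any point of the bidisc, so
  Osgood's lemma applies there.
\<close>
lemma pseries2_recenter:
  fixes f :: "real \<Rightarrow> real \<Rightarrow> real"
  assumes f: "pseries2 c r f" and xy: "\<bar>x0\<bar> < r" "\<bar>y0\<bar> < r"
  obtains c' r' where "r' > 0" "pseries2 c' r' (\<lambda>u v. f (x0 + u) (y0 + v))"
proof -
  obtain F where F: "pseries2 (\<lambda>m n. complex_of_real (c m n)) r F"
    and Ff: "\<And>x y. \<bar>x\<bar> < r \<Longrightarrow> \<bar>y\<bar> < r \<Longrightarrow> F (of_real x) (of_real y) = of_real (f x y)"
    using pseries2_complexification[OF f] by metis
  obtain \<rho> where \<rho>: "max \<bar>x0\<bar> \<bar>y0\<bar> < \<rho>" "\<rho> < r"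
    using xy dense[of "max \<bar>x0\<bar> \<bar>y0\<bar>" r] by (metis max_less_iff_conj)
  then have \<rho>0: "0 \<le> \<rho>" by linarith
  define d where "d = \<rho> - max \<bar>x0\<bar> \<bar>y0\<bar>"
  have d: "d > 0" using \<rho> by (simp add: d_def)
  have bnd: "norm (of_real x0 + z) \<le> \<rho>" "norm (of_real y0 + z) \<le> \<rho>"
    "norm (of_real x0 + z) < r" "norm (of_real y0 + z) < r" if "norm z < d" for z :: complex
  proof -
    have "norm (of_real x0 + z) \<le> \<bar>x0\<bar> + norm z" "norm (of_real y0 + z) \<le> \<bar>y0\<bar> + norm z"
      using norm_triangle_ineq[of "of_real x0" z] norm_triangle_ineq[of "of_real y0" z] by auto
    then show "norm (of_real x0 + z) \<le> \<rho>" "norm (of_real y0 + z) \<le> \<rho>"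
      "norm (of_real x0 + z) < r" "norm (of_real y0 + z) < r"
      using that \<rho> unfolding d_def by linarith+
  qed
  obtain M where M: "\<And>z w. norm z \<le> \<rho> \<Longrightarrow> norm w \<le> \<rho> \<Longrightarrow> norm (F z w) \<le> M"
    using pseries2_bounded[OF F \<rho>0 \<rho>(2)] by metis
  obtain c' where "pseries2 c' (d / 2) (\<lambda>u v. f (x0 + u) (y0 + v))"
  proof (rule osgood_real[where F = "\<lambda>z w. F (of_real x0 + z) (of_real y0 + w)" and r = d and s = "d / 2"])
    show "(\<lambda>z. F (of_real x0 + z) (of_real y0 + w)) holomorphic_on ball 0 d" if "norm w < d" for w
      using bnd[OF that] bnd
      by (intro pseries2_compose_holomorphic[OF F \<rho>0 \<rho>(2)] holomorphic_intros) auto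
    show "(\<lambda>w. F (of_real x0 + z) (of_real y0 + w)) holomorphic_on ball 0 d" if "norm z < d" for z
      using bnd[OF that] bnd
      by (intro pseries2_compose_holomorphic[OF F \<rho>0 \<rho>(2)] holomorphic_intros) auto
    show "norm (F (of_real x0 + z) (of_real y0 + w)) \<le> M" if "norm z < d" "norm w < d" for z w
      using bnd[OF that(1)] bnd[OF that(2)] by (intro M)
    show "F (of_real x0 + of_real x) (of_real y0 + of_real y) = of_real (f (x0 + x) (y0 + y))"
      if "\<bar>x\<bar> < d" "\<bar>y\<bar> < d" for x y
      using bnd(3)[of "of_real x"] bnd(4)[of "of_real y"] that Ff[of "x0 + x" "y0 + y"]
      by (simp flip: of_real_add)
  qed (use d in auto)
  then show ?thesis
    using d that[of "d / 2" c'] by simp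
qed

section \<open>Real analytic functions\<close>

lemma real_analytic2_on_iff:
  "real_analytic2_on f S \<longleftrightarrow>
     (\<forall>x y. (x, y) \<in> S \<longrightarrow> (\<exists>c r. r > 0 \<and> pseries2 c r (\<lambda>u v. f (x + u) (y + v))))"
  unfolding real_analytic2_on_def pseries2_def real_norm_def by blast

lemma pseries2_imp_real_analytic2_on:
  fixes f :: "real \<Rightarrow> real \<Rightarrow> real"
  assumes "pseries2 c r f"
  shows "real_analytic2_on f ({-r<..<r} \<times> {-r<..<r})"
  unfolding real_analytic2_on_iff
proof (intro allI impI)
  fix x y assume "(x, y) \<in> {-r<..<r} \<times> {-r<..<r}"
  then have "\<bar>x\<bar> < r" "\<bar>y\<bar> < r" by auto
  then show "\<exists>c r. r > 0 \<and> pseries2 c r (\<lambda>u v. f (x + u) (y + v))"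
    using pseries2_recenter[OF assms] by metis
qed

lemma real_analytic2_on_scale:
  assumes f: "real_analytic2_on f S" and k: "k \<noteq> 0" "l \<noteq> 0"
    and S: "\<And>x y. (x, y) \<in> S' \<Longrightarrow> (k * x, l * y) \<in> S"
  shows "real_analytic2_on (\<lambda>x y. b * f (k * x) (l * y)) S'"
  unfolding real_analytic2_on_iff
proof (intro allI impI)
  fix x y assume "(x, y) \<in> S'"
  then obtain c r where r: "r > 0" and c: "pseries2 c r (\<lambda>u v. f (k * x + u) (l * y + v))"
    using f S unfolding real_analytic2_on_iff by blast
  define s where "s = r / max \<bar>k\<bar> \<bar>l\<bar>"
  have s: "s > 0" "\<bar>k\<bar> * s \<le> r" "\<bar>l\<bar> * s \<le> r"
    using k r by (auto simp: s_def max_def field_simps)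
  have "pseries2 (\<lambda>m n. b * (c m n * k ^ m * l ^ n)) s (\<lambda>u v. b * f (k * x + k * u) (l * y + l * v))"
    by (rule pseries2_scale[OF c s(2,3) k])
  then show "\<exists>c r. 0 < r \<and> pseries2 c r (\<lambda>u v. b * f (k * (x + u)) (l * (y + v)))"
    using s(1) by (auto simp: distrib_left)
qed

lemma power_series_has_fps_expansion:
  fixes \<phi> :: "real \<Rightarrow> real"
  assumes r: "r > 0" and sums: "\<And>v. \<bar>v\<bar> < r \<Longrightarrow> (\<lambda>n. a n * v ^ n) sums \<phi> v"
  shows "\<phi> has_fps_expansion Abs_fps a"
  unfolding has_fps_expansion_def
proof
  have "conv_radius a \<ge> norm (r / 2)"
    using sums[of "r / 2"] r by (intro conv_radius_geI) (auto intro: sums_summable)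
  then have "ereal (norm (r / 2)) \<le> fps_conv_radius (Abs_fps a)"
    by (simp add: fps_conv_radius_def)
  moreover have "0 < ereal (norm (r / 2))" using r by simp
  ultimately show "0 < fps_conv_radius (Abs_fps a)" by (rule less_le_trans[rotated])
  have "eventually (\<lambda>v. v \<in> {-r<..<r}) (nhds 0)"
    using r by (intro eventually_nhds_in_open) auto
  then show "eventually (\<lambda>v. eval_fps (Abs_fps a) v = \<phi> v) (nhds 0)"
  proof eventually_elim
    case (elim v)
    then have "(\<lambda>n. a n * v ^ n) sums \<phi> v" by (intro sums) auto
    then show ?case by (simp add: eval_fps_def sums_iff)
  qed
qed

lemma real_analytic_on_iff:
  "real_analytic_on f S \<longleftrightarrow> (\<forall>x\<in>S. \<exists>a r. r > 0 \<and> (\<forall>v. \<bar>v\<bar> < r \<longrightarrow> (\<lambda>n. a n * v ^ n) sums f (x + v)))"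
proof -
  have "(\<exists>F. (\<lambda>u. f (x + u)) has_fps_expansion F) \<longleftrightarrow>
      (\<exists>a r. r > 0 \<and> (\<forall>v. \<bar>v\<bar> < r \<longrightarrow> (\<lambda>n. a n * v ^ n) sums f (x + v)))" for x
  proof
    assume "\<exists>F. (\<lambda>u. f (x + u)) has_fps_expansion F"
    then obtain F where F: "fps_conv_radius F > 0" "eventually (\<lambda>v. eval_fps F v = f (x + v)) (nhds 0)"
      by (auto simp: has_fps_expansion_def)
    have "eventually (\<lambda>v. v \<in> eball 0 (fps_conv_radius F)) (nhds (0::real))"
      using F(1) by (intro eventually_nhds_in_open) (auto simp: zero_ereal_def)
    with F(2) have "eventually (\<lambda>v. (\<lambda>n. fps_nth F n * v ^ n) sums f (x + v)) (nhds 0)"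
    proof eventually_elim
      case (elim v)
      then have "ereal (norm v) < fps_conv_radius F" by (simp add: in_eball_iff)
      then show ?case using elim(1) sums_eval_fps[of v F] by simp
    qed
    then obtain r where "r > 0" "\<And>v. dist v 0 < r \<Longrightarrow> (\<lambda>n. fps_nth F n * v ^ n) sums f (x + v)"
      by (auto simp: eventually_nhds_metric)
    then show "\<exists>a r. r > 0 \<and> (\<forall>v. \<bar>v\<bar> < r \<longrightarrow> (\<lambda>n. a n * v ^ n) sums f (x + v))"
      by (auto intro!: exI[of _ "fps_nth F"] exI[of _ r])
  next
    assume "\<exists>a r. r > 0 \<and> (\<forall>v. \<bar>v\<bar> < r \<longrightarrow> (\<lambda>n. a n * v ^ n) sums f (x + v))"
    then obtain a r where "r > 0" "\<And>v. \<bar>v\<bar> < r \<Longrightarrow> (\<lambda>n. a n * v ^ n) sums f (x + v)" by blast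
    then show "\<exists>F. (\<lambda>u. f (x + u)) has_fps_expansion F"
      using power_series_has_fps_expansion[of r a "\<lambda>v. f (x + v)"] by blast
  qed
  then show ?thesis by (simp add: real_analytic_on_def)
qed

lemma real_analytic_on_scale:
  assumes f: "real_analytic_on f S" and k: "k \<noteq> 0" and S: "\<And>x. x \<in> S' \<Longrightarrow> k * x \<in> S"
  shows "real_analytic_on (\<lambda>x. b * f (k * x)) S'"
  unfolding real_analytic_on_iff
proof
  fix x assume "x \<in> S'"
  then obtain a r where r: "r > 0" and a: "\<And>v. \<bar>v\<bar> < r \<Longrightarrow> (\<lambda>n. a n * v ^ n) sums f (k * x + v)"
    using f S unfolding real_analytic_on_iff by blast
  have "(\<lambda>n. b * (a n * k ^ n) * v ^ n) sums (b * f (k * (x + v)))" if v: "\<bar>v\<bar> < r / \<bar>k\<bar>" for v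
  proof -
    have "\<bar>k * v\<bar> < r" using v k by (simp add: abs_mult field_simps)
    then have "(\<lambda>n. b * (a n * (k * v) ^ n)) sums (b * f (k * x + k * v))"
      by (intro sums_mult a)
    then show ?thesis by (simp add: power_mult_distrib distrib_left mult_ac)
  qed
  then show "\<exists>a r. r > 0 \<and> (\<forall>v. \<bar>v\<bar> < r \<longrightarrow> (\<lambda>n. a n * v ^ n) sums (b * f (k * (x + v))))"
    using r k by (intro exI[of _ "\<lambda>n. b * (a n * k ^ n)"] exI[of _ "r / \<bar>k\<bar>"]) auto
qed

lemma real_analytic_on_isCont:
  assumes f: "real_analytic_on f S" and x: "x \<in> S"
  shows "isCont f x"
proof -
  obtain F where "(\<lambda>u. f (x + u)) has_fps_expansion F"
    using f x by (auto simp: real_analytic_on_def)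
  then have "isCont (\<lambda>u. f (x + u)) 0" by (rule has_fps_expansion_imp_continuous)
  then show ?thesis unfolding isCont_iff by simp
qed

lemma pseries2_axis_analytic:
  fixes f :: "real \<Rightarrow> real \<Rightarrow> real"
  assumes f: "pseries2 c r f" and v: "\<bar>v\<bar> < r"
  obtains a s where "s > 0" "\<And>w. \<bar>w\<bar> < s \<Longrightarrow> (\<lambda>n. a n * w ^ n) sums f 0 (v + w)"
proof -
  have r: "\<bar>0\<bar> < r" using v by simp
  obtain c' s where s: "s > 0" and c': "pseries2 c' s (\<lambda>u w. f (0 + u) (v + w))"
    using pseries2_recenter[OF f r v] by metis
  have "(\<lambda>n. c' 0 n * w ^ n) sums f 0 (v + w)" if "\<bar>w\<bar> < s" for w
    using has_sum_imp_sums[OF pseries2_section0[OF c', of w]] that by simp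
  with s show ?thesis by (rule that)
qed

lemma D1_translate: "D1 (\<lambda>u v. f (x0 + u) (y0 + v)) = (\<lambda>u v. D1 f (x0 + u) (y0 + v))"
  unfolding D1_def deriv_def using DERIV_shift[of "\<lambda>s. f s _" _ _ x0] by (simp add: add.commute)

lemma D2_translate: "D2 (\<lambda>u v. f (x0 + u) (y0 + v)) = (\<lambda>u v. D2 f (x0 + u) (y0 + v))"
  unfolding D2_def deriv_def using DERIV_shift[of "\<lambda>s. f _ s" _ _ y0] by (simp add: add.commute)

lemma D1_axis_translate: "D1 (\<lambda>u v. f u (y0 + v)) = (\<lambda>u v. D1 f u (y0 + v))"
  using D1_translate[of f 0 y0] by simp

lemma D2_axis_translate: "D2 (\<lambda>u v. f u (y0 + v)) = (\<lambda>u v. D2 f u (y0 + v))"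
  using D2_translate[of f 0 y0] by simp

text \<open>
  Partial derivatives depend on the function only near the point. Second derivatives are therefore
  computed from formulas for the first ones that hold just on a square.
\<close>
lemma D_cong_box:
  assumes eq: "\<And>x y. \<bar>x\<bar> < r \<Longrightarrow> \<bar>y\<bar> < r \<Longrightarrow> f x y = g x y" and xy: "\<bar>x\<bar> < r" "\<bar>y\<bar> < r"
  shows "D1 f x y = D1 g x y" "D2 f x y = D2 g x y"
proof -
  have ev: "\<forall>\<^sub>F s in nhds t. s \<in> {-r<..<r}" if "\<bar>t\<bar> < r" for t
    using that by (intro eventually_nhds_in_open) (auto simp: abs_less_iff)
  have "\<forall>\<^sub>F s in nhds x. f s y = g s y" "\<forall>\<^sub>F s in nhds y. f x s = g x s"
    using eventually_mono[OF ev[OF xy(1)]] eventually_mono[OF ev[OF xy(2)]] eq xy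
    by (auto simp: abs_less_iff)
  then show "D1 f x y = D1 g x y" "D2 f x y = D2 g x y"
    unfolding D1_def D2_def by (auto intro: deriv_cong_ev)
qed

lemma pseries2_partials:
  fixes f :: "real \<Rightarrow> real \<Rightarrow> real"
  assumes c: "pseries2 c r (\<lambda>u v. f (x + u) (y + v))" and r: "r > 0"
  shows "f x y = c 0 0" "D1 f x y = c 1 0" "D2 f x y = c 0 1"
    "D1 (D1 f) x y = 2 * c 2 0" "D2 (D1 f) x y = c 1 1" "D1 (D2 f) x y = c 1 1" "D2 (D2 f) x y = 2 * c 0 2"
    "D2 (D1 (D1 f)) x y = 2 * c 2 1" "D1 (D2 (D2 f)) x y = 2 * c 1 2"
    "((\<lambda>s. f s y) has_real_derivative c 1 0) (at x)"
    "((\<lambda>s. f x s) has_real_derivative c 0 1) (at y)"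
proof -
  note d1 = pseries2_deriv1(1)[OF c, unfolded D1_translate[of f]]
  note d2 = pseries2_deriv2(1)[OF c, unfolded D2_translate[of f]]
  note d11 = pseries2_deriv1(1)[OF d1, unfolded D1_translate[of "D1 f"]]
  note d12 = pseries2_deriv2(1)[OF d1, unfolded D2_translate[of "D1 f"]]
  note d21 = pseries2_deriv1(1)[OF d2, unfolded D1_translate[of "D2 f"]]
  note d22 = pseries2_deriv2(1)[OF d2, unfolded D2_translate[of "D2 f"]]
  note d112 = pseries2_deriv2(1)[OF d11, unfolded D2_translate[of "D1 (D1 f)"]]
  note d221 = pseries2_deriv1(1)[OF d22, unfolded D1_translate[of "D2 (D2 f)"]]
  note simps = dcoeff1_def dcoeff2_def numeral_2_eq_2
  show "f x y = c 0 0" using pseries2_at_0[OF c r] by simp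
  show 1: "D1 f x y = c 1 0" using pseries2_at_0[OF d1 r] by (simp add: simps)
  show 2: "D2 f x y = c 0 1" using pseries2_at_0[OF d2 r] by (simp add: simps)
  show "D1 (D1 f) x y = 2 * c 2 0" using pseries2_at_0[OF d11 r] by (simp add: simps)
  show "D2 (D1 f) x y = c 1 1" using pseries2_at_0[OF d12 r] by (simp add: simps)
  show "D1 (D2 f) x y = c 1 1" using pseries2_at_0[OF d21 r] by (simp add: simps)
  show "D2 (D2 f) x y = 2 * c 0 2" using pseries2_at_0[OF d22 r] by (simp add: simps)
  show "D2 (D1 (D1 f)) x y = 2 * c 2 1" using pseries2_at_0[OF d112 r] by (simp add: simps)
  show "D1 (D2 (D2 f)) x y = 2 * c 1 2" using pseries2_at_0[OF d221 r] by (simp add: simps)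
  have "((\<lambda>s. f (x + s) y) has_real_derivative D1 f x y) (at 0)"
    using pseries2_deriv1(2)[OF c, of 0 0] r by (simp add: D1_translate[of f])
  then show "((\<lambda>s. f s y) has_real_derivative c 1 0) (at x)"
    using DERIV_shift[of "\<lambda>s. f s y" _ 0 x] 1 by (simp add: add.commute)
  have "((\<lambda>s. f x (y + s)) has_real_derivative D2 f x y) (at 0)"
    using pseries2_deriv2(2)[OF c, of 0 0] r by (simp add: D2_translate[of f])
  then show "((\<lambda>s. f x s) has_real_derivative c 0 1) (at y)"
    using DERIV_shift[of "\<lambda>s. f x s" _ 0 y] 2 by (simp add: add.commute)
qed

text \<open>
  The zeros may lie on one side of the centre only, because the centre will be allowed to be an
  endpoint of a lightlike segment.
\<close>
lemma holomorphic_zero_on_real_segment: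
  assumes h: "h holomorphic_on ball 0 r" and e: "e \<noteq> 0"
    and zero: "\<And>\<theta>. 0 \<le> \<theta> \<Longrightarrow> \<theta> \<le> 1 \<Longrightarrow> \<bar>\<theta> * e\<bar> < r \<Longrightarrow> h (complex_of_real (\<theta> * e)) = 0"
    and z: "norm z < r"
  shows "h z = 0"
proof -
  have r: "r > 0" using z norm_ge_zero[of z] by linarith
  define U where "U = {complex_of_real (\<theta> * e) |\<theta>. 0 \<le> \<theta> \<and> \<theta> \<le> 1 \<and> \<bar>\<theta> * e\<bar> < r}"
  show ?thesis
  proof (rule analytic_continuation[of h "ball 0 r" U 0])
    show "U \<subseteq> ball 0 r" unfolding U_def mem_ball_0 by (auto simp del: of_real_mult)
    show "0 islimpt U"
      unfolding islimpt_approachable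
    proof (intro allI impI)
      fix \<delta> :: real assume \<delta>: "\<delta> > 0"
      define \<theta> where "\<theta> = min 1 (min \<delta> r / (2 * \<bar>e\<bar>))"
      have pos: "0 < min \<delta> r / (2 * \<bar>e\<bar>)" using e r \<delta> by simp
      have \<theta>: "0 < \<theta>" "\<theta> \<le> 1" using pos by (auto simp: \<theta>_def)
      have "\<bar>\<theta> * e\<bar> = \<theta> * \<bar>e\<bar>" using \<theta> by (simp add: abs_mult)
      also have "\<dots> \<le> min \<delta> r / (2 * \<bar>e\<bar>) * \<bar>e\<bar>" by (intro mult_right_mono) (auto simp: \<theta>_def)
      also have "\<dots> = min \<delta> r / 2" using e by simp
      also have "\<dots> < min \<delta> r" using r \<delta> by (simp add: min_def)
      finally have small: "\<bar>\<theta> * e\<bar> < min \<delta> r" .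
      have "complex_of_real (\<theta> * e) \<in> U"
        unfolding U_def using \<theta> small by (intro CollectI exI[of _ \<theta>]) auto
      moreover have "complex_of_real (\<theta> * e) \<noteq> 0" using \<theta> e by simp
      moreover have "dist (complex_of_real (\<theta> * e)) 0 < \<delta>"
        unfolding dist_0_norm dist_norm diff_zero norm_of_real using small by simp
      ultimately show "\<exists>x'\<in>U. x' \<noteq> 0 \<and> dist x' 0 < \<delta>" by blast
    qed
    show "h w = 0" if "w \<in> U" for w
      using that zero unfolding U_def by blast
  qed (use h r z in auto)
qed

lemma holomorphic_zero_on_reals:
  assumes "h holomorphic_on ball 0 r" "\<And>x. \<bar>x\<bar> < r \<Longrightarrow> h (complex_of_real x) = 0" "norm z < r"
  shows "h z = 0"
  using holomorphic_zero_on_real_segment[OF assms(1), of 1 z] assms(2,3) by simp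

lemma pseries2_axis_continuation:
  fixes f :: "real \<Rightarrow> real \<Rightarrow> real"
  assumes f: "pseries2 c r f" and e: "e \<noteq> 0"
    and ax: "\<And>\<theta>. 0 \<le> \<theta> \<Longrightarrow> \<theta> \<le> 1 \<Longrightarrow> \<bar>\<theta> * e\<bar> < r \<Longrightarrow> f 0 (\<theta> * e) = k + m * (\<theta> * e)" and s: "\<bar>s\<bar> < r"
  shows "f 0 s = k + m * s"
proof -
  have r: "r > 0" using s by linarith
  obtain F where F: "pseries2 (\<lambda>m n. complex_of_real (c m n)) r F"
    and Ff: "\<And>x y. \<bar>x\<bar> < r \<Longrightarrow> \<bar>y\<bar> < r \<Longrightarrow> F (of_real x) (of_real y) = of_real (f x y)"
    using pseries2_complexification[OF f] by metis
  have "F 0 (of_real s) - (of_real k + of_real m * of_real s) = 0"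
  proof (rule holomorphic_zero_on_real_segment[of "\<lambda>w. F 0 w - (of_real k + of_real m * w)" r e])
    show "(\<lambda>w. F 0 w - (of_real k + of_real m * w)) holomorphic_on ball 0 r"
      using r by (intro holomorphic_intros pseries2_holomorphic2[OF F]) auto
    fix \<theta> :: real assume \<theta>: "0 \<le> \<theta>" "\<theta> \<le> 1" "\<bar>\<theta> * e\<bar> < r"
    have "F (of_real 0) (of_real (\<theta> * e)) = of_real (f 0 (\<theta> * e))"
      using \<theta> r by (intro Ff) auto
    then show "F 0 (of_real (\<theta> * e)) - (of_real k + of_real m * of_real (\<theta> * e)) = 0"
      using ax[OF \<theta>] by simp
  qed (use e s in auto)
  moreover have "F 0 (of_real s) = of_real (f 0 s)" using Ff[of 0 s] r s by simp
  ultimately have "complex_of_real (f 0 s - (k + m * s)) = 0" by simp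
  then show ?thesis by (simp only: of_real_eq_0_iff)
qed

lemma dcoeff1_funpow: "(dcoeff1 ^^ n) c m k = fact (m + n) / fact m * (c (m + n) k :: real)"
proof (induction n arbitrary: m)
  case (Suc n)
  have "(dcoeff1 ^^ Suc n) c m k = real (Suc m) * (dcoeff1 ^^ n) c (Suc m) k"
    by (simp add: dcoeff1_def)
  also have "\<dots> = real (Suc m) * (fact (Suc m + n) / fact (Suc m)) * c (Suc m + n) k"
    by (simp add: Suc)
  also have "real (Suc m) * (fact (Suc m + n) / fact (Suc m)) = fact (m + Suc n) / (fact m :: real)"
    unfolding fact_Suc by simp
  finally show ?case by simp
qed simp

lemma pseries2_x_taylor_coeff:
  fixes f :: "real \<Rightarrow> real \<Rightarrow> real"
  assumes f: "pseries2 c r f" and y: "\<bar>y\<bar> < r"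
  shows "((\<lambda>k. c n k * y ^ k) has_sum x_taylor_coeff f n y) UNIV"
proof -
  have "pseries2 ((dcoeff1 ^^ n) c) r (\<lambda>x y. (deriv ^^ n) (\<lambda>s. f s y) x)"
  proof (induction n)
    case (Suc n)
    have "D1 (\<lambda>x y. (deriv ^^ n) (\<lambda>s. f s y) x) = (\<lambda>x y. (deriv ^^ Suc n) (\<lambda>s. f s y) x)"
      by (simp add: D1_def)
    with pseries2_deriv1(1)[OF Suc] show ?case by simp
  qed (use f in simp)
  from pseries2_section0[OF this, of y] y
  have "((\<lambda>k. fact n * c n k * y ^ k) has_sum (deriv ^^ n) (\<lambda>s. f s y) 0) UNIV"
    by (simp add: dcoeff1_funpow)
  from has_sum_cmult_right[OF this, of "1 / fact n"] show ?thesis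
    by (simp add: x_taylor_coeff_def)
qed

text \<open>
  Summing the double series of \<open>F\<close> at \<open>(\<i> s, y)\<close> over the second exponent first gives the terms of
  the Wick rotation.
\<close>
lemma wick_eq:
  fixes f :: "real \<Rightarrow> real \<Rightarrow> real"
  assumes f: "pseries2 c r f" and F: "pseries2 (\<lambda>m n. complex_of_real (c m n)) r F"
    and sy: "\<bar>s\<bar> < r" "\<bar>y\<bar> < r"
  shows "summable (wick_term f s y)" "wick f s y = F (\<i> * of_real s) (of_real y)"
proof -
  have tot: "((\<lambda>(m, n). of_real (c m n) * (\<i> * of_real s) ^ m * of_real y ^ n) has_sum
      F (\<i> * of_real s) (of_real y)) (Sigma UNIV (\<lambda>_. UNIV))"
    using pseries2D[OF F, of "\<i> * of_real s" "of_real y"] sy by (simp add: norm_mult)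
  have "(wick_term f s y has_sum F (\<i> * of_real s) (of_real y)) UNIV"
  proof (rule has_sum_SigmaD[OF tot])
    fix n :: nat
    have "((\<lambda>k. complex_of_real (c n k * y ^ k)) has_sum of_real (x_taylor_coeff f n y)) UNIV"
      using sy by (intro has_sum_of_real pseries2_x_taylor_coeff[OF f])
    then have "((\<lambda>k. complex_of_real (c n k * y ^ k) * (\<i> * of_real s) ^ n) has_sum
        of_real (x_taylor_coeff f n y) * (\<i> * of_real s) ^ n) UNIV"
      by (rule has_sum_cmult_left)
    then show "((\<lambda>k. (\<lambda>(m, n). of_real (c m n) * (\<i> * of_real s) ^ m * of_real y ^ n) (n, k)) has_sum
        wick_term f s y n) UNIV"
      by (simp add: wick_term_def mult_ac)
  qed
  then have "wick_term f s y sums F (\<i> * of_real s) (of_real y)"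
    by (rule has_sum_imp_sums)
  then show "summable (wick_term f s y)" "wick f s y = F (\<i> * of_real s) (of_real y)"
    by (auto simp: wick_def sums_iff)
qed

section \<open>The Riccati equation and the six classes\<close>

text \<open>
  With an antiderivative \<open>P\<close> of \<open>A\<close>, the product \<open>\<phi> exp P\<close> is constant.
\<close>
lemma linear_ode_zero:
  fixes \<phi> A :: "real \<Rightarrow> real"
  assumes der: "\<And>y. y \<in> {a..b} \<Longrightarrow> (\<phi> has_real_derivative - A y * \<phi> y) (at y within {a..b})"
    and cont: "continuous_on {a..b} A" and z: "z \<in> {a..b}" "\<phi> z = 0" and y: "y \<in> {a..b}"
  shows "\<phi> y = 0"
proof -
  obtain P where P: "\<And>y. y \<in> {a..b} \<Longrightarrow> (P has_vector_derivative A y) (at y within {a..b})"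
    using antiderivative_continuous[OF cont] by metis
  have "\<exists>c. \<forall>y\<in>{a..b}. \<phi> y * exp (P y) = c"
  proof (rule has_field_derivative_zero_constant)
    fix y assume y: "y \<in> {a..b}"
    have "(P has_real_derivative A y) (at y within {a..b})"
      using P[OF y] by (simp add: has_real_derivative_iff_has_vector_derivative)
    with der[OF y] show "((\<lambda>y. \<phi> y * exp (P y)) has_real_derivative 0) (at y within {a..b})"
      by (auto intro!: derivative_eq_intros)
  qed simp
  then have "\<phi> y * exp (P y) = \<phi> z * exp (P z)" using y z(1) by metis
  then show ?thesis using z(2) by simp
qed

definition riccati_on :: "(real \<Rightarrow> real) \<Rightarrow> real \<Rightarrow> real set \<Rightarrow> bool" where
  "riccati_on \<alpha> \<mu> J \<longleftrightarrow> (\<forall>y\<in>J. (\<alpha> has_real_derivative - \<mu> - (\<alpha> y)\<^sup>2) (at y within J))"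

text \<open>
  The class in terms of the initial value \<open>a = \<alpha>(0)\<close> and the characteristic \<open>\<mu>\<close> before
  normalization. For \<open>\<mu> < 0\<close> the constant solutions \<open>\<plusminus>sqrt (-\<mu>)\<close> separate the
  \<open>tanh\<close>-like solutions from the \<open>coth\<close>-like ones.
\<close>
fun class_cond :: "zmc_class \<Rightarrow> real \<Rightarrow> real \<Rightarrow> bool" where
  "class_cond Alpha_plus a \<mu> \<longleftrightarrow> 0 < \<mu>"
| "class_cond Alpha_zero_I a \<mu> \<longleftrightarrow> \<mu> = 0 \<and> a = 0"
| "class_cond Alpha_zero_II a \<mu> \<longleftrightarrow> \<mu> = 0 \<and> a \<noteq> 0"
| "class_cond Alpha_minus_I a \<mu> \<longleftrightarrow> \<mu> < 0 \<and> a\<^sup>2 < - \<mu>"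
| "class_cond Alpha_minus_II a \<mu> \<longleftrightarrow> \<mu> < 0 \<and> - \<mu> < a\<^sup>2"
| "class_cond Alpha_minus_III a \<mu> \<longleftrightarrow> \<mu> < 0 \<and> a\<^sup>2 = - \<mu>"

lemma class_cond_exhaustive: "\<exists>C. class_cond C a \<mu>"
proof -
  consider "0 < \<mu>" | "\<mu> = 0" "a = 0" | "\<mu> = 0" "a \<noteq> 0"
    | "\<mu> < 0" "a\<^sup>2 < - \<mu>" | "\<mu> < 0" "- \<mu> < a\<^sup>2" | "\<mu> < 0" "a\<^sup>2 = - \<mu>"
    by linarith
  then show ?thesis
    by cases (metis class_cond.simps)+
qed

lemma class_cond_scale:
  assumes "l \<noteq> 0"
  shows "class_cond C (a / l) (\<mu> / l\<^sup>2) \<longleftrightarrow> class_cond C a \<mu>"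
proof -
  have l: "0 < l\<^sup>2" using assms by simp
  show ?thesis
    using assms l
    by (cases C) (auto simp: power_divide divide_less_eq less_divide_eq zero_less_divide_iff
        divide_less_0_iff divide_eq_eq field_simps)
qed

lemma class_cond_sign: "a\<^sup>2 = b\<^sup>2 \<Longrightarrow> class_cond C a \<mu> \<longleftrightarrow> class_cond C b \<mu>"
  by (cases C) (auto simp: power2_eq_iff)

text \<open>
  The difference of both sides solves \<open>\<phi>' = - \<alpha> \<phi>\<close> and vanishes at 0. The product
  form implies that \<open>1 + \<alpha>(0) y\<close> has no zero on the interval.
\<close>
lemma riccati_linearization_zero:
  assumes ric: "riccati_on \<alpha> 0 {a..b}" and z: "0 \<in> {a..b}" and y: "y \<in> {a..b}"
  shows "\<alpha> y * (1 + \<alpha> 0 * y) = \<alpha> 0"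
proof -
  have d: "(\<alpha> has_real_derivative - (\<alpha> y)\<^sup>2) (at y within {a..b})" if "y \<in> {a..b}" for y
    using ric that by (simp add: riccati_on_def)
  have "\<alpha> y * (1 + \<alpha> 0 * y) - \<alpha> 0 = 0"
  proof (rule linear_ode_zero[where A = \<alpha> and \<phi> = "\<lambda>y. \<alpha> y * (1 + \<alpha> 0 * y) - \<alpha> 0", OF _ _ z _ y])
    show "((\<lambda>y. \<alpha> y * (1 + \<alpha> 0 * y) - \<alpha> 0) has_real_derivative
        - \<alpha> y * (\<alpha> y * (1 + \<alpha> 0 * y) - \<alpha> 0)) (at y within {a..b})" if "y \<in> {a..b}" for y
      using d[OF that] by (auto intro!: derivative_eq_intros simp: power2_eq_square algebra_simps)
    show "continuous_on {a..b} \<alpha>"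
      unfolding continuous_on_eq_continuous_within using d DERIV_continuous by blast
  qed simp
  then show ?thesis by simp
qed

text \<open>
  The same argument as for \<open>\<mu> = 0\<close>, with the solution
  \<open>(sinh y + \<alpha>(0) cosh y) / (cosh y + \<alpha>(0) sinh y)\<close> cleared of its denominator.
\<close>
lemma riccati_linearization_minus:
  assumes ric: "riccati_on \<alpha> (- 1) {a..b}" and z: "0 \<in> {a..b}" and y: "y \<in> {a..b}"
  shows "\<alpha> y * (cosh y + \<alpha> 0 * sinh y) = sinh y + \<alpha> 0 * cosh y"
proof -
  have d: "(\<alpha> has_real_derivative 1 - (\<alpha> y)\<^sup>2) (at y within {a..b})" if "y \<in> {a..b}" for y
    using ric that by (simp add: riccati_on_def)
  have "\<alpha> y * (cosh y + \<alpha> 0 * sinh y) - (sinh y + \<alpha> 0 * cosh y) = 0"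
  proof (rule linear_ode_zero[where A = \<alpha> and
        \<phi> = "\<lambda>y. \<alpha> y * (cosh y + \<alpha> 0 * sinh y) - (sinh y + \<alpha> 0 * cosh y)", OF _ _ z _ y])
    show "((\<lambda>y. \<alpha> y * (cosh y + \<alpha> 0 * sinh y) - (sinh y + \<alpha> 0 * cosh y)) has_real_derivative
        - \<alpha> y * (\<alpha> y * (cosh y + \<alpha> 0 * sinh y) - (sinh y + \<alpha> 0 * cosh y))) (at y within {a..b})"
      if "y \<in> {a..b}" for y
      using d[OF that] by (auto intro!: derivative_eq_intros simp: power2_eq_square algebra_simps)
    show "continuous_on {a..b} \<alpha>"
      unfolding continuous_on_eq_continuous_within using d DERIV_continuous by blast
  qed simp
  then show ?thesis by simp
qed

text \<open>
  The function \<open>arctan \<circ> \<alpha>\<close> has derivative \<open>-1\<close>; its boundedness shows that the poles of the tangent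
  stay off the interval.
\<close>
lemma riccati_tan:
  assumes ric: "riccati_on \<alpha> 1 {a..b}" and z: "0 \<in> {a..b}" and y: "y \<in> {a..b}"
  shows "\<alpha> y = - tan (y + - arctan (\<alpha> 0))"
proof -
  have "\<exists>c. \<forall>y\<in>{a..b}. arctan (\<alpha> y) + y = c"
  proof (rule has_field_derivative_zero_constant)
    fix y assume y: "y \<in> {a..b}"
    have "1 + (\<alpha> y)\<^sup>2 \<noteq> 0" by (metis add_pos_nonneg less_irrefl zero_le_power2 zero_less_one)
    moreover have "(\<alpha> has_real_derivative - (1 + (\<alpha> y)\<^sup>2)) (at y within {a..b})"
      using ric y by (simp add: riccati_on_def)
    ultimately show "((\<lambda>y. arctan (\<alpha> y) + y) has_real_derivative 0) (at y within {a..b})"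
      by (auto intro!: derivative_eq_intros simp: field_simps)
  qed simp
  then have "arctan (\<alpha> y) + y = arctan (\<alpha> 0) + 0" using y z by metis
  then have "arctan (\<alpha> y) = - (y + - arctan (\<alpha> 0))" by simp
  then have "tan (arctan (\<alpha> y)) = - tan (y + - arctan (\<alpha> 0))" by (simp only: tan_minus)
  then show ?thesis by (simp only: arctan)
qed

lemma tanh_surj:
  fixes a :: real
  assumes "\<bar>a\<bar> < 1"
  obtains c where "a = tanh c"
proof -
  define q where "q = (1 - a) / (1 + a)"
  have a: "0 < 1 + a" "0 < 1 - a" using assms by auto
  then have q: "q > 0" by (simp add: q_def)
  have "tanh (- (ln q / 2)) = (1 - q) / (1 + q)"
    using q by (simp add: tanh_real_altdef)
  also have "(1 - q) * (1 + a) = a * ((1 + q) * (1 + a))"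
    using a by (simp add: q_def field_simps)
  then have "(1 - q) / (1 + q) = a"
    using a q by (simp add: divide_eq_eq)
  finally show ?thesis using that by metis
qed

text \<open>
  The parameter \<open>c\<close> of the model solution is the one with the right value at 0.
\<close>
lemma riccati_class_solution:
  assumes ric: "riccati_on \<alpha> \<mu> {a..b}" and z: "0 \<in> {a..b}" and \<mu>: "\<mu> \<in> {1, 0, - 1}"
    and C: "class_cond C (\<alpha> 0) \<mu>"
  shows "class_solution C \<alpha> {a..b}"
proof (cases C)
  case Alpha_plus
  with C \<mu> have "\<mu> = 1" by auto
  then have "\<forall>y\<in>{a..b}. \<alpha> y = - tan (y + - arctan (\<alpha> 0))"
    using riccati_tan ric z by blast
  moreover have "\<bar>- arctan (\<alpha> 0)\<bar> < pi / 2"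
    using arctan_lbound[of "\<alpha> 0"] arctan_ubound[of "\<alpha> 0"] by linarith
  ultimately show ?thesis
    unfolding Alpha_plus class_solution.simps by blast
next
  case Alpha_zero_I
  then show ?thesis using C riccati_linearization_zero[of \<alpha> a b] ric z by auto
next
  case Alpha_zero_II
  with C have a0: "\<alpha> 0 \<noteq> 0" and m: "\<mu> = 0" by auto
  have "\<alpha> y = 1 / (y + 1 / \<alpha> 0)" if y: "y \<in> {a..b}" for y
  proof -
    have *: "\<alpha> y * (1 + \<alpha> 0 * y) = \<alpha> 0"
      using riccati_linearization_zero ric z y m by blast
    with a0 have nz: "1 + \<alpha> 0 * y \<noteq> 0" by auto
    have "y + 1 / \<alpha> 0 = (1 + \<alpha> 0 * y) / \<alpha> 0"
      using a0 by (simp add: field_simps)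
    then have "1 / (y + 1 / \<alpha> 0) = \<alpha> 0 / (1 + \<alpha> 0 * y)" by simp
    also have "\<dots> = \<alpha> y" using * nz by (simp add: divide_eq_eq)
    finally show ?thesis by simp
  qed
  moreover have "1 / \<alpha> 0 \<noteq> 0" using a0 by simp
  ultimately show ?thesis
    unfolding Alpha_zero_II class_solution.simps by blast
next
  case Alpha_minus_I
  with C \<mu> have m: "\<mu> = - 1" and "(\<alpha> 0)\<^sup>2 < 1" by auto
  then have "\<bar>\<alpha> 0\<bar> < 1" by (simp add: abs_square_less_1)
  then obtain c where c: "\<alpha> 0 = tanh c" using tanh_surj by blast
  have "\<alpha> y = tanh (y + c)" if y: "y \<in> {a..b}" for y
  proof -
    have "\<alpha> y * (cosh y + \<alpha> 0 * sinh y) = sinh y + \<alpha> 0 * cosh y"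
      using riccati_linearization_minus ric z y m by blast
    then have "\<alpha> y * (cosh y * cosh c + (\<alpha> 0 * cosh c) * sinh y) = sinh y * cosh c + (\<alpha> 0 * cosh c) * cosh y"
      by algebra
    moreover have ac: "\<alpha> 0 * cosh c = sinh c" by (simp add: c tanh_def)
    ultimately have "\<alpha> y * cosh (y + c) = sinh (y + c)"
      unfolding ac by (simp add: cosh_add sinh_add mult_ac add_ac)
    then show ?thesis by (simp add: tanh_def nonzero_eq_divide_eq)
  qed
  then show ?thesis
    unfolding Alpha_minus_I class_solution.simps by blast
next
  case Alpha_minus_II
  with C \<mu> have m: "\<mu> = - 1" and a1: "1 < (\<alpha> 0)\<^sup>2" by auto
  have a0: "\<alpha> 0 \<noteq> 0" using a1 by auto
  have "\<bar>\<alpha> 0\<bar> > 1" using a1 by (metis abs_square_le_1 not_le)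
  then have "\<bar>1 / \<alpha> 0\<bar> < 1" by simp
  then obtain c where c: "1 / \<alpha> 0 = tanh c" using tanh_surj by blast
  have c0: "c \<noteq> 0" using c a0 by auto
  then have s0: "sinh c \<noteq> 0" by simp
  have ac: "\<alpha> 0 * sinh c = cosh c"
    using c a0 by (simp add: tanh_def field_simps)
  have "\<alpha> y = cosh (y + c) / sinh (y + c)" if y: "y \<in> {a..b}" for y
  proof -
    have "\<alpha> y * (cosh y + \<alpha> 0 * sinh y) = sinh y + \<alpha> 0 * cosh y"
      using riccati_linearization_minus ric z y m by blast
    then have "\<alpha> y * (cosh y * sinh c + (\<alpha> 0 * sinh c) * sinh y) = sinh y * sinh c + (\<alpha> 0 * sinh c) * cosh y"
      by algebra
    then have *: "\<alpha> y * sinh (y + c) = cosh (y + c)"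
      unfolding ac by (simp add: cosh_add sinh_add mult_ac add_ac)
    then have "sinh (y + c) \<noteq> 0" by (metis cosh_real_nonzero mult_zero_right)
    then show ?thesis using * by (simp add: nonzero_eq_divide_eq)
  qed
  then show ?thesis
    unfolding Alpha_minus_II class_solution.simps using c0 by blast
next
  case Alpha_minus_III
  with C \<mu> have m: "\<mu> = - 1" and "(\<alpha> 0)\<^sup>2 = 1" by auto
  then have a0: "\<alpha> 0 = 1 \<or> \<alpha> 0 = - 1" by (simp add: power2_eq_1_iff)
  have "\<alpha> y = \<alpha> 0" if y: "y \<in> {a..b}" for y
  proof -
    have *: "\<alpha> y * (cosh y + \<alpha> 0 * sinh y) = sinh y + \<alpha> 0 * cosh y"
      using riccati_linearization_minus ric z y m by blast
    have "cosh y + sinh y \<noteq> 0" "cosh y - sinh y \<noteq> 0"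
      unfolding cosh_plus_sinh cosh_minus_sinh by simp_all
    then show ?thesis using * a0
      by (elim disjE) (auto simp: algebra_simps, algebra+)
  qed
  then show ?thesis using a0 Alpha_minus_III by auto
qed

text \<open>
  Only the value and the derivative at 0 enter. The restrictions on the parameter \<open>c\<close> make every model
  solution smooth at 0, so these two numbers can be computed from the formula.
\<close>
lemma class_solution_imp_cond:
  assumes sol: "class_solution C \<alpha> {a..b}" and ab: "a < b" and z: "0 \<in> {a..b}"
    and der: "(\<alpha> has_real_derivative d) (at 0 within {a..b})"
  shows "class_cond C (\<alpha> 0) (- d - (\<alpha> 0)\<^sup>2)"
proof -
  have nb: "at 0 within {a..b} \<noteq> bot"
    using ab z by (simp add: trivial_limit_within islimpt_Icc)
  have uniq: "d = d'" if "\<And>y. y \<in> {a..b} \<Longrightarrow> \<alpha> y = f y" "(f has_real_derivative d') (at 0)" for f d'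
  proof -
    have "(f has_real_derivative d') (at 0 within {a..b})"
      using that(2) by (rule has_field_derivative_at_within)
    then have "(\<alpha> has_real_derivative d') (at 0 within {a..b})"
      using zero_less_one z by (rule has_field_derivative_transform_within) (use that(1) in auto)
    with der show ?thesis by (rule has_field_derivative_unique) (fact nb)
  qed
  show ?thesis
  proof (cases C)
    case Alpha_plus
    then obtain c where c: "\<bar>c\<bar> < pi / 2" and eq: "\<And>y. y \<in> {a..b} \<Longrightarrow> \<alpha> y = - tan (y + c)"
      using sol by auto
    have "cos c > 0" using c by (intro cos_gt_zero_pi) auto
    then have "((\<lambda>y. - tan (y + c)) has_real_derivative - inverse ((cos c)\<^sup>2)) (at 0)"
      by (auto intro!: derivative_eq_intros)
    from uniq[OF eq this] have "- d = 1 + (tan c)\<^sup>2"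
      using \<open>cos c > 0\<close> by (simp add: tan_sec power_inverse)
    then show ?thesis using Alpha_plus eq[OF z] by simp
  next
    case Alpha_zero_I
    then have eq: "\<And>y. y \<in> {a..b} \<Longrightarrow> \<alpha> y = 0" using sol by auto
    from uniq[OF eq, of 0] show ?thesis using Alpha_zero_I eq[OF z] by simp
  next
    case Alpha_zero_II
    then obtain c where c: "c \<noteq> 0" and eq: "\<And>y. y \<in> {a..b} \<Longrightarrow> \<alpha> y = 1 / (y + c)"
      using sol by auto
    have "((\<lambda>y. 1 / (y + c)) has_real_derivative - (1 / c\<^sup>2)) (at 0)"
      using c by (auto intro!: derivative_eq_intros simp: power2_eq_square)
    from uniq[OF eq this] show ?thesis using Alpha_zero_II eq[OF z] c by (simp add: power_divide)
  next
    case Alpha_minus_I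
    then obtain c where eq: "\<And>y. y \<in> {a..b} \<Longrightarrow> \<alpha> y = tanh (y + c)"
      using sol by auto
    have "((\<lambda>y. tanh (y + c)) has_real_derivative 1 - (tanh c)\<^sup>2) (at 0)"
      by (auto intro!: derivative_eq_intros)
    from uniq[OF eq this] have "- d - (\<alpha> 0)\<^sup>2 = - 1" using eq[OF z] by simp
    moreover have "(\<alpha> 0)\<^sup>2 < 1"
      using eq[OF z] tanh_real_bounds[of c] by (simp add: abs_square_less_1 abs_less_iff)
    ultimately show ?thesis using Alpha_minus_I by simp
  next
    case Alpha_minus_II
    then obtain c where c: "c \<noteq> 0" and eq: "\<And>y. y \<in> {a..b} \<Longrightarrow> \<alpha> y = cosh (y + c) / sinh (y + c)"
      using sol by auto
    have s: "sinh c \<noteq> 0" using c by simp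
    have cs: "(cosh c)\<^sup>2 = 1 + (sinh c)\<^sup>2" by (simp add: cosh_square_eq)
    have s2: "(sinh c)\<^sup>2 > 0" using s by simp
    have "((\<lambda>y. cosh (y + c) / sinh (y + c)) has_real_derivative
        (sinh c * sinh c - cosh c * cosh c) / (sinh c * sinh c)) (at 0)"
      using s by (auto intro!: derivative_eq_intros)
    from uniq[OF eq this] have "d = - (1 / (sinh c)\<^sup>2)"
      using cs by (simp add: power2_eq_square)
    moreover have "(\<alpha> 0)\<^sup>2 = 1 + 1 / (sinh c)\<^sup>2"
      unfolding eq[OF z] using cs s2 by (simp add: power_divide add_divide_distrib)
    moreover have "1 / (sinh c)\<^sup>2 > 0" using s2 by simp
    ultimately show ?thesis using Alpha_minus_II by simp
  next
    case Alpha_minus_III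
    then have "(\<forall>y\<in>{a..b}. \<alpha> y = 1) \<or> (\<forall>y\<in>{a..b}. \<alpha> y = - 1)" using sol by simp
    then obtain e :: real where e: "e\<^sup>2 = 1" and eq: "\<And>y. y \<in> {a..b} \<Longrightarrow> \<alpha> y = e"
      by (metis power2_minus power_one)
    from uniq[OF eq, of 0] have "d = 0" by simp
    then show ?thesis using Alpha_minus_III eq[OF z] e by simp
  qed
qed

section \<open>Approximation functions under isometries and homotheties\<close>

lemma approximation_functionE:
  assumes "approximation_function S L \<alpha>"
  obtains W V I \<beta> where "L \<subseteq> S" "L \<subseteq> {(y, 0, y) | y. True}" "open W" "L \<subseteq> W"
    "open V" "open I" "V \<subseteq> UNIV \<times> I" "real_analytic_on \<alpha> I" "real_analytic2_on \<beta> V"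
    "S \<inter> W = surface (graph_t (\<lambda>x y. y + \<alpha> y / 2 * x\<^sup>2 + \<beta> x y * x ^ 3)) V"
  using assms unfolding approximation_function_def by (elim conjE exE) (rule that)

text \<open>
  Scaling \<open>t = y + \<alpha>(y)/2 x^2 + \<dots>\<close> by \<open>k\<close> divides the quadratic coefficient by \<open>k\<close> and rescales its
  argument.
\<close>
lemma approximation_function_homothety:
  assumes "approximation_function S L \<alpha>" and k: "k > 0"
  shows "approximation_function ((\<lambda>p. k *\<^sub>R p) ` S) ((\<lambda>p. k *\<^sub>R p) ` L) (\<lambda>y. \<alpha> (y / k) / k)"
proof -
  obtain W V I \<beta> where LS: "L \<subseteq> S" "L \<subseteq> {(y, 0, y) | y. True}"
    and W: "open W" "L \<subseteq> W" and V: "open V" and I: "open I" and "V \<subseteq> UNIV \<times> I"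
    and an: "real_analytic_on \<alpha> I" "real_analytic2_on \<beta> V"
    and SW: "S \<inter> W = surface (graph_t (\<lambda>x y. y + \<alpha> y / 2 * x\<^sup>2 + \<beta> x y * x ^ 3)) V"
    using assms(1) by (rule approximation_functionE)
  have inj: "inj (\<lambda>p::L3. k *\<^sub>R p)" using k by (auto simp: inj_on_def)
  define \<beta>' where "\<beta>' = (\<lambda>x y. (1 / k\<^sup>2) * \<beta> ((1 / k) * x) ((1 / k) * y))"
  have "(\<lambda>p. k *\<^sub>R p) ` S \<inter> (\<lambda>p. k *\<^sub>R p) ` W =
      (\<lambda>p. k *\<^sub>R p) ` surface (graph_t (\<lambda>x y. y + \<alpha> y / 2 * x\<^sup>2 + \<beta> x y * x ^ 3)) V"
    using SW image_Int[OF inj] by metis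
  also have "\<dots> = surface (graph_t (\<lambda>x y. y + (\<alpha> (y / k) / k) / 2 * x\<^sup>2 + \<beta>' x y * x ^ 3)) ((\<lambda>p. k *\<^sub>R p) ` V)"
    unfolding surface_def image_image
  proof (rule image_cong[OF refl])
    fix p assume "p \<in> V"
    obtain x y where p: "p = (x, y)" by (cases p)
    show "k *\<^sub>R (case p of (u, v) \<Rightarrow> graph_t (\<lambda>x y. y + \<alpha> y / 2 * x\<^sup>2 + \<beta> x y * x ^ 3) u v) =
        (case k *\<^sub>R p of (u, v) \<Rightarrow> graph_t (\<lambda>x y. y + (\<alpha> (y / k) / k) / 2 * x\<^sup>2 + \<beta>' x y * x ^ 3) u v)"
      using k by (simp add: p graph_t_def \<beta>'_def field_simps power2_eq_square power3_eq_cube)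
  qed
  finally have eq: "(\<lambda>p. k *\<^sub>R p) ` S \<inter> (\<lambda>p. k *\<^sub>R p) ` W =
    surface (graph_t (\<lambda>x y. y + (\<alpha> (y / k) / k) / 2 * x\<^sup>2 + \<beta>' x y * x ^ 3)) ((\<lambda>p. k *\<^sub>R p) ` V)" .
  have an': "real_analytic_on (\<lambda>y. \<alpha> (y / k) / k) ((\<lambda>y. k *\<^sub>R y) ` I)"
  proof -
    have "(1 / k) * y \<in> I" if "y \<in> (\<lambda>y. k *\<^sub>R y) ` I" for y using that k by auto
    then show ?thesis
      using real_analytic_on_scale[OF an(1), of "1 / k" "(\<lambda>y. k *\<^sub>R y) ` I" "1 / k"] k by simp
  qed
  have bn': "real_analytic2_on \<beta>' ((\<lambda>p. k *\<^sub>R p) ` V)"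
    unfolding \<beta>'_def using k by (intro real_analytic2_on_scale[OF an(2)]) auto
  have op: "open ((\<lambda>p. k *\<^sub>R p) ` W)" "open ((\<lambda>p. k *\<^sub>R p) ` V)" "open ((\<lambda>y. k *\<^sub>R y) ` I)"
    using k W(1) V I by (intro open_scaling; simp)+
  have VI: "(\<lambda>p. k *\<^sub>R p) ` V \<subseteq> UNIV \<times> ((\<lambda>y. k *\<^sub>R y) ` I)"
    using \<open>V \<subseteq> UNIV \<times> I\<close> by auto
  have LW: "(\<lambda>p. k *\<^sub>R p) ` L \<subseteq> (\<lambda>p. k *\<^sub>R p) ` W" "(\<lambda>p. k *\<^sub>R p) ` L \<subseteq> (\<lambda>p. k *\<^sub>R p) ` S"
    "(\<lambda>p. k *\<^sub>R p) ` L \<subseteq> {(y, 0, y) | y. True}"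
    using W LS by auto
  show ?thesis
    unfolding approximation_function_def
    using eq an' bn' op VI LW by blast
qed

lemma linear_isometry_injective:
  assumes T: "linear_isometry_L3 T" and p: "T p = 0"
  shows "p = 0"
proof -
  have lin: "linear T" and iso: "\<And>p q. lorentz (T p) (T q) = lorentz p q"
    using T by (auto simp: linear_isometry_L3_def)
  have "lorentz p q = 0" for q
    using iso[of p q] p by (cases "T q") (simp add: zero_prod_def)
  from this[of "(1, 0, 0)"] this[of "(0, 1, 0)"] this[of "(0, 0, 1)"] show ?thesis
    by (cases p) (simp add: zero_prod_def)
qed

lemma class_along_isometry_image:
  assumes R: "linear_isometry_L3 R" and C: "class_along (R ` S) (R ` L) C"
  shows "class_along S L C"
proof -
  obtain T k \<alpha> where T: "linear_isometry_L3 T" "k > 0"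
    and a: "approximation_function ((\<lambda>p. k *\<^sub>R T p) ` R ` S) ((\<lambda>p. k *\<^sub>R T p) ` R ` L) \<alpha>"
    and s: "class_solution C \<alpha> {y. (y, 0, y) \<in> (\<lambda>p. k *\<^sub>R T p) ` R ` L}"
    using C unfolding class_along_def by blast
  have "linear_isometry_L3 (T \<circ> R)"
    using R T(1) linear_compose[of R T] by (simp add: linear_isometry_L3_def del: split_paired_All)
  then show ?thesis
    unfolding class_along_def using T(2) a s
    by (intro exI[of _ "T \<circ> R"] exI[of _ k] exI[of _ \<alpha>]) (simp add: image_image)
qed

lemma class_along_isometry_iff:
  assumes R: "linear_isometry_L3 R" and R': "linear_isometry_L3 R'" and inv: "\<And>p. R' (R p) = p"
  shows "class_along S L C \<longleftrightarrow> class_along (R ` S) (R ` L) C"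
proof
  assume "class_along S L C"
  then show "class_along (R ` S) (R ` L) C"
    using class_along_isometry_image[OF R', of "R ` S" "R ` L"] by (simp add: image_image inv)
qed (rule class_along_isometry_image[OF R])

text \<open>
  Parametrizes the line on which approximation functions are defined.
\<close>
definition null_ray :: "real \<Rightarrow> L3" where
  "null_ray y = (y, 0, y)"

text \<open>
  How the approximation function depends on the position of the surface. Let \<open>M\<close> be the isometry
  followed by the homothety. It maps \<open>\<ell> = (1, 0, 1)\<close> to \<open>l \<ell>\<close>. For a point \<open>p = (y + u, x, y)\<close> of
  \<open>S\<close> near the line, with image \<open>(y1 + v, \<xi>, y1)\<close>, preservation of the products with \<open>\<ell>\<close> and of the
  squares gives \<open>l v = k^2 u\<close> and \<open>\<xi>^2 - v^2 - 2 y1 v = k^2 (x^2 - u^2 - 2 y u)\<close>. As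
  \<open>u / x^2\<close> and \<open>v / \<xi>^2\<close> tend to \<open>\<alpha>/2\<close> and \<open>\<alpha>'/2\<close>, letting the image approach the line along a fixed
  value of \<open>y1\<close> relates the two functions.
\<close>
lemma approximation_function_transport:
  assumes T: "linear_isometry_L3 T" and k: "k > 0"
    and L: "L = null_ray ` {a..b}" and ab: "a \<le> 0" "0 \<le> b" "a < b"
    and S: "approximation_function S L \<alpha>"
    and TS: "approximation_function ((\<lambda>p. k *\<^sub>R T p) ` S) ((\<lambda>p. k *\<^sub>R T p) ` L) \<alpha>'"
  obtains l where "l \<noteq> 0" "(\<lambda>p. k *\<^sub>R T p) ` L = null_ray ` (\<lambda>s. l * s) ` {a..b}"
    "\<And>s. s \<in> {a..b} \<Longrightarrow> \<alpha>' (l * s) = \<alpha> s / l"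
proof -
  define M where "M = (\<lambda>p. k *\<^sub>R T p)"
  have linT: "linear T" and iso: "\<And>p q. lorentz (T p) (T q) = lorentz p q"
    using T by (auto simp: linear_isometry_L3_def)
  have linM: "linear M" unfolding M_def using linT by (rule linear_compose_scale_right)
  have isoM: "lorentz (M p) (M q) = k\<^sup>2 * lorentz p q" for p q
    unfolding iso[of p q, symmetric] M_def
    by (cases "T p"; cases "T q") (simp add: power2_eq_square algebra_simps)
  have injM: "inj M"
  proof (rule injI)
    fix p q assume "M p = M q"
    then have "T (p - q) = 0" using k linT by (simp add: M_def linear_diff)
    then show "p = q" using linear_isometry_injective[OF T, of "p - q"] by simp
  qed
  obtain N where N: "linear N" "\<And>p. N (M p) = p" "\<And>p. M (N p) = p"
    using linear_injective_isomorphism[OF linM injM] by blast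
  \<comment> \<open>a nonzero point of the segment determines the factor \<open>l\<close>\<close>
  define e where "e = (if a = 0 then b else a)"
  have e: "e \<noteq> 0" "e \<in> {a..b}" using ab by (auto simp: e_def)
  obtain W V I \<beta> where LS: "L \<subseteq> S" and W: "open W" "L \<subseteq> W" and V: "V \<subseteq> UNIV \<times> I"
    and an: "real_analytic_on \<alpha> I" "real_analytic2_on \<beta> V"
    and SW: "S \<inter> W = surface (graph_t (\<lambda>x y. y + \<alpha> y / 2 * x\<^sup>2 + \<beta> x y * x ^ 3)) V"
    using S by (rule approximation_functionE)
  obtain W' V' \<beta>' where LS': "M ` L \<subseteq> M ` S" "M ` L \<subseteq> {(y, 0, y) | y. True}" and W': "M ` L \<subseteq> W'"
    and V': "open V'" and an': "real_analytic2_on \<beta>' V'"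
    and SW': "M ` S \<inter> W' = surface (graph_t (\<lambda>x y. y + \<alpha>' y / 2 * x\<^sup>2 + \<beta>' x y * x ^ 3)) V'"
    using TS unfolding M_def[symmetric] by (rule approximation_functionE)
  have "M (null_ray e) \<in> M ` L" unfolding L using e(2) by (intro imageI)
  then obtain z where z: "M (null_ray e) = (z, 0, z)" using LS'(2) by blast
  define l where "l = z / e"
  have Mray: "M (null_ray s) = null_ray (l * s)" for s
  proof -
    have "null_ray s = (s / e) *\<^sub>R null_ray e" using e by (simp add: null_ray_def)
    then have "M (null_ray s) = (s / e) *\<^sub>R M (null_ray e)" by (simp only: linear_scale[OF linM])
    also have "\<dots> = (s / e) *\<^sub>R (z, 0, z)" by (simp only: z)
    finally show ?thesis by (simp add: null_ray_def l_def)
  qed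
  have l0: "l \<noteq> 0"
  proof
    assume "l = 0"
    then have "M (null_ray 1) = 0" using Mray[of 1] by (simp add: null_ray_def zero_prod_def)
    also have "0 = M 0" using linM by (simp add: linear_0)
    finally have "null_ray 1 = 0" using injM by (simp add: inj_eq)
    then show False by (simp add: null_ray_def zero_prod_def)
  qed
  have imgL: "M ` L = null_ray ` (\<lambda>s. l * s) ` {a..b}"
    by (simp add: L image_image Mray)
  have main: "\<alpha>' (l * s) = \<alpha> s / l" if s: "s \<in> {a..b}" for s
  proof -
    define y1 where "y1 = l * s"
    have "null_ray y1 \<in> M ` S \<inter> W'"
      using imgL s LS'(1) W' unfolding y1_def by blast
    then have in_V': "(0, y1) \<in> V'"
      unfolding SW' surface_def graph_t_def null_ray_def by auto
    have "null_ray s \<in> S \<inter> W"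
      using L s LS W(2) by blast
    then have in_V: "(0, s) \<in> V"
      unfolding SW surface_def graph_t_def null_ray_def by auto
    then have sI: "s \<in> I" using V by auto
    obtain c r where r: "r > 0" and c: "pseries2 c r (\<lambda>u v. \<beta> (0 + u) (s + v))"
      using an(2) in_V unfolding real_analytic2_on_iff by blast
    obtain c' r' where r': "r' > 0" and c': "pseries2 c' r' (\<lambda>u v. \<beta>' (0 + u) (y1 + v))"
      using an' in_V' unfolding real_analytic2_on_iff by blast
    obtain B0 where B0: "B0 \<ge> 0" "\<And>u v. \<bar>u\<bar> \<le> r / 2 \<Longrightarrow> \<bar>v\<bar> \<le> r / 2 \<Longrightarrow> \<bar>\<beta> (0 + u) (s + v)\<bar> \<le> B0"
      using pseries2_bounded_real[OF c, of "r / 2"] r by auto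
    obtain B1 where B1: "B1 \<ge> 0" "\<And>u v. \<bar>u\<bar> \<le> r' / 2 \<Longrightarrow> \<bar>v\<bar> \<le> r' / 2 \<Longrightarrow> \<bar>\<beta>' (0 + u) (y1 + v)\<bar> \<le> B1"
      using pseries2_bounded_real[OF c', of "r' / 2"] r' by auto
    define F where "F = at (0::real)"
    have x0: "((\<lambda>x. x) \<longlongrightarrow> 0) F" unfolding F_def by (rule tendsto_ident_at)
    have null: "((\<lambda>t. f t * g t) \<longlongrightarrow> 0) F"
      if "\<forall>\<^sub>F t in F. \<bar>f t\<bar> \<le> K" "(g \<longlongrightarrow> 0) F" for f g :: "real \<Rightarrow> real" and K
    proof (rule Lim_null_comparison)
      show "\<forall>\<^sub>F t in F. norm (f t * g t) \<le> K * \<bar>g t\<bar>"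
        using that(1) by eventually_elim (simp add: abs_mult mult_right_mono)
      show "((\<lambda>t. K * \<bar>g t\<bar>) \<longlongrightarrow> 0) F"
        using that(2) by (intro tendsto_mult_right_zero tendsto_rabs_zero)
    qed
    \<comment> \<open>a curve on the image of \<open>S\<close> that ends at \<open>null_ray y1\<close>, and its preimage \<open>p\<close> on \<open>S\<close>\<close>
    define P where "P = (\<lambda>x. (y1 + \<alpha>' y1 / 2 * x\<^sup>2 + \<beta>' x y1 * x ^ 3, x, y1))"
    define B where "B = (\<lambda>x. \<alpha>' y1 / 2 + \<beta>' x y1 * x)"
    have "\<forall>\<^sub>F x in F. x \<in> {-r'/2<..<r'/2}"
      unfolding F_def using r' by (intro eventually_at_in_open') auto
    then have "\<forall>\<^sub>F x in F. \<bar>\<beta>' x y1\<bar> \<le> B1"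
      by eventually_elim (use B1(2)[of _ 0] r' in auto)
    then have limb: "((\<lambda>x. \<beta>' x y1 * x) \<longlongrightarrow> 0) F" using x0 by (rule null)
    have limB: "(B \<longlongrightarrow> \<alpha>' y1 / 2) F"
      unfolding B_def using tendsto_add[OF tendsto_const limb, of "\<alpha>' y1 / 2"] by simp
    have P_eq: "P x = (y1 + x\<^sup>2 * B x, x, y1)" for x
      by (simp add: P_def B_def power2_eq_square power3_eq_cube algebra_simps)
    have "((\<lambda>x. (y1 + x\<^sup>2 * B x, x, y1)) \<longlongrightarrow> (y1 + 0\<^sup>2 * (\<alpha>' y1 / 2), 0, y1)) F"
      by (intro tendsto_intros limB x0)
    then have limP: "(P \<longlongrightarrow> null_ray y1) F"
      by (simp add: P_eq[abs_def] null_ray_def)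
    define p where "p = (\<lambda>x. N (P x))"
    have "(p \<longlongrightarrow> N (null_ray y1)) F"
      unfolding p_def using linear_conv_bounded_linear N(1) limP bounded_linear.tendsto by blast
    then have limp: "(p \<longlongrightarrow> null_ray s) F"
      using N(2)[of "null_ray s"] by (simp add: Mray y1_def)
    define X where "X = (\<lambda>x. fst (snd (p x)))"
    define Y where "Y = (\<lambda>x. snd (snd (p x)))"
    have limX: "(X \<longlongrightarrow> 0) F" and limY: "(Y \<longlongrightarrow> s) F"
      using tendsto_fst[OF tendsto_snd[OF limp]] tendsto_snd[OF tendsto_snd[OF limp]]
      by (simp_all add: X_def Y_def null_ray_def)
    define A where "A = (\<lambda>x. \<alpha> (Y x) / 2 + \<beta> (X x) (Y x) * X x)"
    have "\<forall>\<^sub>F x in F. X x \<in> {-r/2<..<r/2}"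
      by (rule topological_tendstoD[OF limX]) (use r in auto)
    moreover have "\<forall>\<^sub>F x in F. Y x \<in> {s - r/2<..<s + r/2}"
      by (rule topological_tendstoD[OF limY]) (use r in auto)
    ultimately have "\<forall>\<^sub>F x in F. \<bar>\<beta> (X x) (Y x)\<bar> \<le> B0"
    proof eventually_elim
      case (elim x)
      then have "\<bar>X x\<bar> \<le> r / 2" "\<bar>Y x - s\<bar> \<le> r / 2"
        unfolding greaterThanLessThan_iff abs_le_iff by linarith+
      from B0(2)[OF this] show ?case by simp
    qed
    then have "((\<lambda>x. \<beta> (X x) (Y x) * X x) \<longlongrightarrow> 0) F" using limX by (rule null)
    moreover have "((\<lambda>x. \<alpha> (Y x)) \<longlongrightarrow> \<alpha> s) F"
      using real_analytic_on_isCont[OF an(1) sI] limY by (rule isCont_tendsto_compose)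
    ultimately have "(A \<longlongrightarrow> \<alpha> s / 2 + 0) F"
      unfolding A_def by (intro tendsto_intros) auto
    then have limA: "(A \<longlongrightarrow> \<alpha> s / 2) F" by simp
    have ev: "\<forall>\<^sub>F x in F. l * B x * (1 - ((X x)\<^sup>2 * (A x)\<^sup>2 + 2 * (Y x - s) * A x)) = A x * (1 - x\<^sup>2 * (B x)\<^sup>2)"
    proof -
      have "open ((\<lambda>x. (x, y1)) -` V')"
        using V' by (intro open_vimage) (auto intro!: continuous_intros)
      then have "\<forall>\<^sub>F x in F. x \<in> (\<lambda>x. (x, y1)) -` V'"
        unfolding F_def using in_V' by (intro eventually_at_in_open') auto
      moreover have "\<forall>\<^sub>F x in F. p x \<in> W"
        using limp W(1) \<open>null_ray s \<in> S \<inter> W\<close> by (intro topological_tendstoD) auto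
      moreover have "\<forall>\<^sub>F x in F. x \<noteq> 0"
        unfolding F_def by (rule eventually_neq_at_within)
      ultimately show ?thesis
      proof eventually_elim
        case (elim x)
        have "P x \<in> M ` S \<inter> W'"
          unfolding SW' surface_def P_def graph_t_def using elim(1) by force
        then obtain q where q: "q \<in> S" "P x = M q" by auto
        then have "p x \<in> S" by (simp add: p_def N(2))
        then have "p x \<in> S \<inter> W" using elim(2) by simp
        then obtain x2 y2 where px2: "p x = (y2 + \<alpha> y2 / 2 * x2\<^sup>2 + \<beta> x2 y2 * x2 ^ 3, x2, y2)"
          unfolding SW surface_def graph_t_def by auto
        have X: "X x = x2" and Y: "Y x = y2" by (simp_all add: X_def Y_def px2)
        define u where "u = x2\<^sup>2 * A x"
        have px: "p x = (y2 + u, x2, y2)"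
          by (simp add: px2 u_def A_def X Y power2_eq_square power3_eq_cube algebra_simps)
        have MP: "M (p x) = P x" by (simp add: p_def N(3))
        \<comment> \<open>the product with the null direction, then the square\<close>
        have e1: "l * (x\<^sup>2 * B x) = k\<^sup>2 * u"
          using isoM[of "p x" "null_ray 1"] unfolding MP Mray
          by (simp add: P_eq px null_ray_def algebra_simps)
        have e2: "- (y1 + x\<^sup>2 * B x) * (y1 + x\<^sup>2 * B x) + x * x + y1 * y1 =
            k\<^sup>2 * (- (y2 + u) * (y2 + u) + x2 * x2 + y2 * y2)"
          using isoM[of "p x" "p x"] unfolding MP by (simp add: P_eq px)
        have "x\<^sup>2 * (1 - x\<^sup>2 * (B x)\<^sup>2) = k\<^sup>2 * x2\<^sup>2 * (1 - (x2\<^sup>2 * (A x)\<^sup>2 + 2 * (y2 - s) * A x))"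
          using e1 e2 unfolding u_def y1_def by algebra
        with e1 have "x\<^sup>2 * (l * B x * (1 - (x2\<^sup>2 * (A x)\<^sup>2 + 2 * (y2 - s) * A x))) =
            x\<^sup>2 * (A x * (1 - x\<^sup>2 * (B x)\<^sup>2))"
          unfolding u_def by algebra
        then show ?case using elim(3) by (simp add: X Y)
      qed
    qed
    have "((\<lambda>x. l * B x * (1 - ((X x)\<^sup>2 * (A x)\<^sup>2 + 2 * (Y x - s) * A x))) \<longlongrightarrow>
        l * (\<alpha>' y1 / 2) * (1 - (0\<^sup>2 * (\<alpha> s / 2)\<^sup>2 + 2 * (s - s) * (\<alpha> s / 2)))) F"
      by (intro tendsto_intros limA limB limX limY)
    moreover have "((\<lambda>x. A x * (1 - x\<^sup>2 * (B x)\<^sup>2)) \<longlongrightarrow> \<alpha> s / 2 * (1 - 0\<^sup>2 * (\<alpha>' y1 / 2)\<^sup>2)) F"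
      by (intro tendsto_intros limA limB x0)
    ultimately have "l * (\<alpha>' y1 / 2) * (1 - (0\<^sup>2 * (\<alpha> s / 2)\<^sup>2 + 2 * (s - s) * (\<alpha> s / 2))) =
        \<alpha> s / 2 * (1 - 0\<^sup>2 * (\<alpha>' y1 / 2)\<^sup>2)"
      using ev by (intro tendsto_unique[of F]) (auto simp: F_def elim: tendsto_cong[THEN iffD1, rotated])
    then show ?thesis using l0 by (simp add: y1_def field_simps)
  qed
  show ?thesis
    using that[OF l0] imgL main unfolding M_def by blast
qed

text \<open>
  The class can be read off in the given position of the surface. If some isometry and homothety
  exhibit the class \<open>C\<close>, the criterion holds for the transported function and is invariant under the
  rescaling of \<open>(\<alpha>(0), \<mu>)\<close>; conversely a homothety normalizes \<open>\<mu>\<close>.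
\<close>
lemma class_along_iff_class_cond:
  assumes L: "L = null_ray ` {a..b}" and ab: "a \<le> 0" "0 \<le> b" "a < b"
    and S: "approximation_function S L \<alpha>" and ric: "riccati_on \<alpha> \<mu> {a..b}"
  shows "class_along S L C \<longleftrightarrow> class_cond C (\<alpha> 0) \<mu>"
proof
  assume "class_along S L C"
  then obtain T k \<alpha>' where T: "linear_isometry_L3 T" "k > 0"
    and TS: "approximation_function ((\<lambda>p. k *\<^sub>R T p) ` S) ((\<lambda>p. k *\<^sub>R T p) ` L) \<alpha>'"
    and sol: "class_solution C \<alpha>' {y. (y, 0, y) \<in> (\<lambda>p. k *\<^sub>R T p) ` L}"
    unfolding class_along_def by blast
  obtain l where l: "l \<noteq> 0" and imgL: "(\<lambda>p. k *\<^sub>R T p) ` L = null_ray ` (\<lambda>s. l * s) ` {a..b}"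
    and \<alpha>': "\<And>s. s \<in> {a..b} \<Longrightarrow> \<alpha>' (l * s) = \<alpha> s / l"
    using approximation_function_transport[OF T L ab S TS] by metis
  define a' b' where "a' = (if l > 0 then l * a else l * b)" and "b' = (if l > 0 then l * b else l * a)"
  have J: "(\<lambda>s. l * s) ` {a..b} = {a'..b'}"
    using image_mult_atLeastAtMost_if[of l a b] l ab by (auto simp: a'_def b'_def)
  have ab': "a' < b'" "0 \<in> {a'..b'}"
    using l ab J by (auto simp: a'_def b'_def mult_less_cancel_left zero_le_mult_iff mult_le_0_iff)
  have "{y. (y, 0, y) \<in> (\<lambda>p. k *\<^sub>R T p) ` L} = {a'..b'}"
    unfolding imgL J by (auto simp: null_ray_def)
  with sol have sol': "class_solution C \<alpha>' {a'..b'}" by simp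
  have \<alpha>'_eq: "\<alpha>' y = \<alpha> (y / l) / l" and div: "y / l \<in> {a..b}" if y: "y \<in> {a'..b'}" for y
  proof -
    obtain s where s: "s \<in> {a..b}" "y = l * s" using y unfolding J[symmetric] by auto
    then show "\<alpha>' y = \<alpha> (y / l) / l" "y / l \<in> {a..b}" using \<alpha>'[OF s(1)] l by auto
  qed
  have "(\<alpha> has_real_derivative - \<mu> - (\<alpha> 0)\<^sup>2) (at (0 / l) within {a..b})"
    using ric ab by (auto simp: riccati_on_def)
  then have "(\<alpha> has_real_derivative - \<mu> - (\<alpha> 0)\<^sup>2) (at (0 / l) within (\<lambda>y. y / l) ` {a'..b'})"
    by (rule DERIV_subset) (use div in auto)
  moreover have "((\<lambda>y. y / l) has_real_derivative 1 / l) (at 0 within {a'..b'})"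
    using l by (auto intro!: derivative_eq_intros)
  ultimately have "((\<alpha> \<circ> (\<lambda>y. y / l)) has_real_derivative (- \<mu> - (\<alpha> 0)\<^sup>2) * (1 / l)) (at 0 within {a'..b'})"
    by (rule DERIV_image_chain)
  then have "((\<lambda>y. \<alpha> (y / l) / l) has_real_derivative (- \<mu> - (\<alpha> 0)\<^sup>2) * (1 / l) / l) (at 0 within {a'..b'})"
    by (intro DERIV_cdivide) (simp add: o_def)
  then have "(\<alpha>' has_real_derivative (- \<mu> - (\<alpha> 0)\<^sup>2) * (1 / l) / l) (at 0 within {a'..b'})"
    by (rule has_field_derivative_transform_within[OF _ zero_less_one ab'(2)]) (use \<alpha>'_eq in auto)
  from class_solution_imp_cond[OF sol' ab' this]
  have "class_cond C (\<alpha>' 0) (- ((- \<mu> - (\<alpha> 0)\<^sup>2) * (1 / l) / l) - (\<alpha>' 0)\<^sup>2)" .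
  moreover have "\<alpha>' 0 = \<alpha> 0 / l" using \<alpha>'_eq[OF ab'(2)] by simp
  moreover have "- ((- \<mu> - (\<alpha> 0)\<^sup>2) * (1 / l) / l) - (\<alpha> 0 / l)\<^sup>2 = \<mu> / l\<^sup>2"
    using l by (simp add: field_simps power2_eq_square)
  ultimately show "class_cond C (\<alpha> 0) \<mu>"
    using class_cond_scale[OF l] by simp
next
  assume C: "class_cond C (\<alpha> 0) \<mu>"
  \<comment> \<open>\<open>\<mu> / k\<^sup>2\<close> is 1, 0 or -1\<close>
  define k where "k = (if \<mu> = 0 then 1 else sqrt \<bar>\<mu>\<bar>)"
  have k: "k > 0" by (simp add: k_def)
  define \<alpha>' where "\<alpha>' = (\<lambda>y. \<alpha> (y / k) / k)"
  have app: "approximation_function ((\<lambda>p. k *\<^sub>R p) ` S) ((\<lambda>p. k *\<^sub>R p) ` L) \<alpha>'"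
    unfolding \<alpha>'_def using S k by (rule approximation_function_homothety)
  have J: "{y. (y, 0, y) \<in> (\<lambda>p. k *\<^sub>R p) ` L} = {k * a..k * b}"
  proof -
    have "(\<lambda>p. k *\<^sub>R p) ` L = null_ray ` (\<lambda>s. k * s) ` {a..b}"
      unfolding L by (auto simp: null_ray_def image_image)
    also have "(\<lambda>s. k * s) ` {a..b} = {k * a..k * b}"
      using k ab image_mult_atLeastAtMost_if[of k a b] by auto
    finally show ?thesis by (auto simp: null_ray_def)
  qed
  have "riccati_on \<alpha>' (\<mu> / k\<^sup>2) {k * a..k * b}"
    unfolding riccati_on_def
  proof
    fix y assume y: "y \<in> {k * a..k * b}"
    have div: "z / k \<in> {a..b}" if "z \<in> {k * a..k * b}" for z
      using that k by (auto simp: field_simps)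
    have "(\<alpha> has_real_derivative - \<mu> - (\<alpha> (y / k))\<^sup>2) (at (y / k) within {a..b})"
      using ric div[OF y] by (auto simp: riccati_on_def)
    then have "(\<alpha> has_real_derivative - \<mu> - (\<alpha> (y / k))\<^sup>2) (at (y / k) within (\<lambda>y. y / k) ` {k * a..k * b})"
      by (rule DERIV_subset) (use div in auto)
    moreover have "((\<lambda>y. y / k) has_real_derivative 1 / k) (at y within {k * a..k * b})"
      using k by (auto intro!: derivative_eq_intros)
    ultimately have "((\<alpha> \<circ> (\<lambda>y. y / k)) has_real_derivative (- \<mu> - (\<alpha> (y / k))\<^sup>2) * (1 / k)) (at y within {k * a..k * b})"
      by (rule DERIV_image_chain)
    then have "(\<alpha>' has_real_derivative (- \<mu> - (\<alpha> (y / k))\<^sup>2) * (1 / k) / k) (at y within {k * a..k * b})"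
      unfolding \<alpha>'_def by (intro DERIV_cdivide) (simp add: o_def)
    moreover have "(- \<mu> - (\<alpha> (y / k))\<^sup>2) * (1 / k) / k = - (\<mu> / k\<^sup>2) - (\<alpha>' y)\<^sup>2"
      using k by (simp add: \<alpha>'_def field_simps power2_eq_square)
    ultimately show "(\<alpha>' has_real_derivative - (\<mu> / k\<^sup>2) - (\<alpha>' y)\<^sup>2) (at y within {k * a..k * b})"
      by simp
  qed
  moreover have "0 \<in> {k * a..k * b}"
    using k ab by (auto simp: mult_le_0_iff)
  moreover have "\<mu> / k\<^sup>2 \<in> {1, 0, - 1}"
    by (auto simp: k_def abs_if)
  moreover have "class_cond C (\<alpha>' 0) (\<mu> / k\<^sup>2)"
    using C class_cond_scale[of k] k by (simp add: \<alpha>'_def)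
  ultimately have "class_solution C \<alpha>' {k * a..k * b}"
    by (rule riccati_class_solution)
  moreover have "linear_isometry_L3 (\<lambda>p. p)"
    by (simp add: linear_isometry_L3_def linear_ident)
  ultimately show "class_along S L C"
    unfolding class_along_def using app J k
    by (intro exI[of _ "\<lambda>p. p"] exI[of _ k] exI[of _ \<alpha>']) simp
qed

section \<open>From the differential equations to the Riccati equation\<close>

lemma eventually_at_0_punctured:
  fixes r :: real
  assumes "r > 0"
  shows "\<forall>\<^sub>F x in at 0. x \<in> {-r<..<r}" "\<forall>\<^sub>F x in at (0::real). x \<noteq> 0"
proof -
  show "\<forall>\<^sub>F x in at 0. x \<in> {-r<..<r}"
    using assms by (intro eventually_at_in_open') auto
qed (rule eventually_neq_at_within)

lemma pseries2_isCont1: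
  fixes f :: "real \<Rightarrow> real \<Rightarrow> real"
  assumes "pseries2 c r f" "\<bar>x\<bar> < r" "\<bar>y\<bar> < r"
  shows "isCont (\<lambda>s. f s y) x"
  using pseries2_deriv1(2)[OF assms] by (rule DERIV_isCont)

lemma pseries2_tendsto0:
  fixes f :: "real \<Rightarrow> real \<Rightarrow> real"
  assumes f: "pseries2 c r f" and r: "r > 0"
  shows "((\<lambda>x. f x 0) \<longlongrightarrow> c 0 0) (at 0)"
  using pseries2_isCont1[OF f, of 0 0] pseries2_at_0[OF f r] r by (simp add: isCont_def)

lemma pseries2_tendsto1:
  fixes f :: "real \<Rightarrow> real \<Rightarrow> real"
  assumes f: "pseries2 c r f" and r: "r > 0"
  shows "((\<lambda>x. (f x 0 - c 0 0) / x) \<longlongrightarrow> c 1 0) (at 0)"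
proof -
  obtain f1 where f1: "pseries2 (\<lambda>m. c (Suc m)) r f1"
    "\<And>x y. \<bar>x\<bar> < r \<Longrightarrow> \<bar>y\<bar> < r \<Longrightarrow> f x y = f 0 y + x * f1 x y"
    using pseries2_shift[OF f] by metis
  from eventually_at_0_punctured[OF r] have "\<forall>\<^sub>F x in at 0. f1 x 0 = (f x 0 - c 0 0) / x"
  proof eventually_elim
    case (elim x)
    then show ?case using f1(2)[of x 0] r pseries2_at_0[OF f r] by (simp add: abs_less_iff)
  qed
  moreover have "((\<lambda>x. f1 x 0) \<longlongrightarrow> c (Suc 0) 0) (at 0)"
    using pseries2_tendsto0[OF f1(1) r] .
  ultimately show ?thesis by (simp add: tendsto_cong)
qed

lemma pseries2_tendsto2:
  fixes f :: "real \<Rightarrow> real \<Rightarrow> real"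
  assumes f: "pseries2 c r f" and r: "r > 0" and c1: "c 1 0 = 0"
  shows "((\<lambda>x. (f x 0 - c 0 0) / x\<^sup>2) \<longlongrightarrow> c 2 0) (at 0)"
proof -
  obtain f1 where f1: "pseries2 (\<lambda>m. c (Suc m)) r f1"
    "\<And>x y. \<bar>x\<bar> < r \<Longrightarrow> \<bar>y\<bar> < r \<Longrightarrow> f x y = f 0 y + x * f1 x y"
    using pseries2_shift[OF f] by metis
  from eventually_at_0_punctured[OF r] have "\<forall>\<^sub>F x in at 0. (f1 x 0 - c (Suc 0) 0) / x = (f x 0 - c 0 0) / x\<^sup>2"
  proof eventually_elim
    case (elim x)
    then show ?case using f1(2)[of x 0] r pseries2_at_0[OF f r] c1
      by (simp add: abs_less_iff power2_eq_square)
  qed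
  moreover have "((\<lambda>x. (f1 x 0 - c (Suc 0) 0) / x) \<longlongrightarrow> c (Suc 1) 0) (at 0)"
    using pseries2_tendsto1[OF f1(1) r] .
  ultimately show ?thesis by (simp add: tendsto_cong numeral_2_eq_2)
qed

text \<open>
  The equation divided by \<open>x^2\<close>, in the limit \<open>x = 0\<close>. For \<open>\<epsilon> = 1\<close> it is the zero mean curvature
  equation and for \<open>\<epsilon> = - 1\<close> the Born-Infeld equation, with the variable transversal to the line in
  first place. In terms of \<open>A = f_xx(0, \<cdot>)\<close> the conclusion reads \<open>A'' + 2 \<epsilon> A A' = 0\<close>.
\<close>
lemma pde_coefficient_relation:
  fixes f :: "real \<Rightarrow> real \<Rightarrow> real"
  assumes f: "pseries2 c r f" and r: "r > 0"
    and c: "c 0 1 = 1" "c 0 2 = 0" "c 1 0 = 0" "c 1 1 = 0" "c 1 2 = 0"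
    and pde: "\<And>x. \<bar>x\<bar> < r \<Longrightarrow> (1 - (D2 f x 0)\<^sup>2) * D1 (D1 f) x 0
        + 2 * D1 f x 0 * D2 f x 0 * D2 (D1 f) x 0 + (\<epsilon> - (D1 f x 0)\<^sup>2) * D2 (D2 f) x 0 = 0"
  shows "2 * c 2 0 * c 2 1 + \<epsilon> * c 2 2 = 0"
proof -
  define p where "p = (\<lambda>x. D1 f x 0)"
  define q where "q = (\<lambda>x. D2 f x 0)"
  note d1 = pseries2_deriv1(1)[OF f] and d2 = pseries2_deriv2(1)[OF f]
  note d11 = pseries2_deriv1(1)[OF d1] and d12 = pseries2_deriv2(1)[OF d1]
    and d22 = pseries2_deriv2(1)[OF d2]
  have c': "c 0 (Suc 0) = 1" "c 0 (Suc (Suc 0)) = 0" "c (Suc 0) 0 = 0" "c (Suc 0) (Suc 0) = 0"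
    "c (Suc 0) (Suc (Suc 0)) = 0"
    using c by (simp_all add: numeral_2_eq_2)
  have lp: "((\<lambda>x. p x / x) \<longlongrightarrow> 2 * c 2 0) (at 0)"
    using pseries2_tendsto1[OF d1 r] c' by (simp add: dcoeff1_def p_def numeral_2_eq_2)
  have lp0: "(p \<longlongrightarrow> 0) (at 0)"
    using pseries2_tendsto0[OF d1 r] c' by (simp add: dcoeff1_def p_def)
  have lq0: "(q \<longlongrightarrow> 1) (at 0)"
    using pseries2_tendsto0[OF d2 r] c' by (simp add: dcoeff2_def q_def)
  have lq: "((\<lambda>x. (q x - 1) / x\<^sup>2) \<longlongrightarrow> c 2 1) (at 0)"
    using pseries2_tendsto2[OF d2 r] c' by (simp add: dcoeff2_def q_def)
  have l11: "((\<lambda>x. D1 (D1 f) x 0) \<longlongrightarrow> 2 * c 2 0) (at 0)"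
    using pseries2_tendsto0[OF d11 r] by (simp add: dcoeff1_def numeral_2_eq_2)
  have l12: "((\<lambda>x. D2 (D1 f) x 0 / x) \<longlongrightarrow> 2 * c 2 1) (at 0)"
    using pseries2_tendsto1[OF d12 r] c' by (simp add: dcoeff1_def dcoeff2_def numeral_2_eq_2)
  have l22: "((\<lambda>x. D2 (D2 f) x 0 / x\<^sup>2) \<longlongrightarrow> 2 * c 2 2) (at 0)"
    using pseries2_tendsto2[OF d22 r] c' by (simp add: dcoeff2_def numeral_2_eq_2)
  \<comment> \<open>the left-hand side of the equation divided by \<open>x\<^sup>2\<close>\<close>
  have "((\<lambda>x. - ((q x - 1) / x\<^sup>2) * (q x + 1) * D1 (D1 f) x 0
      + 2 * (p x / x) * q x * (D2 (D1 f) x 0 / x) + (\<epsilon> - (p x)\<^sup>2) * (D2 (D2 f) x 0 / x\<^sup>2)) \<longlongrightarrow>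
      - c 2 1 * (1 + 1) * (2 * c 2 0) + 2 * (2 * c 2 0) * 1 * (2 * c 2 1) + (\<epsilon> - 0\<^sup>2) * (2 * c 2 2)) (at 0)"
    by (intro tendsto_intros lp lp0 lq lq0 l11 l12 l22)
  moreover have "\<forall>\<^sub>F x in at 0. - ((q x - 1) / x\<^sup>2) * (q x + 1) * D1 (D1 f) x 0
      + 2 * (p x / x) * q x * (D2 (D1 f) x 0 / x) + (\<epsilon> - (p x)\<^sup>2) * (D2 (D2 f) x 0 / x\<^sup>2) = 0"
  proof -
    from eventually_at_0_punctured[OF r] show ?thesis
    proof eventually_elim
      case (elim x)
      have "- ((q x - 1) / x\<^sup>2) * (q x + 1) * D1 (D1 f) x 0
          + 2 * (p x / x) * q x * (D2 (D1 f) x 0 / x) + (\<epsilon> - (p x)\<^sup>2) * (D2 (D2 f) x 0 / x\<^sup>2) =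
          ((1 - (q x)\<^sup>2) * D1 (D1 f) x 0 + 2 * p x * q x * D2 (D1 f) x 0
            + (\<epsilon> - (p x)\<^sup>2) * D2 (D2 f) x 0) / x\<^sup>2"
        using elim(2) by (simp add: field_simps power2_eq_square)
      also have "\<dots> = 0"
        using pde[of x] elim(1) by (simp add: p_def q_def abs_less_iff)
      finally show ?case .
    qed
  qed
  ultimately have "((\<lambda>x. 0) \<longlongrightarrow> - c 2 1 * (1 + 1) * (2 * c 2 0) + 2 * (2 * c 2 0) * 1 * (2 * c 2 1)
      + (\<epsilon> - 0\<^sup>2) * (2 * c 2 2)) (at (0::real))"
    by (rule tendsto_cong[THEN iffD1, rotated])
  then have "0 = - c 2 1 * (1 + 1) * (2 * c 2 0) + 2 * (2 * c 2 0) * 1 * (2 * c 2 1) + (\<epsilon> - 0\<^sup>2) * (2 * c 2 2)"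
    by (simp add: tendsto_const_iff)
  then show ?thesis by (simp add: algebra_simps)
qed

lemma pseries2_affine_axis:
  fixes f :: "real \<Rightarrow> real \<Rightarrow> real"
  assumes f: "pseries2 c r f" and r: "r > 0" and ax: "\<And>s. \<bar>s\<bar> < r \<Longrightarrow> f 0 s = k + m * s"
  shows "c 0 0 = k" "c 0 1 = m" "c 0 2 = 0" "\<And>s. \<bar>s\<bar> < r \<Longrightarrow> D2 f 0 s = m"
proof -
  have D: "D2 g 0 s = m'" if g: "pseries2 c' r g" and ax: "\<And>s. \<bar>s\<bar> < r \<Longrightarrow> g 0 s = k' + m' * s"
    and s: "\<bar>s\<bar> < r" for g c' k' m' s
  proof -
    have "((\<lambda>s. g 0 s) has_real_derivative D2 g 0 s) (at s)"
      using s r by (intro pseries2_deriv2(2)[OF g]) auto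
    moreover have "((\<lambda>s. k' + m' * s) has_real_derivative m') (at s)"
      by (auto intro!: derivative_eq_intros)
    then have "((\<lambda>s. g 0 s) has_real_derivative m') (at s)"
      by (rule has_field_derivative_transform_within_open[where S = "{-r<..<r}"]) (use s ax in auto)
    ultimately show ?thesis by (rule DERIV_unique)
  qed
  note d2 = pseries2_deriv2(1)[OF f]
  show "c 0 0 = k" using pseries2_at_0[OF f r] ax[of 0] r by simp
  show *: "\<And>s. \<bar>s\<bar> < r \<Longrightarrow> D2 f 0 s = m" using D[OF f ax] .
  then show "c 0 1 = m" using pseries2_at_0[OF d2 r] r by (simp add: dcoeff2_def)
  have "D2 (D2 f) 0 0 = 0" using D[OF d2, of m 0 0] * r by simp
  then show "c 0 2 = 0"
    using pseries2_at_0[OF pseries2_deriv2(1)[OF d2] r] by (simp add: dcoeff2_def numeral_2_eq_2)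
qed

text \<open>
  A local expansion at \<open>(0, y0)\<close> of a function in canonical position: along the axis its graph is the
  null line, and the gradient there is \<open>(0, 1)\<close>.
\<close>
definition axis_chart :: "(real \<Rightarrow> real \<Rightarrow> real) \<Rightarrow> real \<Rightarrow> (nat \<Rightarrow> nat \<Rightarrow> real) \<Rightarrow> real \<Rightarrow> bool" where
  "axis_chart f y0 c r \<longleftrightarrow> r > 0 \<and> pseries2 c r (\<lambda>u v. f u (y0 + v)) \<and>
     (\<forall>v. \<bar>v\<bar> < r \<longrightarrow> f 0 (y0 + v) = y0 + v \<and> D1 f 0 (y0 + v) = 0)"

lemma axis_chart_recenter:
  assumes ch: "axis_chart f 0 c r" and y0: "\<bar>y0\<bar> < r"
  obtains c' r' where "axis_chart f y0 c' r'" "r' \<le> r - \<bar>y0\<bar>"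
proof -
  have r: "r > 0" and c: "pseries2 c r (\<lambda>u v. f u (0 + v))"
    and ax: "\<And>v. \<bar>v\<bar> < r \<Longrightarrow> f 0 (0 + v) = 0 + v" "\<And>v. \<bar>v\<bar> < r \<Longrightarrow> D1 f 0 (0 + v) = 0"
    using ch unfolding axis_chart_def by blast+
  have zero: "\<bar>0\<bar> < r" using r by simp
  obtain c' s where s: "s > 0" and c': "pseries2 c' s (\<lambda>u v. f (0 + u) (0 + (y0 + v)))"
    by (rule pseries2_recenter[OF c zero y0])
  define r' where "r' = min s (r - \<bar>y0\<bar>)"
  have r': "r' > 0" "r' \<le> s" "r' \<le> r - \<bar>y0\<bar>" using s y0 by (auto simp: r'_def)
  have "f 0 (y0 + v) = y0 + v \<and> D1 f 0 (y0 + v) = 0" if "\<bar>v\<bar> < r'" for v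
  proof -
    have "\<bar>y0 + v\<bar> < r" using that r'(3) by linarith
    then show ?thesis using ax by simp
  qed
  then have "axis_chart f y0 c' r'"
    unfolding axis_chart_def using r'(1) pseries2_mono[OF c' r'(2)] by simp
  then show ?thesis using that r'(3) by blast
qed

text \<open>
  With \<open>A = f_xx(0, \<cdot>)\<close> the relation between the coefficients says that \<open>A' + \<epsilon> A^2\<close> is constant. The
  Riccati equation in its standard form is the one for \<open>\<epsilon> A\<close>.
\<close>
lemma riccati_of_pde:
  fixes f :: "real \<Rightarrow> real \<Rightarrow> real"
  assumes chart: "\<And>y0. y0 \<in> {a..b} \<Longrightarrow> \<exists>c r. axis_chart f y0 c r \<and>
      (\<forall>x. \<bar>x\<bar> < r \<longrightarrow> (1 - (D2 f x y0)\<^sup>2) * D1 (D1 f) x y0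
        + 2 * D1 f x y0 * D2 f x y0 * D2 (D1 f) x y0 + (\<epsilon> - (D1 f x y0)\<^sup>2) * D2 (D2 f) x y0 = 0)"
    and z: "0 \<in> {a..b}" and eps: "\<epsilon>\<^sup>2 = 1"
  shows "riccati_on (\<lambda>y. \<epsilon> * D1 (D1 f) 0 y) (- (\<epsilon> * D2 (D1 (D1 f)) 0 0) - (D1 (D1 f) 0 0)\<^sup>2) {a..b}"
proof -
  define A where "A = (\<lambda>y. D1 (D1 f) 0 y)"
  define A' where "A' = (\<lambda>y. D2 (D1 (D1 f)) 0 y)"
  have der: "(A has_real_derivative A' y0) (at y0)"
    and der2: "(A' has_real_derivative - 2 * \<epsilon> * A y0 * A' y0) (at y0)" if y0: "y0 \<in> {a..b}" for y0
  proof -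
    obtain c r where chart: "axis_chart f y0 c r"
      and pde: "\<And>x. \<bar>x\<bar> < r \<Longrightarrow> (1 - (D2 f x y0)\<^sup>2) * D1 (D1 f) x y0
        + 2 * D1 f x y0 * D2 f x y0 * D2 (D1 f) x y0 + (\<epsilon> - (D1 f x y0)\<^sup>2) * D2 (D2 f) x y0 = 0"
      using chart[OF y0] by blast
    have r: "r > 0" and c: "pseries2 c r (\<lambda>u v. f u (y0 + v))"
      and ax: "\<And>v. \<bar>v\<bar> < r \<Longrightarrow> f 0 (y0 + v) = y0 + v" "\<And>v. \<bar>v\<bar> < r \<Longrightarrow> D1 f 0 (y0 + v) = 0"
      using chart unfolding axis_chart_def by blast+
    note d1 = pseries2_deriv1(1)[OF c, unfolded D1_axis_translate[of f]]
    note d11 = pseries2_deriv1(1)[OF d1, unfolded D1_axis_translate[of "D1 f"]]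
    note d112 = pseries2_deriv2(1)[OF d11, unfolded D2_axis_translate[of "D1 (D1 f)"]]
    have c0: "c 0 1 = 1" "c 0 2 = 0"
      using pseries2_affine_axis[OF c r, of y0 1] ax(1) by auto
    have c1: "c 1 0 = 0" "c 1 1 = 0" "c 1 2 = 0"
      using pseries2_affine_axis(1-3)[OF d1 r, of 0 0] ax(2) by (auto simp: dcoeff1_def)
    have "2 * c 2 0 * c 2 1 + \<epsilon> * c 2 2 = 0"
      by (rule pde_coefficient_relation[OF c r c0 c1])
        (use pde in \<open>simp add: D1_axis_translate[of f] D2_axis_translate[of f]
            D1_axis_translate[of "D1 f"] D2_axis_translate[of "D1 f"] D2_axis_translate[of "D2 f"]\<close>)
    then have rel: "\<epsilon> * (2 * c 2 0 * c 2 1) + \<epsilon>\<^sup>2 * c 2 2 = 0" by algebra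
    have A0: "A y0 = 2 * c 2 0"
      using pseries2_at_0[OF d11 r] by (simp add: A_def dcoeff1_def numeral_2_eq_2)
    have A1: "A' y0 = 2 * c 2 1"
      using pseries2_at_0[OF d112 r] by (simp add: A'_def dcoeff1_def dcoeff2_def numeral_2_eq_2)
    have A2: "D2 (D2 (D1 (D1 f))) 0 y0 = 4 * c 2 2"
      using pseries2_at_0[OF pseries2_deriv2(1)[OF d112] r]
      by (simp add: dcoeff1_def dcoeff2_def numeral_2_eq_2 D2_axis_translate[of "D2 (D1 (D1 f))"])
    have "((\<lambda>v. D1 (D1 f) 0 (y0 + v)) has_real_derivative D2 (\<lambda>u v. D1 (D1 f) u (y0 + v)) 0 0) (at 0)"
      using r by (intro pseries2_deriv2(2)[OF d11]) auto
    then show "(A has_real_derivative A' y0) (at y0)"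
      unfolding A_def A'_def D2_axis_translate[of "D1 (D1 f)"]
      using DERIV_shift[of "D1 (D1 f) 0" _ 0 y0] by (simp add: add.commute)
    have "((\<lambda>v. D2 (D1 (D1 f)) 0 (y0 + v)) has_real_derivative D2 (\<lambda>u v. D2 (D1 (D1 f)) u (y0 + v)) 0 0) (at 0)"
      using r by (intro pseries2_deriv2(2)[OF d112]) auto
    then have "(A' has_real_derivative 4 * c 2 2) (at y0)"
      unfolding A'_def D2_axis_translate[of "D2 (D1 (D1 f))"]
      using DERIV_shift[of "D2 (D1 (D1 f)) 0" _ 0 y0] A2 by (simp add: add.commute)
    moreover have "4 * c 2 2 = - 2 * \<epsilon> * A y0 * A' y0"
      using rel eps by (simp add: A0 A1 algebra_simps)
    ultimately show "(A' has_real_derivative - 2 * \<epsilon> * A y0 * A' y0) (at y0)" by simp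
  qed
  have "\<exists>k. \<forall>y\<in>{a..b}. A' y + \<epsilon> * (A y)\<^sup>2 = k"
  proof (rule has_field_derivative_zero_constant)
    fix y assume y: "y \<in> {a..b}"
    have "((\<lambda>y. A' y + \<epsilon> * (A y)\<^sup>2) has_real_derivative 0) (at y)"
      using der[OF y] der2[OF y] by (auto intro!: derivative_eq_intros)
    then show "((\<lambda>y. A' y + \<epsilon> * (A y)\<^sup>2) has_real_derivative 0) (at y within {a..b})"
      by (rule has_field_derivative_at_within)
  qed simp
  then have const: "A' y + \<epsilon> * (A y)\<^sup>2 = A' 0 + \<epsilon> * (A 0)\<^sup>2" if "y \<in> {a..b}" for y
    using that z by metis
  show ?thesis
    unfolding riccati_on_def
  proof
    fix y assume y: "y \<in> {a..b}"
    have "((\<lambda>y. \<epsilon> * A y) has_real_derivative \<epsilon> * A' y) (at y within {a..b})"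
      by (rule has_field_derivative_at_within[OF DERIV_cmult[OF der[OF y]]])
    moreover have "\<epsilon> * A' y = - (- (\<epsilon> * A' 0) - (A 0)\<^sup>2) - (\<epsilon> * A y)\<^sup>2"
      using const[OF y] eps by algebra
    ultimately show "((\<lambda>y. \<epsilon> * D1 (D1 f) 0 y) has_real_derivative
        - (- (\<epsilon> * D2 (D1 (D1 f)) 0 0) - (D1 (D1 f) 0 0)\<^sup>2) - (\<epsilon> * D1 (D1 f) 0 y)\<^sup>2) (at y within {a..b})"
      by (simp add: A_def A'_def)
  qed
qed

section \<open>Graphs over the (x, y)-plane\<close>

text \<open>
  For a vector \<open>w\<close> in the parameter plane the induced metric pairs \<open>w\<close> with \<open>z\<close> to
  \<open>w \<bullet> z - (\<nabla>g \<bullet> w) (\<nabla>g \<bullet> z)\<close>. A null vector is therefore a multiple of the gradient, and the gradient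
  has length 1.
\<close>
lemma lightlike_at_graph_t_iff:
  assumes "((\<lambda>s. g s y) has_real_derivative a) (at x)" "((\<lambda>s. g x s) has_real_derivative b) (at y)"
  shows "lightlike_at (graph_t g) x y \<longleftrightarrow> a\<^sup>2 + b\<^sup>2 = 1"
proof -
  have "((\<lambda>s. graph_t g s y) has_vector_derivative (a, 1, 0)) (at x)"
    "((\<lambda>s. graph_t g x s) has_vector_derivative (b, 0, 1)) (at y)"
    unfolding graph_t_def using assms
    by (auto intro!: derivative_eq_intros simp: has_real_derivative_iff_has_vector_derivative)
  then have tm: "tangent_map (graph_t g) x y w = (fst w * a + snd w * b, fst w, snd w)" for w
    by (simp add: tangent_map_def vector_derivative_at)
  have im: "induced_metric (graph_t g) x y (w1, w2) (z1, z2) =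
      - (w1 * a + w2 * b) * (z1 * a + z2 * b) + w1 * z1 + w2 * z2" for w1 w2 z1 z2
    by (simp add: induced_metric_def tm)
  show ?thesis
  proof
    assume "lightlike_at (graph_t g) x y"
    then obtain w1 w2 where w: "(w1, w2) \<noteq> 0" and
      deg: "\<And>z1 z2. - (w1 * a + w2 * b) * (z1 * a + z2 * b) + w1 * z1 + w2 * z2 = 0"
      unfolding lightlike_at_def using im by (metis surj_pair)
    have e: "w1 = (w1 * a + w2 * b) * a" "w2 = (w1 * a + w2 * b) * b"
      using deg[of 1 0] deg[of 0 1] by (simp_all add: algebra_simps)
    have "(w1 * a + w2 * b) * (a\<^sup>2 + b\<^sup>2 - 1) = 0" using e by algebra
    moreover have "w1 * a + w2 * b \<noteq> 0"
    proof
      assume "w1 * a + w2 * b = 0"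
      then have "w1 = 0" "w2 = 0" using e by (metis mult_zero_left)+
      then show False using w by (simp add: zero_prod_def)
    qed
    ultimately show "a\<^sup>2 + b\<^sup>2 = 1" by simp
  next
    assume ab: "a\<^sup>2 + b\<^sup>2 = 1"
    have "induced_metric (graph_t g) x y (a, b) z = 0" for z
    proof (cases z)
      case (Pair z1 z2)
      have "- (a * a + b * b) * (z1 * a + z2 * b) + a * z1 + b * z2 = 0" using ab by algebra
      then show ?thesis by (simp add: Pair im)
    qed
    moreover have "(a, b) \<noteq> 0" using ab by (auto simp: zero_prod_def)
    ultimately show "lightlike_at (graph_t g) x y" unfolding lightlike_at_def by blast
  qed
qed

text \<open>
  The terms of order 0 and 1 in \<open>u\<close> are \<open>y0 + v\<close> and 0 by assumption.
\<close>
lemma axis_chart_quadratic: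
  assumes "axis_chart f y0 c r"
  obtains E where "pseries2 (\<lambda>m. c (Suc (Suc m))) r E"
    "\<And>u v. \<bar>u\<bar> < r \<Longrightarrow> \<bar>v\<bar> < r \<Longrightarrow> f u (y0 + v) = y0 + v + u\<^sup>2 * E u v"
    "\<And>v. \<bar>v\<bar> < r \<Longrightarrow> E 0 v = D1 (D1 f) 0 (y0 + v) / 2"
proof -
  have c: "pseries2 c r (\<lambda>u v. f u (y0 + v))"
    and ax: "\<And>v. \<bar>v\<bar> < r \<Longrightarrow> f 0 (y0 + v) = y0 + v" "\<And>v. \<bar>v\<bar> < r \<Longrightarrow> D1 f 0 (y0 + v) = 0"
    using assms unfolding axis_chart_def by blast+
  note d1 = pseries2_deriv1(1)[OF c, unfolded D1_axis_translate[of f]]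
  note d11 = pseries2_deriv1(1)[OF d1, unfolded D1_axis_translate[of "D1 f"]]
  obtain f1 where f1: "pseries2 (\<lambda>m. c (Suc m)) r f1"
    "\<And>u v. \<bar>u\<bar> < r \<Longrightarrow> \<bar>v\<bar> < r \<Longrightarrow> f u (y0 + v) = f 0 (y0 + v) + u * f1 u v"
    using pseries2_shift[OF c] by metis
  obtain f2 where f2: "pseries2 (\<lambda>m. c (Suc (Suc m))) r f2"
    "\<And>u v. \<bar>u\<bar> < r \<Longrightarrow> \<bar>v\<bar> < r \<Longrightarrow> f1 u v = f1 0 v + u * f2 u v"
    using pseries2_shift[OF f1(1)] by metis
  have v1: "f1 0 v = 0" if "\<bar>v\<bar> < r" for v
  proof -
    have "((\<lambda>n. c (Suc 0) n * v ^ n) has_sum f1 0 v) UNIV"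
      using pseries2_section0[OF f1(1), of v] that by simp
    moreover have "((\<lambda>n. c (Suc 0) n * v ^ n) has_sum D1 f 0 (y0 + v)) UNIV"
      using pseries2_section0[OF d1, of v] that by (simp add: dcoeff1_def)
    ultimately show ?thesis using ax(2)[OF that] has_sum_unique by metis
  qed
  have v2: "2 * f2 0 v = D1 (D1 f) 0 (y0 + v)" if "\<bar>v\<bar> < r" for v
  proof -
    have "((\<lambda>n. 2 * (c (Suc (Suc 0)) n * v ^ n)) has_sum 2 * f2 0 v) UNIV"
      using pseries2_section0[OF f2(1), of v] that by (intro has_sum_cmult_right) simp
    moreover have "((\<lambda>n. 2 * (c (Suc (Suc 0)) n * v ^ n)) has_sum D1 (D1 f) 0 (y0 + v)) UNIV"
      using pseries2_section0[OF d11, of v] that by (simp add: dcoeff1_def mult.assoc)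
    ultimately show ?thesis by (rule has_sum_unique)
  qed
  have "f u (y0 + v) = y0 + v + u\<^sup>2 * f2 u v" if uv: "\<bar>u\<bar> < r" "\<bar>v\<bar> < r" for u v
    using f1(2)[OF uv] f2(2)[OF uv] ax(1)[OF uv(2)] v1[OF uv(2)] by (simp add: power2_eq_square)
  moreover have "f2 0 v = D1 (D1 f) 0 (y0 + v) / 2" if "\<bar>v\<bar> < r" for v
    using v2[OF that] by simp
  ultimately show ?thesis using that f2(1) by blast
qed

lemma axis_chart_expansion:
  assumes chart: "axis_chart f y0 c r"
  obtains f3 where "pseries2 (\<lambda>m. c (Suc (Suc (Suc m)))) r f3"
    "\<And>u v. \<bar>u\<bar> < r \<Longrightarrow> \<bar>v\<bar> < r \<Longrightarrow>
       f u (y0 + v) = y0 + v + D1 (D1 f) 0 (y0 + v) / 2 * u\<^sup>2 + f3 u v * u ^ 3"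
    "\<And>v. \<bar>v\<bar> < r \<Longrightarrow> f3 0 v = D1 (D1 (D1 f)) 0 (y0 + v) / 6"
proof -
  have c: "pseries2 c r (\<lambda>u v. f u (y0 + v))"
    using chart unfolding axis_chart_def by blast
  note d1 = pseries2_deriv1(1)[OF c, unfolded D1_axis_translate[of f]]
  note d11 = pseries2_deriv1(1)[OF d1, unfolded D1_axis_translate[of "D1 f"]]
  note d111 = pseries2_deriv1(1)[OF d11, unfolded D1_axis_translate[of "D1 (D1 f)"]]
  obtain E where E: "pseries2 (\<lambda>m. c (Suc (Suc m))) r E"
    "\<And>u v. \<bar>u\<bar> < r \<Longrightarrow> \<bar>v\<bar> < r \<Longrightarrow> f u (y0 + v) = y0 + v + u\<^sup>2 * E u v"
    "\<And>v. \<bar>v\<bar> < r \<Longrightarrow> E 0 v = D1 (D1 f) 0 (y0 + v) / 2"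
    using axis_chart_quadratic[OF chart] by metis
  obtain f3 where f3: "pseries2 (\<lambda>m. c (Suc (Suc (Suc m)))) r f3"
    "\<And>u v. \<bar>u\<bar> < r \<Longrightarrow> \<bar>v\<bar> < r \<Longrightarrow> E u v = E 0 v + u * f3 u v"
    using pseries2_shift[OF E(1)] by metis
  have v3: "6 * f3 0 v = D1 (D1 (D1 f)) 0 (y0 + v)" if "\<bar>v\<bar> < r" for v
  proof -
    have "((\<lambda>n. 6 * (c (Suc (Suc (Suc 0))) n * v ^ n)) has_sum 6 * f3 0 v) UNIV"
      using pseries2_section0[OF f3(1), of v] that by (intro has_sum_cmult_right) simp
    moreover have "((\<lambda>n. 6 * (c (Suc (Suc (Suc 0))) n * v ^ n)) has_sum D1 (D1 (D1 f)) 0 (y0 + v)) UNIV"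
      using pseries2_section0[OF d111, of v] that by (simp add: dcoeff1_def mult.assoc)
    ultimately show ?thesis by (rule has_sum_unique)
  qed
  have "f u (y0 + v) = y0 + v + D1 (D1 f) 0 (y0 + v) / 2 * u\<^sup>2 + f3 u v * u ^ 3"
    if uv: "\<bar>u\<bar> < r" "\<bar>v\<bar> < r" for u v
    unfolding E(2)[OF uv] f3(2)[OF uv] E(3)[OF uv(2)]
    by (simp add: power2_eq_square power3_eq_cube algebra_simps)
  moreover have "f3 0 v = D1 (D1 (D1 f)) 0 (y0 + v) / 6" if "\<bar>v\<bar> < r" for v
    using v3[OF that] by simp
  ultimately show ?thesis using that f3(1) by blast
qed

text \<open>
  Local expansions at the points of the segment are glued to one function \<open>\<beta>\<close>, which is possible
  because \<open>\<beta>\<close> is determined by the surface.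
\<close>
lemma approximation_function_graph_t:
  assumes charts: "\<And>y0. y0 \<in> J \<Longrightarrow> \<exists>c r. axis_chart G y0 c r \<and> {-r<..<r} \<times> {y0 - r<..<y0 + r} \<subseteq> \<Omega>"
  shows "approximation_function (surface (graph_t G) \<Omega>) (null_ray ` J) (D1 (D1 G) 0)"
proof -
  obtain c r where chart: "\<And>y0. y0 \<in> J \<Longrightarrow> axis_chart G y0 (c y0) (r y0)"
    and sub: "\<And>y0. y0 \<in> J \<Longrightarrow> {-r y0<..<r y0} \<times> {y0 - r y0<..<y0 + r y0} \<subseteq> \<Omega>"
    using charts by metis
  have rpos: "r y0 > 0" if "y0 \<in> J" for y0 using chart[OF that] by (simp add: axis_chart_def)
  define \<alpha> where "\<alpha> = D1 (D1 G) 0"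
  \<comment> \<open>the value at \<open>x = 0\<close> is the limit of the quotient\<close>
  define \<beta> where "\<beta> = (\<lambda>x y. if x = 0 then D1 (D1 (D1 G)) 0 y / 6 else (G x y - y - \<alpha> y / 2 * x\<^sup>2) / x ^ 3)"
  define V where "V = (\<Union>y0\<in>J. {-r y0<..<r y0} \<times> {y0 - r y0<..<y0 + r y0})"
  define I where "I = (\<Union>y0\<in>J. {y0 - r y0<..<y0 + r y0})"
  define W where "W = (UNIV :: real set) \<times> V"
  have V\<Omega>: "V \<subseteq> \<Omega>" using sub by (auto simp: V_def)
  have opV: "open V" unfolding V_def by (intro open_UN ballI open_Times open_greaterThanLessThan)
  have G_eq: "G x y = y + \<alpha> y / 2 * x\<^sup>2 + \<beta> x y * x ^ 3" if xy: "(x, y) \<in> V" for x y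
  proof (cases "x = 0")
    case True
    obtain y0 where y0: "y0 \<in> J" "y \<in> {y0 - r y0<..<y0 + r y0}"
      using xy by (auto simp: V_def)
    then have "\<bar>y - y0\<bar> < r y0" by (auto simp: abs_less_iff)
    then have "G 0 (y0 + (y - y0)) = y0 + (y - y0)"
      using chart[OF y0(1)] unfolding axis_chart_def by blast
    then show ?thesis by (simp add: True)
  next
    case False
    then show ?thesis by (simp add: \<beta>_def)
  qed
  have an\<alpha>: "real_analytic_on \<alpha> I"
    unfolding real_analytic_on_iff
  proof
    fix y assume "y \<in> I"
    then obtain y0 where y0: "y0 \<in> J" "y \<in> {y0 - r y0<..<y0 + r y0}"
      by (auto simp: I_def)
    have c: "pseries2 (c y0) (r y0) (\<lambda>u v. G u (y0 + v))"
      using chart[OF y0(1)] by (simp add: axis_chart_def)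
    note d1 = pseries2_deriv1(1)[OF c, unfolded D1_axis_translate[of G]]
    note d11 = pseries2_deriv1(1)[OF d1, unfolded D1_axis_translate[of "D1 G"]]
    have "\<bar>y - y0\<bar> < r y0" using y0(2) by (auto simp: abs_less_iff)
    then obtain a s where "s > 0" "\<And>w. \<bar>w\<bar> < s \<Longrightarrow> (\<lambda>n. a n * w ^ n) sums D1 (D1 G) 0 (y0 + (y - y0 + w))"
      using pseries2_axis_analytic[OF d11] by metis
    then show "\<exists>a s. s > 0 \<and> (\<forall>v. \<bar>v\<bar> < s \<longrightarrow> (\<lambda>n. a n * v ^ n) sums \<alpha> (y + v))"
      by (intro exI[of _ a] exI[of _ s]) (simp add: \<alpha>_def)
  qed
  have an\<beta>: "real_analytic2_on \<beta> V"
    unfolding real_analytic2_on_iff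
  proof (intro allI impI)
    fix x y assume "(x, y) \<in> V"
    then obtain y0 where y0: "y0 \<in> J" "\<bar>x\<bar> < r y0" "\<bar>y - y0\<bar> < r y0"
      by (auto simp: V_def abs_less_iff)
    obtain f3 where f3: "pseries2 (\<lambda>m. c y0 (Suc (Suc (Suc m)))) (r y0) f3"
      and exp: "\<And>u v. \<bar>u\<bar> < r y0 \<Longrightarrow> \<bar>v\<bar> < r y0 \<Longrightarrow>
         G u (y0 + v) = y0 + v + D1 (D1 G) 0 (y0 + v) / 2 * u\<^sup>2 + f3 u v * u ^ 3"
      and ax: "\<And>v. \<bar>v\<bar> < r y0 \<Longrightarrow> f3 0 v = D1 (D1 (D1 G)) 0 (y0 + v) / 6"
      using axis_chart_expansion[OF chart[OF y0(1)]] by metis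
    have \<beta>_eq: "\<beta> u (y0 + v) = f3 u v" if "\<bar>u\<bar> < r y0" "\<bar>v\<bar> < r y0" for u v
      using exp[OF that] ax[OF that(2)] by (simp add: \<beta>_def \<alpha>_def)
    obtain c' s where s: "s > 0" and c': "pseries2 c' s (\<lambda>u w. f3 (x + u) (y - y0 + w))"
      using pseries2_recenter[OF f3 y0(2,3)] by metis
    define s' where "s' = min s (min (r y0 - \<bar>x\<bar>) (r y0 - \<bar>y - y0\<bar>))"
    have s': "s' > 0" "s' \<le> s" "s' \<le> r y0 - \<bar>x\<bar>" "s' \<le> r y0 - \<bar>y - y0\<bar>"
      using s y0 by (auto simp: s'_def)
    have "pseries2 c' s' (\<lambda>u w. \<beta> (x + u) (y + w))"
    proof (rule pseries2_cong[OF pseries2_mono[OF c' s'(2)]])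
      fix u w :: real assume uw: "norm u < s'" "norm w < s'"
      have "\<bar>x + u\<bar> < r y0" "\<bar>y - y0 + w\<bar> < r y0"
        using uw s' unfolding real_norm_def by linarith+
      from \<beta>_eq[OF this] show "f3 (x + u) (y - y0 + w) = \<beta> (x + u) (y + w)" by simp
    qed
    with s'(1) show "\<exists>c r. 0 < r \<and> pseries2 c r (\<lambda>u v. \<beta> (x + u) (y + v))" by blast
  qed
  have SW: "surface (graph_t G) \<Omega> \<inter> W = surface (graph_t (\<lambda>x y. y + \<alpha> y / 2 * x\<^sup>2 + \<beta> x y * x ^ 3)) V"
  proof -
    have "surface (graph_t G) \<Omega> \<inter> W = surface (graph_t G) V"
      using V\<Omega> by (auto simp: surface_def graph_t_def W_def image_iff)
    also have "\<dots> = surface (graph_t (\<lambda>x y. y + \<alpha> y / 2 * x\<^sup>2 + \<beta> x y * x ^ 3)) V"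
      unfolding surface_def by (rule image_cong[OF refl]) (auto simp: graph_t_def G_eq)
    finally show ?thesis .
  qed
  have axis: "(0, y) \<in> V" "G 0 y = y" if "y \<in> J" for y
  proof -
    show "(0, y) \<in> V" using that rpos[OF that] by (force simp: V_def)
    then show "G 0 y = y" using G_eq[of 0 y] by simp
  qed
  have LS: "null_ray ` J \<subseteq> surface (graph_t G) \<Omega>"
  proof
    fix p assume "p \<in> null_ray ` J"
    then obtain y where y: "y \<in> J" "p = null_ray y" by blast
    then have "p = (case (0, y) of (u, v) \<Rightarrow> graph_t G u v)" "(0, y) \<in> \<Omega>"
      using axis[OF y(1)] V\<Omega> by (auto simp: null_ray_def graph_t_def)
    then show "p \<in> surface (graph_t G) \<Omega>" unfolding surface_def by (rule image_eqI)
  qed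
  show ?thesis
    unfolding approximation_function_def \<alpha>_def[symmetric]
  proof (intro conjI exI)
    show "null_ray ` J \<subseteq> {(y, 0, y) | y. True}" by (auto simp: null_ray_def)
    show "open W" unfolding W_def using opV by (intro open_Times) auto
    show "null_ray ` J \<subseteq> W" using axis(1) by (auto simp: W_def null_ray_def)
    show "V \<subseteq> UNIV \<times> I" by (auto simp: V_def I_def)
    show "open I" unfolding I_def by (intro open_UN ballI open_greaterThanLessThan)
  qed (fact LS opV an\<alpha> an\<beta> SW)+
qed

text \<open>
  On the segment \<open>g = y\<close> gives \<open>g_y = 1\<close>, and lightlikeness then gives \<open>g_x = 0\<close>. The approximation
  function lives on an open neighbourhood of the segment, so both identities have to be continued
  analytically beyond its endpoints.
\<close>
lemma axis_charts_of_lightlike_segment: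
  assumes \<Omega>: "open \<Omega>" and an: "real_analytic2_on G \<Omega>" and ab: "a < b" and y0: "y0 \<in> {a..b}"
    and seg: "lightlike_segment (graph_t G) \<Omega> (null_ray ` {a..b})"
  shows "\<exists>c r. axis_chart G y0 c r \<and> {-r<..<r} \<times> {y0 - r<..<y0 + r} \<subseteq> \<Omega>"
proof -
  have on: "(0, y) \<in> \<Omega> \<and> G 0 y = y" if "y \<in> {a..b}" for y
  proof -
    have "null_ray y \<in> surface (graph_t G) \<Omega>"
      using seg that unfolding lightlike_segment_def by blast
    then show ?thesis by (auto simp: surface_def graph_t_def null_ray_def)
  qed
  have light: "lightlike_at (graph_t G) 0 y" if "y \<in> {a..b}" for y
  proof -
    have "graph_t G 0 y = null_ray y" using on[OF that] by (simp add: graph_t_def null_ray_def)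
    then have "graph_t G 0 y \<in> null_ray ` {a..b}" using that by simp
    then show ?thesis using seg on[OF that] unfolding lightlike_segment_def by blast
  qed
  obtain c r1 where r1: "r1 > 0" and c1: "pseries2 c r1 (\<lambda>u v. G (0 + u) (y0 + v))"
    using an on[OF y0] unfolding real_analytic2_on_iff by blast
  obtain r2 where r2: "r2 > 0" "ball (0, y0) r2 \<subseteq> \<Omega>"
    using \<Omega> on[OF y0] open_contains_ball by blast
  define r where "r = min r1 (r2 / 2)"
  have r: "r > 0" "r \<le> r1" "r \<le> r2 / 2" using r1 r2 by (auto simp: r_def)
  have c: "pseries2 c r (\<lambda>u v. G u (y0 + v))" using pseries2_mono[OF c1 r(2)] by simp
  have box: "{-r<..<r} \<times> {y0 - r<..<y0 + r} \<subseteq> \<Omega>"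
  proof
    fix p assume "p \<in> {-r<..<r} \<times> {y0 - r<..<y0 + r}"
    then obtain x y where p: "p = (x, y)" "\<bar>x\<bar> < r" "\<bar>y0 - y\<bar> < r" by (auto simp: abs_less_iff)
    have "dist (0, y0) p \<le> \<bar>0 - x\<bar> + \<bar>y0 - y\<bar>"
      unfolding p(1) dist_Pair_Pair dist_real_def power2_abs by (rule sqrt_sum_squares_le_sum_abs)
    also have "\<dots> < r2" using p(2,3) r(3) by simp
    finally show "p \<in> \<Omega>" using r2(2) by auto
  qed
  \<comment> \<open>the segment contains the points from \<open>y0\<close> to \<open>y0 + e\<close>, also if \<open>y0\<close> is an endpoint\<close>
  define e where "e = (if y0 < b then b - y0 else a - y0)"
  have e: "e \<noteq> 0" using ab y0 by (auto simp: e_def)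
  have e_in: "y0 + \<theta> * e \<in> {a..b}" if "0 \<le> \<theta>" "\<theta> \<le> 1" for \<theta>
  proof -
    have "y0 + \<theta> * e = (1 - \<theta>) * y0 + \<theta> * (if y0 < b then b else a)"
      by (simp add: e_def algebra_simps)
    moreover have "convex {a..b}" by simp
    ultimately show ?thesis
      using convexD_alt[of "{a..b}" y0 "if y0 < b then b else a" \<theta>] y0 ab that by simp
  qed
  have ax: "G 0 (y0 + v) = y0 + v" if "\<bar>v\<bar> < r" for v
    using pseries2_axis_continuation[OF c e, of y0 1 v] on e_in that by simp
  note d1 = pseries2_deriv1(1)[OF c, unfolded D1_axis_translate[of G]]
  have D2_1: "D2 G 0 (y0 + v) = 1" if "\<bar>v\<bar> < r" for v
    using pseries2_affine_axis(4)[OF c r(1), of y0 1 v] ax that by (simp add: D2_axis_translate[of G])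
  have D1_0: "D1 G 0 y = 0" if y: "y \<in> {a..b}" "\<bar>y - y0\<bar> < r" for y
  proof -
    have "((\<lambda>s. G s (y0 + (y - y0))) has_real_derivative D1 (\<lambda>u v. G u (y0 + v)) 0 (y - y0)) (at 0)"
      using y r by (intro pseries2_deriv1(2)[OF c]) auto
    then have 1: "((\<lambda>s. G s y) has_real_derivative D1 G 0 y) (at 0)"
      by (simp add: D1_axis_translate[of G])
    have "((\<lambda>s. G 0 (y0 + s)) has_real_derivative D2 G 0 y) (at (y - y0))"
      using pseries2_deriv2(2)[OF c, of 0 "y - y0"] y r by (simp add: D2_axis_translate[of G])
    then have 2: "((\<lambda>s. G 0 s) has_real_derivative D2 G 0 y) (at y)"
      using DERIV_shift[of "G 0" _ "y - y0" y0] by (simp add: add.commute)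
    have "(D1 G 0 y)\<^sup>2 + (D2 G 0 y)\<^sup>2 = 1"
      using lightlike_at_graph_t_iff[where g = G, OF 1 2] light[OF y(1)] by simp
    then show ?thesis using D2_1[OF y(2)] by simp
  qed
  have ax1: "D1 G 0 (y0 + v) = 0" if "\<bar>v\<bar> < r" for v
  proof -
    have "D1 G 0 (y0 + v) = 0 + 0 * v"
      by (rule pseries2_axis_continuation[OF d1 e _ that]) (use D1_0 e_in in simp)
    then show ?thesis by simp
  qed
  have "axis_chart G y0 c r" using r(1) c ax ax1 by (simp add: axis_chart_def)
  with box show ?thesis by blast
qed

theorem class_along_graph_t:
  assumes \<Omega>: "open \<Omega>" and an: "real_analytic2_on G \<Omega>" and zmc: "zero_mean_curvature_on G \<Omega>"
    and ab: "a \<le> 0" "0 \<le> b" "a < b"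
    and seg: "lightlike_segment (graph_t G) \<Omega> (null_ray ` {a..b})"
  shows "class_along (surface (graph_t G) \<Omega>) (null_ray ` {a..b}) C \<longleftrightarrow>
    class_cond C (D1 (D1 G) 0 0) (- D2 (D1 (D1 G)) 0 0 - (D1 (D1 G) 0 0)\<^sup>2)"
proof -
  note charts = axis_charts_of_lightlike_segment[OF \<Omega> an ab(3) _ seg]
  have "riccati_on (\<lambda>y. 1 * D1 (D1 G) 0 y) (- (1 * D2 (D1 (D1 G)) 0 0) - (D1 (D1 G) 0 0)\<^sup>2) {a..b}"
  proof (rule riccati_of_pde)
    fix y0 assume "y0 \<in> {a..b}"
    then obtain c r where cr: "axis_chart G y0 c r" "{-r<..<r} \<times> {y0 - r<..<y0 + r} \<subseteq> \<Omega>"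
      using charts by blast
    have "(1 - (D2 G x y0)\<^sup>2) * D1 (D1 G) x y0 + 2 * D1 G x y0 * D2 G x y0 * D2 (D1 G) x y0
        + (1 - (D1 G x y0)\<^sup>2) * D2 (D2 G) x y0 = 0" if "\<bar>x\<bar> < r" for x
    proof -
      have "(x, y0) \<in> \<Omega>" using cr(2) that by (auto simp: abs_less_iff)
      then show ?thesis using zmc unfolding zero_mean_curvature_on_def by blast
    qed
    with cr(1) show "\<exists>c r. axis_chart G y0 c r \<and>
        (\<forall>x. \<bar>x\<bar> < r \<longrightarrow> (1 - (D2 G x y0)\<^sup>2) * D1 (D1 G) x y0
        + 2 * D1 G x y0 * D2 G x y0 * D2 (D1 G) x y0 + (1 - (D1 G x y0)\<^sup>2) * D2 (D2 G) x y0 = 0)"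
      by blast
  qed (use ab in auto)
  then have ric: "riccati_on (D1 (D1 G) 0) (- D2 (D1 (D1 G)) 0 0 - (D1 (D1 G) 0 0)\<^sup>2) {a..b}"
    by simp
  show ?thesis
    using refl ab approximation_function_graph_t[OF charts] ric by (rule class_along_iff_class_cond)
qed

section \<open>An analytic implicit function\<close>

text \<open>
  Picard iteration for \<open>t = y - x^2 F(x, t)\<close>. The factor \<open>x^2\<close> makes it a contraction near the origin.
  All iterates are holomorphic in \<open>x\<close> and in \<open>y\<close>, and so is their uniform limit.
\<close>
lemma analytic_fixed_point:
  fixes F :: "complex \<Rightarrow> complex \<Rightarrow> complex"
  assumes F: "pseries2 c r F" and r: "r > 0"
  obtains \<rho> s T where "0 < \<rho>" "\<rho> \<le> s" "0 < s" "s < r"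
    "\<And>y. norm y < \<rho> \<Longrightarrow> (\<lambda>x. T x y) holomorphic_on ball 0 \<rho>"
    "\<And>x. norm x < \<rho> \<Longrightarrow> (\<lambda>y. T x y) holomorphic_on ball 0 \<rho>"
    "\<And>x y. norm x < \<rho> \<Longrightarrow> norm y < \<rho> \<Longrightarrow> norm (T x y) < s"
    "\<And>x y. norm x < \<rho> \<Longrightarrow> norm y < \<rho> \<Longrightarrow> T x y = y - x\<^sup>2 * F x (T x y)"
    "\<And>x y t. norm x < \<rho> \<Longrightarrow> norm y < \<rho> \<Longrightarrow> norm t < s \<Longrightarrow> t = y - x\<^sup>2 * F x t \<Longrightarrow> t = T x y"
proof -
  define s where "s = r / 2"
  have s: "0 < s" "s < r" "0 \<le> s" using r by (auto simp: s_def)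
  obtain M where M: "M \<ge> 0" "\<And>z w. norm z \<le> s \<Longrightarrow> norm w \<le> s \<Longrightarrow> norm (F z w) \<le> M"
    using pseries2_bounded[OF F s(3,2)] by metis
  obtain N where N: "N \<ge> 0" "\<And>z w w'. norm z \<le> s \<Longrightarrow> norm w \<le> s \<Longrightarrow> norm w' \<le> s \<Longrightarrow>
      norm (F z w - F z w') \<le> N * norm (w - w')"
    using pseries2_lipschitz2[OF F s(3,2)] by metis
  \<comment> \<open>for \<open>norm x < \<rho>\<close> the map \<open>x\<^sup>2 F\<close> is bounded by \<open>s / 2\<close> and contracts by the factor \<open>1 / 2\<close>\<close>
  define \<rho> where "\<rho> = min (s / 2) (min 1 (min (s / (2 * (M + 1))) (1 / (2 * (N + 1)))))"
  have \<rho>_le: "\<rho> \<le> s / 2" "\<rho> \<le> 1" "\<rho> \<le> s / (2 * (M + 1))" "\<rho> \<le> 1 / (2 * (N + 1))"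
    unfolding \<rho>_def by (rule min.cobounded1 min.coboundedI2[OF min.cobounded1]
        min.coboundedI2[OF min.coboundedI2[OF min.cobounded1]]
        min.coboundedI2[OF min.coboundedI2[OF min.cobounded2]])+
  have half: "a / (2 * k) * k = a / 2" "1 / (2 * k) * (k * a) = a / 2" if "k > 0" for a k :: real
    using that by simp_all
  have \<rho>: "0 < \<rho>" using s M(1) N(1) by (auto simp: \<rho>_def)
  have x2: "norm (x\<^sup>2) \<le> \<rho>" if "norm x < \<rho>" for x :: complex
  proof -
    have "norm x * norm x \<le> \<rho> * 1" using that \<rho>_le(2) \<rho> by (intro mult_mono) auto
    then show ?thesis by (simp add: norm_mult power2_eq_square)
  qed
  have small: "norm (x\<^sup>2 * F x t) \<le> s / 2" if "norm x < \<rho>" "norm t \<le> s" for x t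
  proof -
    have "norm (x\<^sup>2 * F x t) \<le> \<rho> * M"
      unfolding norm_mult using that \<rho>_le \<rho> s by (intro mult_mono x2 M(2)) auto
    also have "\<dots> \<le> s / (2 * (M + 1)) * (M + 1)"
      using \<rho>_le(3) M(1) \<rho> by (intro mult_mono) auto
    also have "\<dots> = s / 2" using M(1) by (intro half) simp
    finally show ?thesis .
  qed
  have contr: "norm (x\<^sup>2 * F x t - x\<^sup>2 * F x t') \<le> norm (t - t') / 2"
    if "norm x < \<rho>" "norm t \<le> s" "norm t' \<le> s" for x t t'
  proof -
    have "norm (x\<^sup>2 * F x t - x\<^sup>2 * F x t') = norm (x\<^sup>2) * norm (F x t - F x t')"
      by (simp add: right_diff_distrib[symmetric] norm_mult)
    also have "\<dots> \<le> \<rho> * (N * norm (t - t'))"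
      using that \<rho>_le \<rho> s by (intro mult_mono x2 N(2)) auto
    also have "\<dots> \<le> 1 / (2 * (N + 1)) * ((N + 1) * norm (t - t'))"
      using \<rho>_le(4) N(1) \<rho> by (intro mult_mono mult_right_mono) auto
    also have "\<dots> = norm (t - t') / 2" using N(1) by (intro half) simp
    finally show ?thesis .
  qed
  define T where "T = rec_nat (\<lambda>x y. y) (\<lambda>_ T x y. y - x\<^sup>2 * F x (T x y :: complex))"
  have T0: "T 0 x y = y" and TS: "T (Suc n) x y = y - x\<^sup>2 * F x (T n x y)" for n x y
    by (simp_all add: T_def)
  have Tb: "norm (T n x y) \<le> s" if "norm x < \<rho>" "norm y < \<rho>" for n x y
  proof (induction n)
    case 0
    then show ?case using that \<rho>_le s by (simp add: T0)
  next
    case (Suc n)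
    have "norm (T (Suc n) x y) \<le> norm y + norm (x\<^sup>2 * F x (T n x y))"
      unfolding TS by (rule norm_triangle_ineq4)
    also have "\<dots> \<le> s / 2 + s / 2"
      using small[OF that(1) Suc] that \<rho>_le by (intro add_mono) auto
    finally show ?case by simp
  qed
  have step: "norm (T (Suc n) x y - T n x y) \<le> s * (1 / 2) ^ n" if xy: "norm x < \<rho>" "norm y < \<rho>" for n x y
  proof (induction n)
    case 0
    show ?case using small[OF xy(1) Tb[OF xy, of 0]] s by (simp add: TS T0)
  next
    case (Suc n)
    have "T (Suc (Suc n)) x y - T (Suc n) x y =
        - (x\<^sup>2 * F x (T (Suc n) x y) - x\<^sup>2 * F x (T n x y))"
      by (simp add: TS)
    then have "norm (T (Suc (Suc n)) x y - T (Suc n) x y) =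
        norm (x\<^sup>2 * F x (T (Suc n) x y) - x\<^sup>2 * F x (T n x y))"
      by (simp only: norm_minus_cancel)
    also have "\<dots> \<le> norm (T (Suc n) x y - T n x y) / 2"
      using xy Tb[OF xy] by (intro contr)
    also have "\<dots> \<le> s * (1 / 2) ^ n / 2" using Suc by simp
    finally show ?case by simp
  qed
  define S where "S = (\<lambda>x y. y + (\<Sum>n. T (Suc n) x y - T n x y))"
  have lim: "uniform_limit A (\<lambda>n p. T n (\<phi> p) (\<psi> p)) (\<lambda>p. S (\<phi> p) (\<psi> p)) sequentially"
    if A: "\<And>p. p \<in> A \<Longrightarrow> norm (\<phi> p) < \<rho>" "\<And>p. p \<in> A \<Longrightarrow> norm (\<psi> p) < \<rho>"
    for A :: "complex set" and \<phi> \<psi> :: "complex \<Rightarrow> complex"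
  proof -
    have "uniform_limit A (\<lambda>n p. \<Sum>i<n. T (Suc i) (\<phi> p) (\<psi> p) - T i (\<phi> p) (\<psi> p))
        (\<lambda>p. \<Sum>i. T (Suc i) (\<phi> p) (\<psi> p) - T i (\<phi> p) (\<psi> p)) sequentially"
    proof (rule Weierstrass_m_test)
      show "norm (T (Suc n) (\<phi> p) (\<psi> p) - T n (\<phi> p) (\<psi> p)) \<le> s * (1 / 2) ^ n" if "p \<in> A" for n p
        using A[OF that] by (rule step)
      show "summable (\<lambda>n. s * (1 / 2) ^ n)"
        by (intro summable_mult summable_geometric) simp
    qed
    then have "uniform_limit A (\<lambda>n p. \<psi> p + (\<Sum>i<n. T (Suc i) (\<phi> p) (\<psi> p) - T i (\<phi> p) (\<psi> p)))
        (\<lambda>p. \<psi> p + (\<Sum>i. T (Suc i) (\<phi> p) (\<psi> p) - T i (\<phi> p) (\<psi> p))) sequentially"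
      by (intro uniform_limit_add uniform_limit_const)
    moreover have "\<psi> p + (\<Sum>i<n. T (Suc i) (\<phi> p) (\<psi> p) - T i (\<phi> p) (\<psi> p)) = T n (\<phi> p) (\<psi> p)" for n p
      using sum_lessThan_telescope[of "\<lambda>i. T i (\<phi> p) (\<psi> p)" n] by (simp add: T0)
    ultimately show ?thesis by (simp add: S_def)
  qed
  have ptw: "(\<lambda>n. T n x y) \<longlonglongrightarrow> S x y" if "norm x < \<rho>" "norm y < \<rho>" for x y
    using tendsto_uniform_limitI[OF lim[of "{0}" "\<lambda>_. x" "\<lambda>_. y"], of 0] that by simp
  have Sb: "norm (S x y) \<le> s" if "norm x < \<rho>" "norm y < \<rho>" for x y
    using Tb[OF that] by (intro Lim_norm_ubound[OF _ ptw[OF that]]) auto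
  have fix_pt: "S x y = y - x\<^sup>2 * F x (S x y)" if xy: "norm x < \<rho>" "norm y < \<rho>" for x y
  proof -
    have "(\<lambda>n. x\<^sup>2 * F x (T n x y)) \<longlonglongrightarrow> x\<^sup>2 * F x (S x y)"
    proof (rule LIM_zero_cancel, rule Lim_null_comparison)
      show "\<forall>\<^sub>F n in sequentially. norm (x\<^sup>2 * F x (T n x y) - x\<^sup>2 * F x (S x y)) \<le> norm (T n x y - S x y) / 2"
        by (intro always_eventually allI contr xy Tb Sb)
      show "(\<lambda>n. norm (T n x y - S x y) / 2) \<longlonglongrightarrow> 0"
        using tendsto_divide_zero[OF tendsto_norm_zero[OF LIM_zero[OF ptw[OF xy]]]] by simp
    qed
    then have "(\<lambda>n. y - x\<^sup>2 * F x (T n x y)) \<longlonglongrightarrow> y - x\<^sup>2 * F x (S x y)"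
      by (intro tendsto_diff tendsto_const)
    then have "(\<lambda>n. T (Suc n) x y) \<longlonglongrightarrow> y - x\<^sup>2 * F x (S x y)" by (simp add: TS)
    moreover have "(\<lambda>n. T (Suc n) x y) \<longlonglongrightarrow> S x y" using ptw[OF xy] by (rule LIMSEQ_Suc)
    ultimately show ?thesis using LIMSEQ_unique by metis
  qed
  have Tx: "(\<lambda>x. T n x y) holomorphic_on ball 0 \<rho>" if "norm y < \<rho>" for n y
  proof (induction n)
    case (Suc n)
    have "(\<lambda>x. F x (T n x y)) holomorphic_on ball 0 \<rho>"
      using Tb[OF _ that] \<rho>_le s by (intro pseries2_compose_holomorphic[OF F s(3,2)] Suc holomorphic_intros) auto
    then show ?case unfolding TS by (intro holomorphic_intros)
  qed (simp add: T0)
  have Ty: "(\<lambda>y. T n x y) holomorphic_on ball 0 \<rho>" if "norm x < \<rho>" for n x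
  proof (induction n)
    case (Suc n)
    have "(\<lambda>y. F x (T n x y)) holomorphic_on ball 0 \<rho>"
      using Tb[OF that] that \<rho>_le s by (intro pseries2_compose_holomorphic[OF F s(3,2)] Suc holomorphic_intros) auto
    then show ?case unfolding TS by (intro holomorphic_intros)
  qed (simp add: T0 holomorphic_on_ident)
  show ?thesis
  proof (rule that[of \<rho> s S])
    show "(\<lambda>x. S x y) holomorphic_on ball 0 \<rho>" if "norm y < \<rho>" for y
      by (rule holomorphic_on_uniform_limit[OF lim[of "ball 0 \<rho>" "\<lambda>x. x" "\<lambda>_. y"]])
        (use that Tx in auto)
    show "(\<lambda>y. S x y) holomorphic_on ball 0 \<rho>" if "norm x < \<rho>" for x
      by (rule holomorphic_on_uniform_limit[OF lim[of "ball 0 \<rho>" "\<lambda>_. x" "\<lambda>y. y"]])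
        (use that Ty in auto)
    show "norm (S x y) < s" if xy: "norm x < \<rho>" "norm y < \<rho>" for x y
    proof -
      have "norm (S x y) \<le> norm y + norm (x\<^sup>2 * F x (S x y))"
        using fix_pt[OF xy] norm_triangle_ineq4 by metis
      also have "\<dots> < s / 2 + s / 2"
        using small[OF xy(1) Sb[OF xy]] xy(2) \<rho>_le(1) by linarith
      finally show ?thesis by simp
    qed
    show "t = S x y" if xy: "norm x < \<rho>" "norm y < \<rho>" and t: "norm t < s" "t = y - x\<^sup>2 * F x t" for x y t
    proof -
      have "norm (t - S x y) = norm (x\<^sup>2 * F x t - x\<^sup>2 * F x (S x y))"
      proof -
        have "t - S x y = - (x\<^sup>2 * F x t - x\<^sup>2 * F x (S x y))"
          using t(2) fix_pt[OF xy] by algebra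
        then show ?thesis by (simp only: norm_minus_cancel)
      qed
      also have "\<dots> \<le> norm (t - S x y) / 2"
        using xy t Sb[OF xy] by (intro contr) auto
      finally show ?thesis by simp
    qed
  qed (use \<rho> \<rho>_le s fix_pt in auto)
qed

text \<open>
  Solving \<open>y = t + x^2 E(x, t)\<close> for \<open>t\<close>. Writing the solution as \<open>y + x^2 B(x, y)\<close> keeps the factor \<open>x^2\<close>,
  so that the approximation function of the new graph is visible as \<open>2 B(0, y) = - 2 E(0, y)\<close>.
\<close>
lemma implicit_graph:
  fixes E :: "real \<Rightarrow> real \<Rightarrow> real"
  assumes E: "pseries2 c r E" and r: "r > 0"
  obtains s \<rho> d B where "0 < \<rho>" "\<rho> < s" "0 < s" "s < r" "pseries2 d \<rho> B"
    "\<And>x y. \<bar>x\<bar> < \<rho> \<Longrightarrow> \<bar>y\<bar> < \<rho> \<Longrightarrow> \<bar>y + x\<^sup>2 * B x y\<bar> < s"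
    "\<And>x y t. \<bar>x\<bar> < \<rho> \<Longrightarrow> \<bar>y\<bar> < \<rho> \<Longrightarrow> \<bar>t\<bar> < s \<Longrightarrow> t + x\<^sup>2 * E x t = y \<longleftrightarrow> t = y + x\<^sup>2 * B x y"
    "\<And>y. \<bar>y\<bar> < \<rho> \<Longrightarrow> B 0 y = - E 0 y"
proof -
  obtain F where F: "pseries2 (\<lambda>m n. complex_of_real (c m n)) r F"
    and FE: "\<And>x y. \<bar>x\<bar> < r \<Longrightarrow> \<bar>y\<bar> < r \<Longrightarrow> F (of_real x) (of_real y) = of_real (E x y)"
    and Fcnj: "\<And>z w. norm z < r \<Longrightarrow> norm w < r \<Longrightarrow> F (cnj z) (cnj w) = cnj (F z w)"
    using pseries2_complexification[OF E] by metis
  show ?thesis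
  proof (rule analytic_fixed_point[OF F r])
    fix \<rho> s :: real and T :: "complex \<Rightarrow> complex \<Rightarrow> complex"
    assume \<rho>: "0 < \<rho>" "\<rho> \<le> s" and s: "0 < s" "s < r"
      and Tx: "\<And>y. norm y < \<rho> \<Longrightarrow> (\<lambda>x. T x y) holomorphic_on ball 0 \<rho>"
      and Ty: "\<And>x. norm x < \<rho> \<Longrightarrow> (\<lambda>y. T x y) holomorphic_on ball 0 \<rho>"
      and Tb: "\<And>x y. norm x < \<rho> \<Longrightarrow> norm y < \<rho> \<Longrightarrow> norm (T x y) < s"
      and Tfix: "\<And>x y. norm x < \<rho> \<Longrightarrow> norm y < \<rho> \<Longrightarrow> T x y = y - x\<^sup>2 * F x (T x y)"
      and Tuniq: "\<And>x y t. norm x < \<rho> \<Longrightarrow> norm y < \<rho> \<Longrightarrow> norm t < s \<Longrightarrow> t = y - x\<^sup>2 * F x t \<Longrightarrow> t = T x y"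
    obtain M where M: "M \<ge> 0" "\<And>z w. norm z \<le> s \<Longrightarrow> norm w \<le> s \<Longrightarrow> norm (F z w) \<le> M"
      using pseries2_bounded[OF F less_imp_le[OF s(1)] s(2)] by metis
    have s0: "0 \<le> s" using s by simp
    \<comment> \<open>the conjugate of the solution solves the same equation\<close>
    have Treal: "T (of_real x) (of_real y) = of_real (Re (T (of_real x) (of_real y)))"
      if xy: "\<bar>x\<bar> < \<rho>" "\<bar>y\<bar> < \<rho>" for x y
    proof -
      define t where "t = T (of_real x) (of_real y)"
      have xy': "norm (complex_of_real x) < \<rho>" "norm (complex_of_real y) < \<rho>" using xy by auto
      have tb: "norm t < s" unfolding t_def by (rule Tb[OF xy'])
      have "t = of_real y - (of_real x)\<^sup>2 * F (of_real x) t" unfolding t_def by (rule Tfix[OF xy'])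
      then have "cnj t = cnj (of_real y - (of_real x)\<^sup>2 * F (of_real x) t)" by simp
      also have "\<dots> = of_real y - (of_real x)\<^sup>2 * F (of_real x) (cnj t)"
        using Fcnj[of "of_real x" t] xy' tb \<rho> s by simp
      finally have "cnj t = T (of_real x) (of_real y)"
        using tb by (intro Tuniq xy') auto
      then have "cnj t = t" by (simp add: t_def)
      then show ?thesis unfolding t_def[symmetric] by (simp add: complex_eq_iff)
    qed
    define \<tau> where "\<tau> = (\<lambda>x y. Re (T (of_real x) (of_real y)))"
    define B where "B = (\<lambda>x y. - E x (\<tau> x y))"
    have \<tau>b: "\<bar>\<tau> x y\<bar> < s" if "\<bar>x\<bar> < \<rho>" "\<bar>y\<bar> < \<rho>" for x y
      using Tb[of "of_real x" "of_real y"] that abs_Re_le_cmod[of "T (of_real x) (of_real y)"]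
      unfolding \<tau>_def by simp
    have FB: "- F (of_real x) (T (of_real x) (of_real y)) = of_real (B x y)" if xy: "\<bar>x\<bar> < \<rho>" "\<bar>y\<bar> < \<rho>" for x y
    proof -
      have "T (of_real x) (of_real y) = of_real (\<tau> x y)" using Treal[OF xy] by (simp add: \<tau>_def)
      then show ?thesis using FE[of x "\<tau> x y"] \<tau>b[OF xy] xy \<rho> s by (simp add: B_def)
    qed
    have \<tau>_eq: "\<tau> x y = y + x\<^sup>2 * B x y" if xy: "\<bar>x\<bar> < \<rho>" "\<bar>y\<bar> < \<rho>" for x y
    proof -
      have "complex_of_real (\<tau> x y) = T (of_real x) (of_real y)" using Treal[OF xy] by (simp add: \<tau>_def)
      also have "\<dots> = of_real y + (of_real x)\<^sup>2 * (- F (of_real x) (T (of_real x) (of_real y)))"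
        using Tfix[of "of_real x" "of_real y"] xy by simp
      also have "\<dots> = of_real (y + x\<^sup>2 * B x y)" unfolding FB[OF xy] by simp
      finally show ?thesis by (simp only: of_real_eq_iff)
    qed
    have uniq: "t = \<tau> x y" if xy: "\<bar>x\<bar> < \<rho>" "\<bar>y\<bar> < \<rho>" and t: "\<bar>t\<bar> < s" "t + x\<^sup>2 * E x t = y" for x y t
    proof -
      have "complex_of_real t = of_real y - (of_real x)\<^sup>2 * F (of_real x) (of_real t)"
        using FE[of x t] xy t(1) \<rho> s t(2)[symmetric] by simp
      then have "complex_of_real t = T (of_real x) (of_real y)"
        using xy t(1) by (intro Tuniq) auto
      then show ?thesis unfolding \<tau>_def by (metis Re_complex_of_real)
    qed
    obtain d where d: "pseries2 d (\<rho> / 2) B"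
    proof (rule osgood_real[where F = "\<lambda>x y. - F x (T x y)" and r = \<rho> and s = "\<rho> / 2"])
      show "(\<lambda>x. - F x (T x y)) holomorphic_on ball 0 \<rho>" if "norm y < \<rho>" for y
        using Tb[OF _ that] \<rho>
        by (intro holomorphic_intros pseries2_compose_holomorphic[OF F s0 s(2)] Tx that) (auto simp: less_imp_le)
      show "(\<lambda>y. - F x (T x y)) holomorphic_on ball 0 \<rho>" if "norm x < \<rho>" for x
        using Tb[OF that] \<rho> that
        by (intro holomorphic_intros pseries2_compose_holomorphic[OF F s0 s(2)] Ty that) (auto simp: less_imp_le)
      show "norm (- F x (T x y)) \<le> M" if "norm x < \<rho>" "norm y < \<rho>" for x y
        using Tb[OF that] that \<rho> M(2)[of x "T x y"] by simp
    qed (use FB \<rho> in auto)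
    show ?thesis
    proof (rule that[of "\<rho> / 2" s d B])
      show "\<bar>y + x\<^sup>2 * B x y\<bar> < s" if "\<bar>x\<bar> < \<rho> / 2" "\<bar>y\<bar> < \<rho> / 2" for x y
        using \<tau>_eq[of x y] \<tau>b[of x y] that \<rho> by simp
      show "t + x\<^sup>2 * E x t = y \<longleftrightarrow> t = y + x\<^sup>2 * B x y" if "\<bar>x\<bar> < \<rho> / 2" "\<bar>y\<bar> < \<rho> / 2" "\<bar>t\<bar> < s" for x y t
      proof
        assume "t + x\<^sup>2 * E x t = y"
        then show "t = y + x\<^sup>2 * B x y" using uniq[of x y t] \<tau>_eq[of x y] that \<rho> by simp
      next
        assume "t = y + x\<^sup>2 * B x y"
        moreover have eq: "\<tau> x y = y + x\<^sup>2 * B x y" using that \<rho> by (intro \<tau>_eq) auto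
        ultimately have t: "t = \<tau> x y" by simp
        have "\<tau> x y = y - x\<^sup>2 * E x (\<tau> x y)" using eq by (simp only: B_def)
        then show "t + x\<^sup>2 * E x t = y" unfolding t by linarith
      qed
      show "B 0 y = - E 0 y" if "\<bar>y\<bar> < \<rho> / 2" for y
        using \<tau>_eq[of 0 y] that \<rho> by (simp add: B_def)
    qed (use \<rho> s d in auto)
  qed
qed

section \<open>Graphs over the (t, x)-plane\<close>

lemma lightlike_at_graph_y:
  assumes "((\<lambda>s. h s x) has_real_derivative a) (at t)" "((\<lambda>s. h t s) has_real_derivative 0) (at x)"
    and a: "a\<^sup>2 = 1"
  shows "lightlike_at (graph_y h) t x"
proof -
  have "((\<lambda>s. graph_y h s x) has_vector_derivative (1, 0, a)) (at t)"
    "((\<lambda>s. graph_y h t s) has_vector_derivative (0, 1, 0)) (at x)"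
    unfolding graph_y_def using assms(1,2)
    by (auto intro!: derivative_eq_intros simp: has_real_derivative_iff_has_vector_derivative)
  then have tm: "tangent_map (graph_y h) t x w = (fst w, snd w, fst w * a)" for w
    by (simp add: tangent_map_def vector_derivative_at)
  have "induced_metric (graph_y h) t x (1, 0) z = 0" for z
    using a by (cases z) (simp add: induced_metric_def tm power2_eq_square)
  moreover have "(1::real, 0::real) \<noteq> 0" by (simp add: zero_prod_def)
  ultimately show ?thesis unfolding lightlike_at_def by blast
qed

lemma linear_null_ray: "linear null_ray"
  unfolding null_ray_def by (intro linearI) simp_all

lemma null_ray_closed_segment:
  assumes "a \<le> b"
  shows "null_ray ` {a..b} = closed_segment (null_ray a) (null_ray b)"
  using closed_segment_linear_image[OF linear_null_ray, of a b] assms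
  by (simp add: closed_segment_eq_real_ivl)

lemma lightlike_segment_null_rayI:
  assumes ab: "a < b"
    and on: "\<And>y. y \<in> {a..b} \<Longrightarrow> null_ray y \<in> surface F U"
    and light: "\<And>u v. (u, v) \<in> U \<Longrightarrow> F u v \<in> null_ray ` {a..b} \<Longrightarrow> lightlike_at F u v"
  shows "lightlike_segment F U (null_ray ` {a..b})"
proof -
  have "null_ray a \<noteq> null_ray b" using ab by (simp add: null_ray_def)
  moreover have "lorentz (null_ray b - null_ray a) (null_ray b - null_ray a) = 0"
    by (simp add: null_ray_def algebra_simps)
  moreover have "null_ray ` {a..b} = closed_segment (null_ray a) (null_ray b)"
    using ab by (intro null_ray_closed_segment) simp
  ultimately show ?thesis
    unfolding lightlike_segment_def using on light by blast
qed

text \<open>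
  Near the origin the surface \<open>y = H(t, x) = t + x^2 E(x, t)\<close> is also the graph
  \<open>t = y + x^2 B(x, y)\<close>, with approximation function \<open>\<alpha> = - H_xx(\<cdot>, 0)\<close>. The Born-Infeld equation for \<open>H\<close>
  gives its Riccati equation. The segment can be chosen short, since only some lightlike segment of
  the rotated surface is asked for.
\<close>
theorem class_along_graph_y:
  assumes ch: "axis_chart (\<lambda>x t. H t x) 0 c r"
    and bi: "born_infeld_on H ({-r<..<r} \<times> {-r<..<r})"
  obtains \<rho> where "0 < \<rho>" "\<rho> < r"
    "lightlike_segment (graph_y H) ({-r<..<r} \<times> {-r<..<r}) (null_ray ` {-\<rho>..\<rho>})"
    "\<And>C. class_along (surface (graph_y H) ({-r<..<r} \<times> {-r<..<r})) (null_ray ` {-\<rho>..\<rho>}) C \<longleftrightarrow>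
       class_cond C (- D2 (D2 H) 0 0) (D1 (D2 (D2 H)) 0 0 - (D2 (D2 H) 0 0)\<^sup>2)"
proof -
  define U where "U = {-r<..<r} \<times> {-r<..<r}"
  \<comment> \<open>the variable transversal to the line comes first in \<open>axis_chart\<close>\<close>
  define K where "K = (\<lambda>x t. H t x)"
  have D1K: "D1 K = (\<lambda>x t. D2 H t x)" and D2K: "D2 K = (\<lambda>x t. D1 H t x)"
    and D11K: "D1 (D1 K) = (\<lambda>x t. D2 (D2 H) t x)" and D22K: "D2 (D2 K) = (\<lambda>x t. D1 (D1 H) t x)"
    and D21K: "D2 (D1 K) = (\<lambda>x t. D1 (D2 H) t x)" and D12K: "D1 (D2 K) = (\<lambda>x t. D2 (D1 H) t x)"
    and D112K: "D2 (D1 (D1 K)) = (\<lambda>x t. D1 (D2 (D2 H)) t x)"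
    by (simp_all add: K_def D1_def D2_def)
  have ch: "axis_chart K 0 c r" using ch by (simp add: K_def)
  have r: "r > 0" and c: "pseries2 c r K"
    and ax: "\<And>v. \<bar>v\<bar> < r \<Longrightarrow> K 0 v = v" "\<And>v. \<bar>v\<bar> < r \<Longrightarrow> D1 K 0 v = 0"
    using ch unfolding axis_chart_def by simp_all
  have partials: "((\<lambda>s. H s x) has_real_derivative D1 H t x) (at t)"
      "((\<lambda>s. H t s) has_real_derivative D2 H t x) (at x)" "D1 (D2 K) x t = D2 (D1 K) x t"
    if t: "\<bar>t\<bar> < r" and x: "\<bar>x\<bar> < r" for t x
  proof -
    obtain c' s where s: "s > 0" and c': "pseries2 c' s (\<lambda>u v. K (x + u) (t + v))"
      by (rule pseries2_recenter[OF c x t])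
    note p = pseries2_partials[OF c' s]
    show "((\<lambda>s. H s x) has_real_derivative D1 H t x) (at t)"
      using p(3,11) D2K by (simp add: K_def)
    show "((\<lambda>s. H t s) has_real_derivative D2 H t x) (at x)"
      using p(2,10) D1K by (simp add: K_def)
    show "D1 (D2 K) x t = D2 (D1 K) x t" using p by simp
  qed
  obtain E where E: "pseries2 (\<lambda>m. c (Suc (Suc m))) r E"
    and KE: "\<And>x t. \<bar>x\<bar> < r \<Longrightarrow> \<bar>t\<bar> < r \<Longrightarrow> K x (0 + t) = 0 + t + x\<^sup>2 * E x t"
    and E0: "\<And>t. \<bar>t\<bar> < r \<Longrightarrow> E 0 t = D1 (D1 K) 0 (0 + t) / 2"
    using axis_chart_quadratic[OF ch] by metis
  obtain s \<rho> d B where \<rho>: "0 < \<rho>" "\<rho> < s" and s: "0 < s" "s < r" and d: "pseries2 d \<rho> B"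
    and Bs: "\<And>x y. \<bar>x\<bar> < \<rho> \<Longrightarrow> \<bar>y\<bar> < \<rho> \<Longrightarrow> \<bar>y + x\<^sup>2 * B x y\<bar> < s"
    and sol: "\<And>x y t. \<bar>x\<bar> < \<rho> \<Longrightarrow> \<bar>y\<bar> < \<rho> \<Longrightarrow> \<bar>t\<bar> < s \<Longrightarrow> t + x\<^sup>2 * E x t = y \<longleftrightarrow> t = y + x\<^sup>2 * B x y"
    and B0: "\<And>y. \<bar>y\<bar> < \<rho> \<Longrightarrow> B 0 y = - E 0 y"
    by (rule implicit_graph[OF E r]) (rule that; assumption)
  obtain B1 where B1: "pseries2 (\<lambda>m. d (Suc m)) \<rho> B1"
    and BB1: "\<And>x y. \<bar>x\<bar> < \<rho> \<Longrightarrow> \<bar>y\<bar> < \<rho> \<Longrightarrow> B x y = B 0 y + x * B1 x y"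
    using pseries2_shift[OF d] by metis
  define \<alpha> where "\<alpha> = (\<lambda>y. - D1 (D1 K) 0 y)"
  define V where "V = {-\<rho><..<\<rho>} \<times> {-\<rho><..<\<rho>}"
  define W where "W = {-s<..<s} \<times> V"
  define J where "J = {-(\<rho>/2)..\<rho>/2}"
  have \<tau>: "y + \<alpha> y / 2 * x\<^sup>2 + B1 x y * x ^ 3 = y + x\<^sup>2 * B x y" if "\<bar>x\<bar> < \<rho>" "\<bar>y\<bar> < \<rho>" for x y
  proof -
    have "\<bar>y\<bar> < r" using that \<rho> s by linarith
    then have "B x y = \<alpha> y / 2 + x * B1 x y"
      using BB1[OF that] B0[OF that(2)] E0[of y] by (simp add: \<alpha>_def)
    then show ?thesis by (simp add: algebra_simps power2_eq_square power3_eq_cube)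
  qed
  have SW: "surface (graph_y H) U \<inter> W = surface (graph_t (\<lambda>x y. y + \<alpha> y / 2 * x\<^sup>2 + B1 x y * x ^ 3)) V"
  proof (intro equalityI subsetI)
    fix p assume "p \<in> surface (graph_y H) U \<inter> W"
    then obtain t x where p: "p = (t, x, H t x)" "\<bar>t\<bar> < s" "\<bar>x\<bar> < \<rho>" "\<bar>H t x\<bar> < \<rho>"
      by (auto simp: surface_def graph_y_def W_def V_def abs_less_iff)
    have "t + x\<^sup>2 * E x t = H t x"
      using KE[of x t] p \<rho> s by (simp add: K_def)
    then have "t = H t x + x\<^sup>2 * B x (H t x)" using sol[OF p(3,4,2)] by simp
    then have "p = (case (x, H t x) of (u, v) \<Rightarrow> graph_t (\<lambda>x y. y + \<alpha> y / 2 * x\<^sup>2 + B1 x y * x ^ 3) u v)"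
      using \<tau>[OF p(3,4)] p(1) by (simp add: graph_t_def)
    moreover have "(x, H t x) \<in> V" using p(3,4) by (auto simp: V_def abs_less_iff)
    ultimately show "p \<in> surface (graph_t (\<lambda>x y. y + \<alpha> y / 2 * x\<^sup>2 + B1 x y * x ^ 3)) V"
      unfolding surface_def by (rule image_eqI)
  next
    fix p assume "p \<in> surface (graph_t (\<lambda>x y. y + \<alpha> y / 2 * x\<^sup>2 + B1 x y * x ^ 3)) V"
    then obtain x y where p: "p = (y + \<alpha> y / 2 * x\<^sup>2 + B1 x y * x ^ 3, x, y)" "\<bar>x\<bar> < \<rho>" "\<bar>y\<bar> < \<rho>"
      by (auto simp: surface_def graph_t_def V_def abs_less_iff)
    define t where "t = y + x\<^sup>2 * B x y"
    have pt: "p = (t, x, y)" using p(1) \<tau>[OF p(2,3)] by (simp add: t_def)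
    have ts: "\<bar>t\<bar> < s" unfolding t_def using p(2,3) by (rule Bs)
    have "t + x\<^sup>2 * E x t = y" using sol[OF p(2,3) ts] by (simp add: t_def)
    then have "H t x = y" using KE[of x t] p ts \<rho> s by (simp add: K_def)
    then have "p = (case (t, x) of (u, v) \<Rightarrow> graph_y H u v)" using pt by (simp add: graph_y_def)
    moreover have "(t, x) \<in> U" using ts p(2) \<rho> s by (auto simp: U_def abs_less_iff)
    ultimately have "p \<in> surface (graph_y H) U" unfolding surface_def by (rule image_eqI)
    moreover have "p \<in> W" using pt ts p(2,3) by (auto simp: W_def V_def abs_less_iff)
    ultimately show "p \<in> surface (graph_y H) U \<inter> W" by blast
  qed
  have Jr: "\<bar>y\<bar> < r" "\<bar>y\<bar> < \<rho>" "\<bar>y\<bar> < s" if "y \<in> J" for y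
    using that \<rho> s by (auto simp: J_def abs_less_iff)
  have onS: "null_ray y \<in> surface (graph_y H) U" if "y \<in> J" for y
  proof -
    have "null_ray y = (case (y, 0) of (u, v) \<Rightarrow> graph_y H u v)" "(y, 0) \<in> U"
      using ax(1)[of y] Jr[OF that] r by (auto simp: null_ray_def graph_y_def U_def K_def abs_less_iff)
    then show ?thesis unfolding surface_def by (rule image_eqI)
  qed
  have an\<alpha>: "real_analytic_on \<alpha> {-\<rho><..<\<rho>}"
    unfolding real_analytic_on_iff
  proof
    fix y assume "y \<in> {-\<rho><..<\<rho>}"
    then have "\<bar>y\<bar> < r" using \<rho> s by (auto simp: abs_less_iff)
    then obtain a e where e: "e > 0" "\<And>w. \<bar>w\<bar> < e \<Longrightarrow> (\<lambda>n. a n * w ^ n) sums D1 (D1 K) 0 (y + w)"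
      using pseries2_axis_analytic[OF pseries2_deriv1(1)[OF pseries2_deriv1(1)[OF c]]] by metis
    have "(\<lambda>n. - a n * w ^ n) sums \<alpha> (y + w)" if "\<bar>w\<bar> < e" for w
      using sums_minus[OF e(2)[OF that]] by (simp add: \<alpha>_def)
    with e(1) show "\<exists>a r. r > 0 \<and> (\<forall>v. \<bar>v\<bar> < r \<longrightarrow> (\<lambda>n. a n * v ^ n) sums \<alpha> (y + v))"
      by (intro exI[of _ "\<lambda>n. - a n"] exI[of _ e]) simp
  qed
  have app: "approximation_function (surface (graph_y H) U) (null_ray ` J) \<alpha>"
    unfolding approximation_function_def
  proof (intro conjI exI)
    show "null_ray ` J \<subseteq> surface (graph_y H) U" using onS by blast
    show "null_ray ` J \<subseteq> {(y, 0, y) | y. True}" by (auto simp: null_ray_def)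
    show "open W" "open V" unfolding W_def V_def by (intro open_Times open_greaterThanLessThan)+
    show "null_ray ` J \<subseteq> W"
    proof
      fix p assume "p \<in> null_ray ` J"
      then obtain y where y: "y \<in> J" "p = null_ray y" by blast
      then show "p \<in> W" using Jr[OF y(1)] \<rho> by (auto simp: null_ray_def W_def V_def abs_less_iff)
    qed
    show "V \<subseteq> UNIV \<times> {-\<rho><..<\<rho>}" by (auto simp: V_def)
    show "real_analytic2_on B1 V" unfolding V_def by (rule pseries2_imp_real_analytic2_on[OF B1])
  qed (use an\<alpha> SW in auto)
  have "riccati_on (\<lambda>y. - 1 * D1 (D1 K) 0 y) (- (- 1 * D2 (D1 (D1 K)) 0 0) - (D1 (D1 K) 0 0)\<^sup>2) J"
    unfolding J_def
  proof (rule riccati_of_pde)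
    fix y0 assume "y0 \<in> {-(\<rho>/2)..\<rho>/2}"
    then have y0: "\<bar>y0\<bar> < r" using Jr by (simp add: J_def)
    obtain c' r' where cr: "axis_chart K y0 c' r'" "r' \<le> r - \<bar>y0\<bar>"
      using axis_chart_recenter[OF ch y0] by metis
    have "(1 - (D2 K x y0)\<^sup>2) * D1 (D1 K) x y0 + 2 * D1 K x y0 * D2 K x y0 * D2 (D1 K) x y0
        + (- 1 - (D1 K x y0)\<^sup>2) * D2 (D2 K) x y0 = 0" if "\<bar>x\<bar> < r'" for x
    proof -
      have x: "\<bar>x\<bar> < r" using that cr(2) by linarith
      then have "(y0, x) \<in> U" using y0 by (auto simp: U_def abs_less_iff)
      then have "(1 - (D1 H y0 x)\<^sup>2) * D2 (D2 H) y0 x + 2 * D1 H y0 x * D2 H y0 x * D2 (D1 H) y0 x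
          - (1 + (D2 H y0 x)\<^sup>2) * D1 (D1 H) y0 x = 0"
        using bi unfolding born_infeld_on_def U_def by blast
      then show ?thesis
        using partials(3)[OF y0 x] unfolding D11K D22K D21K D12K unfolding D1K D2K by algebra
    qed
    with cr(1) show "\<exists>c r. axis_chart K y0 c r \<and>
        (\<forall>x. \<bar>x\<bar> < r \<longrightarrow> (1 - (D2 K x y0)\<^sup>2) * D1 (D1 K) x y0
        + 2 * D1 K x y0 * D2 K x y0 * D2 (D1 K) x y0 + (- 1 - (D1 K x y0)\<^sup>2) * D2 (D2 K) x y0 = 0)"
      by blast
  qed (use \<rho> in auto)
  then have ric: "riccati_on \<alpha> (D1 (D2 (D2 H)) 0 0 - (D2 (D2 H) 0 0)\<^sup>2) J"
    unfolding \<alpha>_def D112K unfolding D11K by simp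
  have "class_along (surface (graph_y H) U) (null_ray ` J) C \<longleftrightarrow>
      class_cond C (\<alpha> 0) (D1 (D2 (D2 H)) 0 0 - (D2 (D2 H) 0 0)\<^sup>2)" for C
    by (rule class_along_iff_class_cond[OF _ _ _ _ app ric[unfolded J_def]]) (use \<rho> in \<open>auto simp: J_def\<close>)
  moreover have "\<alpha> 0 = - D2 (D2 H) 0 0" by (simp add: \<alpha>_def D11K)
  moreover have "lightlike_segment (graph_y H) U (null_ray ` J)"
    unfolding J_def
  proof (rule lightlike_segment_null_rayI)
    show "null_ray y \<in> surface (graph_y H) U" if "y \<in> {-(\<rho>/2)..\<rho>/2}" for y
      using that onS by (simp add: J_def)
    fix t x assume tx: "(t, x) \<in> U" "graph_y H t x \<in> null_ray ` {-(\<rho>/2)..\<rho>/2}"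
    then have x: "x = 0" and t: "\<bar>t\<bar> < r" by (auto simp: graph_y_def null_ray_def U_def abs_less_iff)
    have 0: "\<bar>0\<bar> < r" using r by simp
    have "((\<lambda>s. H s 0) has_real_derivative 1) (at t)"
    proof (rule has_field_derivative_transform_within_open[where S = "{-r<..<r}"])
      show "((\<lambda>s. s) has_real_derivative 1) (at t)" by (rule DERIV_ident)
      show "s = H s 0" if "s \<in> {-r<..<r}" for s
        using ax(1)[of s] that by (simp add: K_def abs_less_iff)
    qed (use t in \<open>auto simp: abs_less_iff\<close>)
    moreover have "((\<lambda>s. H t s) has_real_derivative 0) (at 0)"
      using partials(2)[OF t 0] ax(2)[OF t] by (simp add: D1K)
    ultimately show "lightlike_at (graph_y H) t x"
      unfolding x by (rule lightlike_at_graph_y) simp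
  qed (use \<rho> in auto)
  ultimately show ?thesis
    using that[of "\<rho> / 2"] \<rho> s by (simp add: J_def U_def)
qed

section \<open>Rotating one variable of a complexified solution\<close>

text \<open>
  Complex counterparts of \<^const>\<open>D1\<close> and \<^const>\<open>D2\<close>.
\<close>
definition CD1 :: "(complex \<Rightarrow> complex \<Rightarrow> complex) \<Rightarrow> complex \<Rightarrow> complex \<Rightarrow> complex" where
  "CD1 F = (\<lambda>z w. deriv (\<lambda>s. F s w) z)"

definition CD2 :: "(complex \<Rightarrow> complex \<Rightarrow> complex) \<Rightarrow> complex \<Rightarrow> complex \<Rightarrow> complex" where
  "CD2 F = (\<lambda>z w. deriv (F z) w)"

lemma pseries2_CD1:
  assumes "pseries2 (\<lambda>m n. complex_of_real (c m n)) r F"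
  shows "pseries2 (\<lambda>m n. complex_of_real (dcoeff1 c m n)) r (CD1 F)"
  using pseries2_deriv1_complex[OF assms] by (simp add: CD1_def dcoeff1_def)

lemma pseries2_CD2:
  assumes "pseries2 (\<lambda>m n. complex_of_real (c m n)) r F"
  shows "pseries2 (\<lambda>m n. complex_of_real (dcoeff2 c m n)) r (CD2 F)"
  using pseries2_deriv2_complex[OF assms] by (simp add: CD2_def dcoeff2_def)

text \<open>
  With \<open>\<kappa> = \<plusminus>1\<close> and \<open>\<kappa> = \<plusminus>\<i>\<close> these are the two Wick rotations up to sign.
\<close>
definition rotated :: "complex \<Rightarrow> (complex \<Rightarrow> complex \<Rightarrow> complex) \<Rightarrow> real \<Rightarrow> real \<Rightarrow> real" where
  "rotated \<kappa> F = (\<lambda>x y. Re (\<kappa> * F (\<i> * of_real x) (of_real y)))"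

definition rotated_coeff :: "complex \<Rightarrow> (nat \<Rightarrow> nat \<Rightarrow> real) \<Rightarrow> nat \<Rightarrow> nat \<Rightarrow> real" where
  "rotated_coeff \<kappa> c = (\<lambda>m n. Re (\<kappa> * \<i> ^ m) * c m n)"

lemma dcoeff1_rotated: "dcoeff1 (rotated_coeff \<kappa> c) = rotated_coeff (\<kappa> * \<i>) (dcoeff1 c)"
  by (simp add: fun_eq_iff dcoeff1_def rotated_coeff_def mult_ac)

lemma dcoeff2_rotated: "dcoeff2 (rotated_coeff \<kappa> c) = rotated_coeff \<kappa> (dcoeff2 c)"
  by (simp add: fun_eq_iff dcoeff2_def rotated_coeff_def mult_ac)

lemma pseries2_rotated:
  assumes F: "pseries2 (\<lambda>m n. complex_of_real (c m n)) r F"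
  shows "pseries2 (rotated_coeff \<kappa> c) r (rotated \<kappa> F)"
  unfolding pseries2_def
proof (intro allI impI)
  fix x y :: real assume xy: "norm x < r" "norm y < r"
  have "((\<lambda>p. \<kappa> * (\<lambda>(m, n). of_real (c m n) * (\<i> * of_real x) ^ m * of_real y ^ n) p) has_sum
      \<kappa> * F (\<i> * of_real x) (of_real y)) UNIV"
    using xy by (intro has_sum_cmult_right pseries2D[OF F]) (auto simp: norm_mult)
  then have "((\<lambda>p. Re (\<kappa> * (\<lambda>(m, n). of_real (c m n) * (\<i> * of_real x) ^ m * of_real y ^ n) p)) has_sum
      rotated \<kappa> F x y) UNIV"
    unfolding rotated_def by (rule has_sum_Re)
  moreover have "Re (\<kappa> * (\<lambda>(m, n). of_real (c m n) * (\<i> * of_real x) ^ m * of_real y ^ n) p) =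
      (\<lambda>(m, n). rotated_coeff \<kappa> c m n * x ^ m * y ^ n) p" for p
  proof (cases p)
    case (Pair m n)
    have 1: "\<kappa> * (of_real (c m n) * (\<i> * of_real x) ^ m * of_real y ^ n) =
        (\<kappa> * \<i> ^ m) * of_real (c m n * x ^ m * y ^ n)"
      by (simp add: power_mult_distrib mult_ac)
    have 2: "Re (\<kappa> * \<i> ^ m * of_real t) = Re (\<kappa> * \<i> ^ m) * t" for t by simp
    show ?thesis
      unfolding Pair prod.case 1 2 rotated_coeff_def by (simp only: mult.assoc)
  qed
  ultimately show "((\<lambda>(m, n). rotated_coeff \<kappa> c m n * x ^ m * y ^ n) has_sum rotated \<kappa> F x y) UNIV"
    by simp
qed

lemma D1_rotated:
  assumes F: "pseries2 (\<lambda>m n. complex_of_real (c m n)) r F" and xy: "\<bar>x\<bar> < r" "\<bar>y\<bar> < r"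
  shows "D1 (rotated \<kappa> F) x y = rotated (\<kappa> * \<i>) (CD1 F) x y"
proof -
  have A: "pseries2 (rotated_coeff (\<kappa> * \<i>) (dcoeff1 c)) r (D1 (rotated \<kappa> F))"
    using pseries2_deriv1(1)[OF pseries2_rotated[OF F]] by (simp add: dcoeff1_rotated)
  have B: "pseries2 (rotated_coeff (\<kappa> * \<i>) (dcoeff1 c)) r (rotated (\<kappa> * \<i>) (CD1 F))"
    by (rule pseries2_rotated[OF pseries2_CD1[OF F]])
  show ?thesis using pseries2_unique_value[OF A B, of x y] xy by simp
qed

lemma D2_rotated:
  assumes F: "pseries2 (\<lambda>m n. complex_of_real (c m n)) r F" and xy: "\<bar>x\<bar> < r" "\<bar>y\<bar> < r"
  shows "D2 (rotated \<kappa> F) x y = rotated \<kappa> (CD2 F) x y"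
proof -
  have A: "pseries2 (rotated_coeff \<kappa> (dcoeff2 c)) r (D2 (rotated \<kappa> F))"
    using pseries2_deriv2(1)[OF pseries2_rotated[OF F]] by (simp add: dcoeff2_rotated)
  have B: "pseries2 (rotated_coeff \<kappa> (dcoeff2 c)) r (rotated \<kappa> (CD2 F))"
    by (rule pseries2_rotated[OF pseries2_CD2[OF F]])
  show ?thesis using pseries2_unique_value[OF A B, of x y] xy by simp
qed

text \<open>
  The rotated values \<open>\<kappa> F(\<i>x, y)\<close> are real, so that taking the real part loses nothing.
\<close>
definition real_rotation :: "complex \<Rightarrow> (nat \<Rightarrow> nat \<Rightarrow> real) \<Rightarrow> real \<Rightarrow> (complex \<Rightarrow> complex \<Rightarrow> complex) \<Rightarrow> bool" where
  "real_rotation \<kappa> c r F \<longleftrightarrow> pseries2 (\<lambda>m n. complex_of_real (c m n)) r F \<and>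
     (\<forall>x y. \<bar>x\<bar> < r \<longrightarrow> \<bar>y\<bar> < r \<longrightarrow> Im (\<kappa> * F (\<i> * of_real x) (of_real y)) = 0)"

lemma real_rotation_value:
  "real_rotation \<kappa> c r F \<Longrightarrow> \<bar>x\<bar> < r \<Longrightarrow> \<bar>y\<bar> < r \<Longrightarrow>
     \<kappa> * F (\<i> * of_real x) (of_real y) = of_real (rotated \<kappa> F x y)"
  by (simp add: real_rotation_def rotated_def complex_eq_iff)

lemma Im_eq_rotated: "Im (\<kappa> * F (\<i> * of_real x) (of_real y)) = rotated (- \<i> * \<kappa>) F x y"
  by (simp add: rotated_def algebra_simps)

text \<open>
  The imaginary part of \<open>\<kappa> F(\<i>x, y)\<close> is itself a rotated function, with factor \<open>- \<i>\<kappa>\<close>. Where it vanishes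
  identically, so do its derivatives.
\<close>
lemma real_rotation_CD:
  assumes "real_rotation \<kappa> c r F"
  shows "real_rotation (\<kappa> * \<i>) (dcoeff1 c) r (CD1 F)" "real_rotation \<kappa> (dcoeff2 c) r (CD2 F)"
proof -
  have F: "pseries2 (\<lambda>m n. complex_of_real (c m n)) r F"
    and zero: "\<And>x y. \<bar>x\<bar> < r \<Longrightarrow> \<bar>y\<bar> < r \<Longrightarrow> rotated (- \<i> * \<kappa>) F x y = 0"
    using assms Im_eq_rotated by (auto simp: real_rotation_def)
  have Z: "D1 (rotated (- \<i> * \<kappa>) F) x y = 0" "D2 (rotated (- \<i> * \<kappa>) F) x y = 0"
    if "\<bar>x\<bar> < r" "\<bar>y\<bar> < r" for x y
    using D_cong_box[of r "rotated (- \<i> * \<kappa>) F" "\<lambda>_ _. 0", OF zero that] by (simp_all add: D1_def D2_def)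
  have "Im (\<kappa> * \<i> * CD1 F (\<i> * of_real x) (of_real y)) = 0" if "\<bar>x\<bar> < r" "\<bar>y\<bar> < r" for x y
    using Z(1)[OF that] D1_rotated[OF F that, of "- \<i> * \<kappa>"] Im_eq_rotated[of "\<kappa> * \<i>" "CD1 F" x y]
    by (simp add: mult_ac)
  then show "real_rotation (\<kappa> * \<i>) (dcoeff1 c) r (CD1 F)"
    using pseries2_CD1[OF F] by (simp add: real_rotation_def)
  have "Im (\<kappa> * CD2 F (\<i> * of_real x) (of_real y)) = 0" if "\<bar>x\<bar> < r" "\<bar>y\<bar> < r" for x y
    using Z(2)[OF that] D2_rotated[OF F that, of "- \<i> * \<kappa>"] Im_eq_rotated[of \<kappa> "CD2 F" x y] by simp
  then show "real_rotation \<kappa> (dcoeff2 c) r (CD2 F)"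
    using pseries2_CD2[OF F] by (simp add: real_rotation_def)
qed

text \<open>
  Every derivative in the rotated variable contributes a factor \<open>\<i>\<close>.
\<close>
lemma rotated_partials:
  assumes rot: "real_rotation \<kappa> c r F" and xy: "\<bar>x\<bar> < r" "\<bar>y\<bar> < r"
  defines "K \<equiv> rotated \<kappa> F" and "z \<equiv> \<i> * of_real x" and "w \<equiv> complex_of_real y"
  shows "of_real (D1 K x y) = \<kappa> * \<i> * CD1 F z w" "of_real (D2 K x y) = \<kappa> * CD2 F z w"
    "of_real (D1 (D1 K) x y) = \<kappa> * \<i> * \<i> * CD1 (CD1 F) z w"
    "of_real (D2 (D1 K) x y) = \<kappa> * \<i> * CD2 (CD1 F) z w"
    "of_real (D2 (D2 K) x y) = \<kappa> * CD2 (CD2 F) z w"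
proof -
  note rot1 = real_rotation_CD(1)[OF rot] and rot2 = real_rotation_CD(2)[OF rot]
  note rot11 = real_rotation_CD(1)[OF rot1] and rot12 = real_rotation_CD(2)[OF rot1]
    and rot22 = real_rotation_CD(2)[OF rot2]
  have F: "pseries2 (\<lambda>m n. complex_of_real (c m n)) r F"
    using rot by (simp add: real_rotation_def)
  note e1 = D1_rotated[OF F, of _ _ \<kappa>] and e2 = D2_rotated[OF F, of _ _ \<kappa>]
  note F1 = pseries2_CD1[OF F] and F2 = pseries2_CD2[OF F]
  show "of_real (D1 K x y) = \<kappa> * \<i> * CD1 F z w"
    using real_rotation_value[OF rot1 xy] e1[OF xy] by (simp add: K_def z_def w_def)
  show "of_real (D2 K x y) = \<kappa> * CD2 F z w"
    using real_rotation_value[OF rot2 xy] e2[OF xy] by (simp add: K_def z_def w_def)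
  have "D1 (D1 K) x y = rotated (\<kappa> * \<i> * \<i>) (CD1 (CD1 F)) x y"
    unfolding K_def using D_cong_box(1)[OF e1 xy] D1_rotated[OF F1 xy] by simp
  then show "of_real (D1 (D1 K) x y) = \<kappa> * \<i> * \<i> * CD1 (CD1 F) z w"
    using real_rotation_value[OF rot11 xy] by (simp add: z_def w_def)
  have "D2 (D1 K) x y = rotated (\<kappa> * \<i>) (CD2 (CD1 F)) x y"
    unfolding K_def using D_cong_box(2)[OF e1 xy] D2_rotated[OF F1 xy] by simp
  then show "of_real (D2 (D1 K) x y) = \<kappa> * \<i> * CD2 (CD1 F) z w"
    using real_rotation_value[OF rot12 xy] by (simp add: z_def w_def)
  have "D2 (D2 K) x y = rotated \<kappa> (CD2 (CD2 F)) x y"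
    unfolding K_def using D_cong_box(2)[OF e2 xy] D2_rotated[OF F2 xy] by simp
  then show "of_real (D2 (D2 K) x y) = \<kappa> * CD2 (CD2 F) z w"
    using real_rotation_value[OF rot22 xy] by (simp add: z_def w_def)
qed

text \<open>
  For real \<open>y\<close> the left-hand side is holomorphic in \<open>z\<close> and vanishes at all real \<open>z\<close>. Only one variable
  becomes complex, since only one is rotated.
\<close>
lemma complex_zero_mean_curvature:
  assumes g: "pseries2 c r g" and F: "pseries2 (\<lambda>m n. complex_of_real (c m n)) r F"
    and zmc: "zero_mean_curvature_on g ({-r<..<r} \<times> {-r<..<r})" and z: "norm z < r" and y: "\<bar>y\<bar> < r"
  defines "w \<equiv> complex_of_real y"
  shows "(1 - (CD2 F z w)\<^sup>2) * CD1 (CD1 F) z w + 2 * CD1 F z w * CD2 F z w * CD2 (CD1 F) z w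
    + (1 - (CD1 F z w)\<^sup>2) * CD2 (CD2 F) z w = 0"
proof (rule holomorphic_zero_on_reals[where r = r and z = z and
      h = "\<lambda>z. (1 - (CD2 F z w)\<^sup>2) * CD1 (CD1 F) z w + 2 * CD1 F z w * CD2 F z w * CD2 (CD1 F) z w
    + (1 - (CD1 F z w)\<^sup>2) * CD2 (CD2 F) z w"])
  note F1 = pseries2_CD1[OF F] and F2 = pseries2_CD2[OF F]
  note F11 = pseries2_CD1[OF F1] and F12 = pseries2_CD2[OF F1] and F22 = pseries2_CD2[OF F2]
  have w: "norm w < r" using y by (simp add: w_def)
  show "(\<lambda>z. (1 - (CD2 F z w)\<^sup>2) * CD1 (CD1 F) z w + 2 * CD1 F z w * CD2 F z w * CD2 (CD1 F) z w
    + (1 - (CD1 F z w)\<^sup>2) * CD2 (CD2 F) z w) holomorphic_on ball 0 r"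
    by (intro holomorphic_intros pseries2_holomorphic1[OF F1 w] pseries2_holomorphic1[OF F2 w]
        pseries2_holomorphic1[OF F11 w] pseries2_holomorphic1[OF F12 w] pseries2_holomorphic1[OF F22 w])
  fix x :: real assume x: "\<bar>x\<bar> < r"
  note d1 = pseries2_deriv1(1)[OF g] and d2 = pseries2_deriv2(1)[OF g]
  note v = pseries2_complexification_value[OF F1 d1 x y] pseries2_complexification_value[OF F2 d2 x y]
    pseries2_complexification_value[OF F11 pseries2_deriv1(1)[OF d1] x y]
    pseries2_complexification_value[OF F12 pseries2_deriv2(1)[OF d1] x y]
    pseries2_complexification_value[OF F22 pseries2_deriv2(1)[OF d2] x y]
  have "(x, y) \<in> {-r<..<r} \<times> {-r<..<r}" using x y by (auto simp: abs_less_iff)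
  then have "(1 - (D2 g x y)\<^sup>2) * D1 (D1 g) x y + 2 * D1 g x y * D2 g x y * D2 (D1 g) x y
        + (1 - (D1 g x y)\<^sup>2) * D2 (D2 g) x y = 0"
    using zmc unfolding zero_mean_curvature_on_def by blast
  then have "complex_of_real ((1 - (D2 g x y)\<^sup>2) * D1 (D1 g) x y + 2 * D1 g x y * D2 g x y * D2 (D1 g) x y
        + (1 - (D1 g x y)\<^sup>2) * D2 (D2 g) x y) = 0" by simp
  then show "(1 - (CD2 F (of_real x) w)\<^sup>2) * CD1 (CD1 F) (of_real x) w
    + 2 * CD1 F (of_real x) w * CD2 F (of_real x) w * CD2 (CD1 F) (of_real x) w
    + (1 - (CD1 F (of_real x) w)\<^sup>2) * CD2 (CD2 F) (of_real x) w = 0"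
    unfolding w_def v by simp
qed (fact z)

text \<open>
  The rotated variable is the space variable of the Born-Infeld equation: its left-hand side is
  \<open>- \<kappa>\<close> times that of the zero mean curvature equation at \<open>(\<i>x, y)\<close>.
\<close>
lemma rotated_pde_square_one:
  assumes rot: "real_rotation \<kappa> c r F" and \<kappa>: "\<kappa>\<^sup>2 = 1" and xy: "\<bar>x\<bar> < r" "\<bar>y\<bar> < r"
    and zmc: "\<And>z y. norm z < r \<Longrightarrow> \<bar>y\<bar> < r \<Longrightarrow>
      (1 - (CD2 F z (of_real y))\<^sup>2) * CD1 (CD1 F) z (of_real y)
      + 2 * CD1 F z (of_real y) * CD2 F z (of_real y) * CD2 (CD1 F) z (of_real y)
      + (1 - (CD1 F z (of_real y))\<^sup>2) * CD2 (CD2 F) z (of_real y) = 0"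
  defines "K \<equiv> rotated \<kappa> F"
  shows "(1 - (D2 K x y)\<^sup>2) * D1 (D1 K) x y + 2 * D2 K x y * D1 K x y * D2 (D1 K) x y
    - (1 + (D1 K x y)\<^sup>2) * D2 (D2 K) x y = 0"
proof -
  define z where "z = \<i> * complex_of_real x"
  define w where "w = complex_of_real y"
  note p = rotated_partials[OF rot xy, folded K_def z_def w_def]
  have "norm z < r" using xy by (simp add: z_def norm_mult)
  from zmc[OF this xy(2), folded w_def]
  have P: "(1 - (CD2 F z w)\<^sup>2) * CD1 (CD1 F) z w + 2 * CD1 F z w * CD2 F z w * CD2 (CD1 F) z w
    + (1 - (CD1 F z w)\<^sup>2) * CD2 (CD2 F) z w = 0" .
  have i2: "\<i> * \<i> = (-1 :: complex)" by simp
  have "(1 - (\<kappa> * CD2 F z w)\<^sup>2) * (\<kappa> * \<i> * \<i> * CD1 (CD1 F) z w)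
      + 2 * (\<kappa> * CD2 F z w) * (\<kappa> * \<i> * CD1 F z w) * (\<kappa> * \<i> * CD2 (CD1 F) z w)
      - (1 + (\<kappa> * \<i> * CD1 F z w)\<^sup>2) * (\<kappa> * CD2 (CD2 F) z w) = 0"
    using P \<kappa> i2 by algebra
  then have "complex_of_real ((1 - (D2 K x y)\<^sup>2) * D1 (D1 K) x y + 2 * D2 K x y * D1 K x y * D2 (D1 K) x y
    - (1 + (D1 K x y)\<^sup>2) * D2 (D2 K) x y) = 0"
    unfolding of_real_add of_real_diff of_real_mult of_real_power of_real_1 of_real_numeral p .
  then show ?thesis by (simp only: of_real_eq_0_iff)
qed

text \<open>
  The rotated variable is the time variable of the Born-Infeld equation: its left-hand side is
  \<open>\<kappa>\<close> times that of the zero mean curvature equation at \<open>(\<i>x, y)\<close>.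
\<close>
lemma rotated_pde_square_minus_one:
  assumes rot: "real_rotation \<kappa> c r F" and \<kappa>: "\<kappa>\<^sup>2 = - 1" and xy: "\<bar>x\<bar> < r" "\<bar>y\<bar> < r"
    and zmc: "\<And>z y. norm z < r \<Longrightarrow> \<bar>y\<bar> < r \<Longrightarrow>
      (1 - (CD2 F z (of_real y))\<^sup>2) * CD1 (CD1 F) z (of_real y)
      + 2 * CD1 F z (of_real y) * CD2 F z (of_real y) * CD2 (CD1 F) z (of_real y)
      + (1 - (CD1 F z (of_real y))\<^sup>2) * CD2 (CD2 F) z (of_real y) = 0"
  defines "K \<equiv> rotated \<kappa> F"
  shows "(1 - (D1 K x y)\<^sup>2) * D2 (D2 K) x y + 2 * D1 K x y * D2 K x y * D2 (D1 K) x y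
    - (1 + (D2 K x y)\<^sup>2) * D1 (D1 K) x y = 0"
proof -
  define z where "z = \<i> * complex_of_real x"
  define w where "w = complex_of_real y"
  note p = rotated_partials[OF rot xy, folded K_def z_def w_def]
  have "norm z < r" using xy by (simp add: z_def norm_mult)
  from zmc[OF this xy(2), folded w_def]
  have P: "(1 - (CD2 F z w)\<^sup>2) * CD1 (CD1 F) z w + 2 * CD1 F z w * CD2 F z w * CD2 (CD1 F) z w
    + (1 - (CD1 F z w)\<^sup>2) * CD2 (CD2 F) z w = 0" .
  have i2: "\<i> * \<i> = (-1 :: complex)" by simp
  have "(1 - (\<kappa> * \<i> * CD1 F z w)\<^sup>2) * (\<kappa> * CD2 (CD2 F) z w)
      + 2 * (\<kappa> * \<i> * CD1 F z w) * (\<kappa> * CD2 F z w) * (\<kappa> * \<i> * CD2 (CD1 F) z w)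
      - (1 + (\<kappa> * CD2 F z w)\<^sup>2) * (\<kappa> * \<i> * \<i> * CD1 (CD1 F) z w) = 0"
    using P \<kappa> i2 by algebra
  then have "complex_of_real ((1 - (D1 K x y)\<^sup>2) * D2 (D2 K) x y + 2 * D1 K x y * D2 K x y * D2 (D1 K) x y
    - (1 + (D2 K x y)\<^sup>2) * D1 (D1 K) x y) = 0"
    unfolding of_real_add of_real_diff of_real_mult of_real_power of_real_1 of_real_numeral p .
  then show ?thesis by (simp only: of_real_eq_0_iff)
qed

lemma born_infeld_on_swap:
  assumes K: "pseries2 c r K"
    and pde: "\<And>x t. \<bar>x\<bar> < r \<Longrightarrow> \<bar>t\<bar> < r \<Longrightarrow>
      (1 - (D2 K x t)\<^sup>2) * D1 (D1 K) x t + 2 * D2 K x t * D1 K x t * D2 (D1 K) x t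
      - (1 + (D1 K x t)\<^sup>2) * D2 (D2 K) x t = 0"
  shows "born_infeld_on (\<lambda>t x. K x t) ({-r<..<r} \<times> {-r<..<r})"
  unfolding born_infeld_on_def
proof clarify
  fix t x assume "t \<in> {-r<..<r}" "x \<in> {-r<..<r}"
  then have tx: "\<bar>x\<bar> < r" "\<bar>t\<bar> < r" by (auto simp: abs_less_iff)
  have e: "D1 (\<lambda>t x. K x t) = (\<lambda>t x. D2 K x t)" "D2 (\<lambda>t x. K x t) = (\<lambda>t x. D1 K x t)"
    "D1 (\<lambda>t x. D2 K x t) = (\<lambda>t x. D2 (D2 K) x t)" "D2 (\<lambda>t x. D1 K x t) = (\<lambda>t x. D1 (D1 K) x t)"
    "D2 (\<lambda>t x. D2 K x t) = (\<lambda>t x. D1 (D2 K) x t)"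
    by (simp_all add: D1_def D2_def)
  show "(1 - (D1 (\<lambda>t x. K x t) t x)\<^sup>2) * D2 (D2 (\<lambda>t x. K x t)) t x
      + 2 * D1 (\<lambda>t x. K x t) t x * D2 (\<lambda>t x. K x t) t x * D2 (D1 (\<lambda>t x. K x t)) t x
      - (1 + (D2 (\<lambda>t x. K x t) t x)\<^sup>2) * D1 (D1 (\<lambda>t x. K x t)) t x = 0"
    unfolding e pseries2_mixed_partials[OF K tx] using pde[OF tx] .
qed

lemma holomorphic_reflected_argument:
  assumes "f holomorphic_on ball 0 r"
  shows "(\<lambda>z. f (- z)) holomorphic_on ball (0::complex) r"
proof -
  have "(f \<circ> uminus) holomorphic_on ball 0 r"
    by (rule holomorphic_on_compose_gen[of uminus "ball 0 r" f "ball 0 r"])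
      (use assms in \<open>auto intro: holomorphic_intros\<close>)
  then show ?thesis by (simp add: o_def)
qed

text \<open>
  A parity in \<open>x\<close> extends to complex arguments by the identity theorem.
\<close>
lemma parity_continuation:
  fixes g :: "real \<Rightarrow> real \<Rightarrow> real"
  assumes g: "pseries2 c r g" and F: "pseries2 (\<lambda>m n. complex_of_real (c m n)) r F"
    and par: "\<And>x y. \<bar>x\<bar> < r \<Longrightarrow> \<bar>y\<bar> < r \<Longrightarrow> g (- x) y = e * g x y" and z: "norm z < r" and y: "\<bar>y\<bar> < r"
  shows "F (- z) (of_real y) = of_real e * F z (of_real y)"
proof -
  have w: "norm (complex_of_real y) < r" using y by simp
  note hol = pseries2_holomorphic1[OF F w]
  have "F (- z) (of_real y) - of_real e * F z (of_real y) = 0"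
  proof (rule holomorphic_zero_on_reals[of "\<lambda>z. F (- z) (of_real y) - of_real e * F z (of_real y)", OF _ _ z])
    show "(\<lambda>z. F (- z) (of_real y) - of_real e * F z (of_real y)) holomorphic_on ball 0 r"
      by (intro holomorphic_intros hol holomorphic_reflected_argument[OF hol])
    fix x :: real assume x: "\<bar>x\<bar> < r"
    then have "F (of_real (- x)) (of_real y) = of_real (g (- x) y)"
      using y by (intro pseries2_complexification_value[OF F g]) auto
    then show "F (- of_real x) (of_real y) - of_real e * F (of_real x) (of_real y) = 0"
      using pseries2_complexification_value[OF F g x y] par[OF x y] by simp
  qed
  then show ?thesis by simp
qed

text \<open>
  Conjugation maps \<open>\<i>x\<close> to \<open>- \<i>x\<close>, so on the imaginary axis parity compares \<open>F\<close> with its conjugate: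
  an even \<open>F\<close> is real there and an odd one is purely imaginary.
\<close>
lemma even_odd_real_rotation:
  fixes g :: "real \<Rightarrow> real \<Rightarrow> real"
  assumes g: "pseries2 c r g" and F: "pseries2 (\<lambda>m n. complex_of_real (c m n)) r F"
  shows "(\<And>x y. \<bar>x\<bar> < r \<Longrightarrow> \<bar>y\<bar> < r \<Longrightarrow> g (- x) y = g x y) \<Longrightarrow> real_rotation (of_real k) c r F"
    and "(\<And>x y. \<bar>x\<bar> < r \<Longrightarrow> \<bar>y\<bar> < r \<Longrightarrow> g (- x) y = - g x y) \<Longrightarrow> real_rotation (- \<i> * of_real k) c r F"
proof -
  obtain G where G: "pseries2 (\<lambda>m n. complex_of_real (c m n)) r G"
    and Gcnj: "\<And>z w. norm z < r \<Longrightarrow> norm w < r \<Longrightarrow> G (cnj z) (cnj w) = cnj (G z w)"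
    using pseries2_complexification[OF g] by metis
  have GF: "G z w = F z w" if "norm z < r" "norm w < r" for z w
    by (rule pseries2_unique_value[OF G F that])
  have cnj: "F (- (\<i> * of_real x)) (of_real y) = cnj (F (\<i> * of_real x) (of_real y))"
    if "\<bar>x\<bar> < r" "\<bar>y\<bar> < r" for x y
    using Gcnj[of "\<i> * of_real x" "of_real y"] GF[of "\<i> * of_real x" "of_real y"]
      GF[of "- (\<i> * of_real x)" "of_real y"] that by (simp add: norm_mult)
  show "real_rotation (of_real k) c r F" if even: "\<And>x y. \<bar>x\<bar> < r \<Longrightarrow> \<bar>y\<bar> < r \<Longrightarrow> g (- x) y = g x y"
    unfolding real_rotation_def
  proof (intro conjI F allI impI)
    fix x y :: real assume xy: "\<bar>x\<bar> < r" "\<bar>y\<bar> < r"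
    have "F (- (\<i> * of_real x)) (of_real y) = of_real 1 * F (\<i> * of_real x) (of_real y)"
      using xy even by (intro parity_continuation[OF g F]) (auto simp: norm_mult)
    then have "cnj (F (\<i> * of_real x) (of_real y)) = F (\<i> * of_real x) (of_real y)"
      using cnj[OF xy] by simp
    then have "Im (F (\<i> * of_real x) (of_real y)) = 0" by (simp add: complex_eq_iff)
    then show "Im (of_real k * F (\<i> * of_real x) (of_real y)) = 0" by simp
  qed
  show "real_rotation (- \<i> * of_real k) c r F" if odd: "\<And>x y. \<bar>x\<bar> < r \<Longrightarrow> \<bar>y\<bar> < r \<Longrightarrow> g (- x) y = - g x y"
    unfolding real_rotation_def
  proof (intro conjI F allI impI)
    fix x y :: real assume xy: "\<bar>x\<bar> < r" "\<bar>y\<bar> < r"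
    have "F (- (\<i> * of_real x)) (of_real y) = of_real (- 1) * F (\<i> * of_real x) (of_real y)"
      using xy odd by (intro parity_continuation[OF g F]) (auto simp: norm_mult)
    then have "cnj (F (\<i> * of_real x) (of_real y)) = - F (\<i> * of_real x) (of_real y)"
      using cnj[OF xy] by simp
    then have "Re (F (\<i> * of_real x) (of_real y)) = 0" by (simp add: complex_eq_iff)
    then show "Im (- \<i> * of_real k * F (\<i> * of_real x) (of_real y)) = 0" by simp
  qed
qed

section \<open>Coordinate changes\<close>

lemma abs_one_square: "\<bar>\<sigma>\<bar> = 1 \<Longrightarrow> \<sigma> * \<sigma> = (1::real)"
  by (metis abs_mult_self_eq mult_1)

text \<open>
  Both expansions have the same coefficients up to sign. This reduces the behaviour of differential
  conditions under reflection to their Taylor coefficients, and similarly for the exchange of the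
  variables.
\<close>
lemma analytic_reflect_chart:
  assumes an: "real_analytic2_on g \<Omega>" and \<sigma>: "\<bar>\<sigma>\<bar> = 1" and xy: "(x, \<sigma> * y) \<in> \<Omega>"
  obtains c r where "r > 0" "pseries2 c r (\<lambda>u v. g (x + u) (\<sigma> * y + v))"
    "pseries2 (\<lambda>m n. c m n * \<sigma> ^ n) r (\<lambda>u v. g (x + u) (\<sigma> * (y + v)))"
proof -
  obtain c r where r: "r > 0" and c: "pseries2 c r (\<lambda>u v. g (x + u) (\<sigma> * y + v))"
    using an xy unfolding real_analytic2_on_iff by blast
  with pseries2_reflect[OF c \<sigma>] show ?thesis using that by (simp add: distrib_left)
qed

lemma zmc_reflect:
  assumes an: "real_analytic2_on g \<Omega>" and zmc: "zero_mean_curvature_on g \<Omega>" and \<sigma>: "\<bar>\<sigma>\<bar> = 1"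
  shows "real_analytic2_on (\<lambda>x y. g x (\<sigma> * y)) {(x, y). (x, \<sigma> * y) \<in> \<Omega>}"
    and "zero_mean_curvature_on (\<lambda>x y. g x (\<sigma> * y)) {(x, y). (x, \<sigma> * y) \<in> \<Omega>}"
proof -
  show "real_analytic2_on (\<lambda>x y. g x (\<sigma> * y)) {(x, y). (x, \<sigma> * y) \<in> \<Omega>}"
    unfolding real_analytic2_on_iff
  proof (intro allI impI)
    fix x y assume "(x, y) \<in> {(x, y). (x, \<sigma> * y) \<in> \<Omega>}"
    then have xy: "(x, \<sigma> * y) \<in> \<Omega>" by simp
    obtain c r where "r > 0" "pseries2 c r (\<lambda>u v. g (x + u) (\<sigma> * y + v))"
      and "pseries2 (\<lambda>m n. c m n * \<sigma> ^ n) r (\<lambda>u v. g (x + u) (\<sigma> * (y + v)))"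
      by (rule analytic_reflect_chart[OF an \<sigma> xy])
    then show "\<exists>c r. r > 0 \<and> pseries2 c r (\<lambda>u v. g (x + u) (\<sigma> * (y + v)))"
      by (intro exI[of _ "\<lambda>m n. c m n * \<sigma> ^ n"] exI[of _ r]) simp
  qed
  show "zero_mean_curvature_on (\<lambda>x y. g x (\<sigma> * y)) {(x, y). (x, \<sigma> * y) \<in> \<Omega>}"
    unfolding zero_mean_curvature_on_def
  proof clarify
    fix x y assume xy: "(x, \<sigma> * y) \<in> \<Omega>"
    obtain c r where r: "r > 0" and c: "pseries2 c r (\<lambda>u v. g (x + u) (\<sigma> * y + v))"
      and c': "pseries2 (\<lambda>m n. c m n * \<sigma> ^ n) r (\<lambda>u v. g (x + u) (\<sigma> * (y + v)))"
      by (rule analytic_reflect_chart[OF an \<sigma> xy])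
    note p = pseries2_partials[OF c r] and q = pseries2_partials[where f = "\<lambda>x y. g x (\<sigma> * y)", OF c' r]
    have "(1 - (c 0 1)\<^sup>2) * (2 * c 2 0) + 2 * c 1 0 * c 0 1 * c 1 1 + (1 - (c 1 0)\<^sup>2) * (2 * c 0 2) = 0"
      using zmc xy p unfolding zero_mean_curvature_on_def by fastforce
    then show "(1 - (D2 (\<lambda>x y. g x (\<sigma> * y)) x y)\<^sup>2) * D1 (D1 (\<lambda>x y. g x (\<sigma> * y))) x y
        + 2 * D1 (\<lambda>x y. g x (\<sigma> * y)) x y * D2 (\<lambda>x y. g x (\<sigma> * y)) x y * D2 (D1 (\<lambda>x y. g x (\<sigma> * y))) x y
        + (1 - (D1 (\<lambda>x y. g x (\<sigma> * y)) x y)\<^sup>2) * D2 (D2 (\<lambda>x y. g x (\<sigma> * y))) x y = 0"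
      unfolding q(2-5,7) using abs_one_square[OF \<sigma>]
      by (simp add: power2_eq_square) algebra
  qed
qed

lemma zmc_swap:
  assumes an: "real_analytic2_on g \<Omega>" and zmc: "zero_mean_curvature_on g \<Omega>"
  shows "real_analytic2_on (\<lambda>x y. g y x) {(x, y). (y, x) \<in> \<Omega>}"
    and "zero_mean_curvature_on (\<lambda>x y. g y x) {(x, y). (y, x) \<in> \<Omega>}"
proof -
  have chart: "\<exists>c r. r > 0 \<and> pseries2 c r (\<lambda>u v. g (y + u) (x + v)) \<and>
      pseries2 (\<lambda>m n. c n m) r (\<lambda>u v. g (y + v) (x + u))" if "(y, x) \<in> \<Omega>" for x y
  proof -
    obtain c r where r: "r > 0" and c: "pseries2 c r (\<lambda>u v. g (y + u) (x + v))"
      using an \<open>(y, x) \<in> \<Omega>\<close> unfolding real_analytic2_on_iff by blast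
    from pseries2_swap[OF c] r c show ?thesis by (intro exI[of _ c] exI[of _ r]) simp
  qed
  show "real_analytic2_on (\<lambda>x y. g y x) {(x, y). (y, x) \<in> \<Omega>}"
    unfolding real_analytic2_on_iff
  proof (intro allI impI)
    fix x y assume "(x, y) \<in> {(x, y). (y, x) \<in> \<Omega>}"
    then have "(y, x) \<in> \<Omega>" by simp
    then obtain c r where "r > 0" "pseries2 (\<lambda>m n. c n m) r (\<lambda>u v. g (y + v) (x + u))"
      using chart by metis
    then show "\<exists>c r. r > 0 \<and> pseries2 c r (\<lambda>u v. g (y + v) (x + u))"
      by (intro exI[of _ "\<lambda>m n. c n m"] exI[of _ r]) simp
  qed
  show "zero_mean_curvature_on (\<lambda>x y. g y x) {(x, y). (y, x) \<in> \<Omega>}"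
    unfolding zero_mean_curvature_on_def
  proof clarify
    fix x y assume xy: "(y, x) \<in> \<Omega>"
    obtain c r where r: "r > 0" and c: "pseries2 c r (\<lambda>u v. g (y + u) (x + v))"
      and c': "pseries2 (\<lambda>m n. c n m) r (\<lambda>u v. g (y + v) (x + u))"
      using chart[OF xy] by blast
    note p = pseries2_partials[OF c r] and q = pseries2_partials[where f = "\<lambda>x y. g y x", OF c' r]
    have "(1 - (c 0 1)\<^sup>2) * (2 * c 2 0) + 2 * c 1 0 * c 0 1 * c 1 1 + (1 - (c 1 0)\<^sup>2) * (2 * c 0 2) = 0"
      using zmc xy p unfolding zero_mean_curvature_on_def by fastforce
    then show "(1 - (D2 (\<lambda>x y. g y x) x y)\<^sup>2) * D1 (D1 (\<lambda>x y. g y x)) x y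
        + 2 * D1 (\<lambda>x y. g y x) x y * D2 (\<lambda>x y. g y x) x y * D2 (D1 (\<lambda>x y. g y x)) x y
        + (1 - (D1 (\<lambda>x y. g y x) x y)\<^sup>2) * D2 (D2 (\<lambda>x y. g y x)) x y = 0"
      unfolding q(2-5,7) by algebra
  qed
qed

lemma linear_isometry_reflect:
  assumes "\<bar>\<sigma>\<bar> = 1"
  shows "linear_isometry_L3 (\<lambda>(t, x, y). (t, x, \<sigma> * y))"
  unfolding linear_isometry_L3_def
proof (intro conjI allI)
  show "linear (\<lambda>(t, x, y). (t, x, \<sigma> * y))"
    by (intro linearI) (auto simp: algebra_simps)
  fix p q :: L3
  show "lorentz ((\<lambda>(t, x, y). (t, x, \<sigma> * y)) p) ((\<lambda>(t, x, y). (t, x, \<sigma> * y)) q) = lorentz p q"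
  proof -
    have "\<sigma> * y * (\<sigma> * y') = y * y'" for y y' using abs_one_square[OF assms] by algebra
    then show ?thesis by (cases p; cases q) simp
  qed
qed

lemma linear_isometry_swap: "linear_isometry_L3 (\<lambda>(t, x, y). (t, y, x))"
  unfolding linear_isometry_L3_def
proof (intro conjI allI)
  show "linear (\<lambda>(t, x, y). (t, y, x))" by (intro linearI) auto
  fix p q :: L3
  show "lorentz ((\<lambda>(t, x, y). (t, y, x)) p) ((\<lambda>(t, x, y). (t, y, x)) q) = lorentz p q"
    by (cases p; cases q) simp
qed

lemma open_swap:
  fixes \<Omega> :: "(real \<times> real) set"
  assumes "open \<Omega>"
  shows "open {(x, y). (y, x) \<in> \<Omega>}"
proof -
  have "{(x, y). (y, x) \<in> \<Omega>} = prod.swap -` \<Omega>" by auto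
  also have "open \<dots>"
    using assms by (intro open_vimage) (auto intro!: continuous_intros simp: prod.swap_def)
  finally show ?thesis .
qed

lemma surface_graph_t_swap:
  "(\<lambda>(t, x, y). (t, y, x)) ` surface (graph_t g) \<Omega> =
    surface (graph_t (\<lambda>x y. g y x)) {(x, y). (y, x) \<in> \<Omega>}"
  by (force simp: surface_def graph_t_def image_iff)

lemma lightlike_segment_swap:
  assumes an: "real_analytic2_on g \<Omega>" and seg: "lightlike_segment (graph_t g) \<Omega> L"
  shows "lightlike_segment (graph_t (\<lambda>x y. g y x)) {(x, y). (y, x) \<in> \<Omega>} ((\<lambda>(t, x, y). (t, y, x)) ` L)"
proof -
  define S where "S = (\<lambda>(t, x, y). (t, y, x) :: L3)"
  have lin: "linear S" and iso: "\<And>p q. lorentz (S p) (S q) = lorentz p q" and inv: "\<And>p. S (S p) = p"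
    using linear_isometry_swap by (auto simp: linear_isometry_L3_def S_def)
  define \<Omega>' where "\<Omega>' = {(x, y). (y, x) \<in> \<Omega>}"
  define g' where "g' = (\<lambda>x y. g y x)"
  have "lightlike_segment (graph_t g') \<Omega>' (S ` L)"
    unfolding lightlike_segment_def
  proof (intro conjI)
    obtain p q where pq: "p \<noteq> q" "lorentz (q - p) (q - p) = 0" "L = closed_segment p q"
      using seg unfolding lightlike_segment_def by blast
    have "S p \<noteq> S q" using pq(1) inv by metis
    moreover have "lorentz (S q - S p) (S q - S p) = 0"
      using pq(2) iso[of "q - p" "q - p"] by (simp add: linear_diff[OF lin])
    moreover have "S ` L = closed_segment (S p) (S q)"
      unfolding pq(3) by (rule closed_segment_linear_image[OF lin, symmetric])
    ultimately show "\<exists>p q. p \<noteq> q \<and> lorentz (q - p) (q - p) = 0 \<and> S ` L = closed_segment p q"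
      by blast
    have "L \<subseteq> surface (graph_t g) \<Omega>" using seg by (simp add: lightlike_segment_def)
    then show "S ` L \<subseteq> surface (graph_t g') \<Omega>'"
      unfolding S_def g'_def \<Omega>'_def surface_graph_t_swap[symmetric] by (rule image_mono)
    have "lightlike_at (graph_t g') x y" if xy: "(x, y) \<in> \<Omega>'" "graph_t g' x y \<in> S ` L" for x y
    proof -
      have yx: "(y, x) \<in> \<Omega>" using xy(1) by (simp add: \<Omega>'_def)
      have "S (graph_t g' x y) \<in> S ` S ` L" using xy(2) by (rule imageI)
      then have "graph_t g y x \<in> L" using inv by (simp add: image_image S_def graph_t_def g'_def)
      then have light: "lightlike_at (graph_t g) y x"
        using seg yx unfolding lightlike_segment_def by blast
      obtain c r where r: "r > 0" and c: "pseries2 c r (\<lambda>u v. g (y + u) (x + v))"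
        using an yx unfolding real_analytic2_on_iff by blast
      note p = pseries2_partials(10,11)[OF c r]
      have "(c 0 1)\<^sup>2 + (c 1 0)\<^sup>2 = 1"
        using light lightlike_at_graph_t_iff[where g = g, OF p] by simp
      then show ?thesis
        using lightlike_at_graph_t_iff[where g = g' and x = x and y = y, unfolded g'_def, OF p(2,1)]
        by (simp add: g'_def)
    qed
    then show "\<forall>(x, y)\<in>\<Omega>'. graph_t g' x y \<in> S ` L \<longrightarrow> lightlike_at (graph_t g') x y"
      by blast
  qed
  then show ?thesis by (simp only: S_def g'_def \<Omega>'_def)
qed

text \<open>
  The line of \<^const>\<open>null_ray\<close> or its mirror image, for \<open>\<sigma> = 1\<close> and \<open>\<sigma> = - 1\<close>.
\<close>
definition tilted_ray :: "real \<Rightarrow> real \<Rightarrow> L3" where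
  "tilted_ray \<sigma> r = (r, 0, \<sigma> * r)"

lemma reflect_tilted_ray:
  assumes "\<bar>\<sigma>\<bar> = 1"
  shows "(\<lambda>(t, x, y). (t, x, \<sigma> * y)) ` tilted_ray \<sigma> ` A = null_ray ` A"
  unfolding image_image
  by (rule image_cong) (use abs_one_square[OF assms] in \<open>simp_all add: tilted_ray_def null_ray_def mult.assoc[symmetric]\<close>)

lemma class_along_reflect:
  assumes \<sigma>: "\<bar>\<sigma>\<bar> = 1"
  shows "class_along S (tilted_ray \<sigma> ` A) C \<longleftrightarrow>
    class_along ((\<lambda>(t, x, y). (t, x, \<sigma> * y)) ` S) (null_ray ` A) C"
proof -
  have inv: "(\<lambda>(t, x, y). (t, x, \<sigma> * y)) ((\<lambda>(t, x, y). (t, x, \<sigma> * y)) p) = p" for p :: L3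
    using abs_one_square[OF \<sigma>] by (cases p) (simp add: mult.assoc[symmetric])
  show ?thesis
    using class_along_isometry_iff[OF linear_isometry_reflect[OF \<sigma>] linear_isometry_reflect[OF \<sigma>] inv,
        of S "tilted_ray \<sigma> ` A" C]
    unfolding reflect_tilted_ray[OF \<sigma>] .
qed

text \<open>
  The reflection \<open>y \<mapsto> \<sigma> y\<close> moves the segment onto the standard line.
\<close>
lemma class_along_tilted_graph_t:
  assumes \<Omega>: "open \<Omega>" and an: "real_analytic2_on g \<Omega>" and zmc: "zero_mean_curvature_on g \<Omega>"
    and \<sigma>: "\<bar>\<sigma>\<bar> = 1" and ab: "a \<le> 0" "0 \<le> b" "a < b"
    and seg: "lightlike_segment (graph_t g) \<Omega> (tilted_ray \<sigma> ` {a..b})"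
  obtains c r where "axis_chart (\<lambda>x y. g x (\<sigma> * y)) 0 c r"
    "\<And>x y. \<bar>x\<bar> < r \<Longrightarrow> \<bar>y\<bar> < r \<Longrightarrow> (x, y) \<in> \<Omega>"
    "\<And>C. class_along (surface (graph_t g) \<Omega>) (tilted_ray \<sigma> ` {a..b}) C \<longleftrightarrow>
       class_cond C (2 * c 2 0) (- 2 * c 2 1 - (2 * c 2 0)\<^sup>2)"
proof -
  define G where "G = (\<lambda>x y. g x (\<sigma> * y))"
  define \<Omega>' where "\<Omega>' = {(x, y). (x, \<sigma> * y) \<in> \<Omega>}"
  have \<sigma>2: "\<sigma> * (\<sigma> * y) = y" for y
    using abs_one_square[OF \<sigma>] by (simp add: mult.assoc[symmetric])
  have \<Omega>': "open \<Omega>'"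
  proof -
    have "\<Omega>' = (\<lambda>p. (fst p, \<sigma> * snd p)) -` \<Omega>" by (auto simp: \<Omega>'_def)
    also have "open \<dots>" using \<Omega> by (intro open_vimage) (auto intro!: continuous_intros)
    finally show ?thesis .
  qed
  have an': "real_analytic2_on G \<Omega>'" and zmc': "zero_mean_curvature_on G \<Omega>'"
    unfolding G_def \<Omega>'_def by (rule zmc_reflect[OF an zmc \<sigma>])+
  have surf: "(\<lambda>(t, x, y). (t, x, \<sigma> * y)) ` surface (graph_t g) \<Omega> = surface (graph_t G) \<Omega>'"
  proof (intro equalityI subsetI)
    fix p assume "p \<in> (\<lambda>(t, x, y). (t, x, \<sigma> * y)) ` surface (graph_t g) \<Omega>"
    then obtain x y where "(x, y) \<in> \<Omega>" "p = (g x y, x, \<sigma> * y)"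
      by (auto simp: surface_def graph_t_def)
    then have "p = (case (x, \<sigma> * y) of (u, v) \<Rightarrow> graph_t G u v)" "(x, \<sigma> * y) \<in> \<Omega>'"
      by (simp_all add: G_def \<Omega>'_def graph_t_def \<sigma>2)
    then show "p \<in> surface (graph_t G) \<Omega>'" unfolding surface_def by (rule image_eqI)
  next
    fix p assume "p \<in> surface (graph_t G) \<Omega>'"
    then obtain x y where xy: "(x, \<sigma> * y) \<in> \<Omega>" "p = (g x (\<sigma> * y), x, y)"
      by (auto simp: surface_def graph_t_def G_def \<Omega>'_def)
    then have "graph_t g x (\<sigma> * y) \<in> surface (graph_t g) \<Omega>" unfolding surface_def by force
    moreover have "p = (\<lambda>(t, x, y). (t, x, \<sigma> * y)) (graph_t g x (\<sigma> * y))"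
      by (simp add: xy(2) graph_t_def \<sigma>2)
    ultimately show "p \<in> (\<lambda>(t, x, y). (t, x, \<sigma> * y)) ` surface (graph_t g) \<Omega>" by blast
  qed
  have seg': "lightlike_segment (graph_t G) \<Omega>' (null_ray ` {a..b})"
  proof (rule lightlike_segment_null_rayI[OF ab(3)])
    show "null_ray y \<in> surface (graph_t G) \<Omega>'" if "y \<in> {a..b}" for y
    proof -
      have "tilted_ray \<sigma> ` {a..b} \<subseteq> surface (graph_t g) \<Omega>" using seg by (simp add: lightlike_segment_def)
      then have "null_ray ` {a..b} \<subseteq> surface (graph_t G) \<Omega>'"
        unfolding surf[symmetric] reflect_tilted_ray[OF \<sigma>, symmetric] by (rule image_mono)
      then show ?thesis using that by blast
    qed
    fix x y assume xy: "(x, y) \<in> \<Omega>'" and "graph_t G x y \<in> null_ray ` {a..b}"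
    then have "graph_t g x (\<sigma> * y) \<in> tilted_ray \<sigma> ` {a..b}"
      by (auto simp: graph_t_def G_def null_ray_def tilted_ray_def image_iff)
    moreover have "(x, \<sigma> * y) \<in> \<Omega>" using xy by (simp add: \<Omega>'_def)
    ultimately have light: "lightlike_at (graph_t g) x (\<sigma> * y)"
      using seg unfolding lightlike_segment_def by blast
    obtain c r where r: "r > 0" and c: "pseries2 c r (\<lambda>u v. g (x + u) (\<sigma> * y + v))"
      and c': "pseries2 (\<lambda>m n. c m n * \<sigma> ^ n) r (\<lambda>u v. g (x + u) (\<sigma> * (y + v)))"
      by (rule analytic_reflect_chart[OF an \<sigma> \<open>(x, \<sigma> * y) \<in> \<Omega>\<close>])
    note p = pseries2_partials(10,11)[OF c r]
    have "pseries2 (\<lambda>m n. c m n * \<sigma> ^ n) r (\<lambda>u v. G (x + u) (y + v))"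
      using c' by (simp add: G_def)
    note q = pseries2_partials(10,11)[OF this r]
    have "(c 1 0)\<^sup>2 + (c 0 1)\<^sup>2 = 1"
      using light lightlike_at_graph_t_iff[where g = g, OF p] by simp
    then have "(c 1 0 * \<sigma> ^ 0)\<^sup>2 + (c 0 1 * \<sigma> ^ 1)\<^sup>2 = 1"
      using abs_one_square[OF \<sigma>] by (simp add: power_mult_distrib power2_eq_square[of \<sigma>])
    then show "lightlike_at (graph_t G) x y"
      using lightlike_at_graph_t_iff[where g = G, OF q] by simp
  qed
  have "0 \<in> {a..b}" using ab by simp
  from axis_charts_of_lightlike_segment[OF \<Omega>' an' ab(3) this seg']
  obtain c r where chart: "axis_chart G 0 c r" and box: "{-r<..<r} \<times> {0 - r<..<0 + r} \<subseteq> \<Omega>'"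
    by blast
  have r: "r > 0" and c: "pseries2 c r (\<lambda>u v. G (0 + u) (0 + v))"
    using chart by (simp_all add: axis_chart_def)
  show ?thesis
  proof (rule that)
    show "axis_chart (\<lambda>x y. g x (\<sigma> * y)) 0 c r" using chart by (simp add: G_def)
    show "(x, y) \<in> \<Omega>" if "\<bar>x\<bar> < r" "\<bar>y\<bar> < r" for x y
    proof -
      have "\<bar>\<sigma> * y\<bar> < r" using that \<sigma> by (simp add: abs_mult)
      then have "(x, \<sigma> * y) \<in> {-r<..<r} \<times> {0 - r<..<0 + r}" using that(1) by (simp add: abs_less_iff)
      then have "(x, \<sigma> * y) \<in> \<Omega>'" using box by blast
      then show ?thesis by (simp add: \<Omega>'_def \<sigma>2)
    qed
    show "class_along (surface (graph_t g) \<Omega>) (tilted_ray \<sigma> ` {a..b}) C \<longleftrightarrow>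
       class_cond C (2 * c 2 0) (- 2 * c 2 1 - (2 * c 2 0)\<^sup>2)" for C
      unfolding class_along_reflect[OF \<sigma>] surf class_along_graph_t[OF \<Omega>' an' zmc' ab seg']
      using pseries2_partials(4,8)[OF c r] by simp
  qed
qed

text \<open>
  The reflection \<open>y \<mapsto> \<sigma> y\<close> of \<open>L3\<close> replaces \<open>h\<close> by \<open>\<sigma> h\<close>, which is in canonical position.
\<close>
lemma class_along_tilted_graph_y:
  assumes ch: "axis_chart (\<lambda>x t. H t x) 0 c r"
    and bi: "born_infeld_on H ({-r<..<r} \<times> {-r<..<r})" and \<sigma>: "\<bar>\<sigma>\<bar> = 1"
    and h: "h = (\<lambda>t x. \<sigma> * H t x)"
  obtains L' where "lightlike_segment (graph_y h) ({-r<..<r} \<times> {-r<..<r}) L'" "(0, 0, 0) \<in> L'"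
    "\<And>C. class_along (surface (graph_y h) ({-r<..<r} \<times> {-r<..<r})) L' C \<longleftrightarrow>
       class_cond C (- 2 * c 2 0) (2 * c 2 1 - (2 * c 2 0)\<^sup>2)"
proof -
  define U where "U = {-r<..<r} \<times> {-r<..<r}"
  obtain \<rho> where \<rho>: "0 < \<rho>" "\<rho> < r" and seg: "lightlike_segment (graph_y H) U (null_ray ` {-\<rho>..\<rho>})"
    and cls: "\<And>C. class_along (surface (graph_y H) U) (null_ray ` {-\<rho>..\<rho>}) C \<longleftrightarrow>
       class_cond C (- D2 (D2 H) 0 0) (D1 (D2 (D2 H)) 0 0 - (D2 (D2 H) 0 0)\<^sup>2)"
    using class_along_graph_y[OF ch bi] unfolding U_def by metis
  have r: "r > 0" and c: "pseries2 c r (\<lambda>x t. H t x)"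
    and ax: "\<And>t. \<bar>t\<bar> < r \<Longrightarrow> H t 0 = t" "\<And>t. \<bar>t\<bar> < r \<Longrightarrow> D2 H t 0 = 0"
    using ch by (simp_all add: axis_chart_def D1_def D2_def)
  have c': "pseries2 (\<lambda>m n. c n m) r (\<lambda>u v. H (0 + u) (0 + v))"
    using pseries2_swap[OF c] by simp
  note parts = pseries2_partials(7,9)[OF c' r]
  have surf: "(\<lambda>(t, x, y). (t, x, \<sigma> * y)) ` surface (graph_y h) U = surface (graph_y H) U"
    unfolding surface_def image_image
    by (rule image_cong[OF refl])
      (use abs_one_square[OF \<sigma>] in \<open>auto simp: h graph_y_def mult.assoc[symmetric]\<close>)
  have "lightlike_segment (graph_y h) U (tilted_ray \<sigma> ` {-\<rho>..\<rho>})"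
    unfolding lightlike_segment_def
  proof (intro conjI)
    have lin: "linear (tilted_ray \<sigma>)" unfolding tilted_ray_def by (intro linearI) (auto simp: algebra_simps)
    have "tilted_ray \<sigma> ` {-\<rho>..\<rho>} = closed_segment (tilted_ray \<sigma> (-\<rho>)) (tilted_ray \<sigma> \<rho>)"
      using closed_segment_linear_image[OF lin, of "-\<rho>" \<rho>] \<rho> by (simp add: closed_segment_eq_real_ivl)
    moreover have "tilted_ray \<sigma> (-\<rho>) \<noteq> tilted_ray \<sigma> \<rho>" using \<rho> by (simp add: tilted_ray_def)
    moreover have "lorentz (tilted_ray \<sigma> \<rho> - tilted_ray \<sigma> (-\<rho>)) (tilted_ray \<sigma> \<rho> - tilted_ray \<sigma> (-\<rho>)) = 0"
      using abs_one_square[OF \<sigma>] by (simp add: tilted_ray_def)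
    ultimately show "\<exists>p q. p \<noteq> q \<and> lorentz (q - p) (q - p) = 0 \<and> tilted_ray \<sigma> ` {-\<rho>..\<rho>} = closed_segment p q"
      by blast
    show "tilted_ray \<sigma> ` {-\<rho>..\<rho>} \<subseteq> surface (graph_y h) U"
    proof
      fix p assume "p \<in> tilted_ray \<sigma> ` {-\<rho>..\<rho>}"
      then obtain t where t: "t \<in> {-\<rho>..\<rho>}" "p = tilted_ray \<sigma> t" by blast
      then have "\<bar>t\<bar> < r" using \<rho> by auto
      then have "p = (case (t, 0) of (u, v) \<Rightarrow> graph_y h u v)" "(t, 0) \<in> U"
        using ax(1)[of t] r t(2) by (auto simp: tilted_ray_def graph_y_def h U_def abs_less_iff)
      then show "p \<in> surface (graph_y h) U" unfolding surface_def by (rule image_eqI)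
    qed
    have "lightlike_at (graph_y h) t x"
      if tx: "(t, x) \<in> U" "graph_y h t x \<in> tilted_ray \<sigma> ` {-\<rho>..\<rho>}" for t x
    proof -
      have x: "x = 0" and t: "\<bar>t\<bar> < r" using tx by (auto simp: graph_y_def tilted_ray_def U_def abs_less_iff)
      have z: "\<bar>0\<bar> < r" using r by simp
      have "((\<lambda>s. h s 0) has_real_derivative \<sigma>) (at t)"
      proof (rule has_field_derivative_transform_within_open[where S = "{-r<..<r}"])
        show "((\<lambda>s. \<sigma> * s) has_real_derivative \<sigma>) (at t)" by (auto intro!: derivative_eq_intros)
        show "\<sigma> * s = h s 0" if "s \<in> {-r<..<r}" for s
          using ax(1)[of s] that by (simp add: h abs_less_iff)
      qed (use t in \<open>auto simp: abs_less_iff\<close>)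
      moreover have "((\<lambda>s. h t s) has_real_derivative \<sigma> * 0) (at 0)"
      proof -
        have "((\<lambda>s. H t s) has_real_derivative D2 H t 0) (at 0)"
          using pseries2_deriv1(2)[OF c z t] by (simp add: D1_def D2_def)
        then have "((\<lambda>s. H t s) has_real_derivative 0) (at 0)" using ax(2)[OF t] by simp
        then show ?thesis unfolding h by (rule DERIV_cmult)
      qed
      ultimately show "lightlike_at (graph_y h) t x"
        unfolding x using abs_one_square[OF \<sigma>]
        by (intro lightlike_at_graph_y[where a = \<sigma>]) (simp_all add: power2_eq_square)
    qed
    then show "\<forall>(t, x)\<in>U. graph_y h t x \<in> tilted_ray \<sigma> ` {-\<rho>..\<rho>} \<longrightarrow> lightlike_at (graph_y h) t x"
      by blast
  qed
  moreover have "(0, 0, 0) \<in> tilted_ray \<sigma> ` {-\<rho>..\<rho>}"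
    using \<rho> by (force simp: tilted_ray_def)
  moreover have "class_along (surface (graph_y h) U) (tilted_ray \<sigma> ` {-\<rho>..\<rho>}) C \<longleftrightarrow>
      class_cond C (- 2 * c 2 0) (2 * c 2 1 - (2 * c 2 0)\<^sup>2)" for C
    unfolding class_along_reflect[OF \<sigma>] surf cls using parts by simp
  ultimately show ?thesis using that unfolding U_def by blast
qed

section \<open>The direction of the segment\<close>

text \<open>
  A null vector has nonzero time component, so time parametrizes the segment; the origin splits the
  parameter interval into a nonpositive and a nonnegative part.
\<close>
lemma null_segment_through_origin:
  fixes p q :: L3
  assumes pq: "p \<noteq> q" and null: "lorentz (q - p) (q - p) = 0" and z: "(0, 0, 0) \<in> closed_segment p q"
  obtains a b d1 d2 where "a \<le> 0" "0 \<le> b" "a < b" "d1\<^sup>2 + d2\<^sup>2 = 1"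
    "closed_segment p q = (\<lambda>r. (r, r * d1, r * d2)) ` {a..b}"
proof -
  obtain v0 v1 v2 where v: "q - p = (v0, v1, v2)" by (metis prod_cases3)
  obtain u where u: "0 \<le> u" "u \<le> 1" and uz: "(0, 0, 0) = (1 - u) *\<^sub>R p + u *\<^sub>R q"
    using z unfolding in_segment by blast
  have n: "v0 * v0 = v1 * v1 + v2 * v2" using null by (simp add: v)
  have v00: "v0 \<noteq> 0"
  proof
    assume "v0 = 0"
    then have "v1 = 0" "v2 = 0" using n by (simp_all add: sum_squares_eq_zero_iff)
    with \<open>v0 = 0\<close> have "q - p = 0" by (simp add: v zero_prod_def)
    then show False using pq by simp
  qed
  \<comment> \<open>the direction with time component 1\<close>
  define d where "d = (1::real, v1 / v0, v2 / v0)"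
  have vd: "q - p = v0 *\<^sub>R d" using v00 by (simp add: v d_def)
  have p: "p = (- u * v0) *\<^sub>R d"
  proof -
    have "p + u *\<^sub>R (q - p) = 0" using uz by (simp add: algebra_simps zero_prod_def)
    then show ?thesis unfolding vd by (simp add: eq_neg_iff_add_eq_0)
  qed
  have q: "q = ((1 - u) * v0) *\<^sub>R d"
  proof -
    have "q = p + v0 *\<^sub>R d" using vd by (simp add: algebra_simps)
    then show ?thesis using p by (simp add: algebra_simps)
  qed
  define a where "a = min (- u * v0) ((1 - u) * v0)"
  define b where "b = max (- u * v0) ((1 - u) * v0)"
  have diff: "(1 - u) * v0 - (- u * v0) = v0" by (simp add: algebra_simps)
  have lin: "linear (\<lambda>r. r *\<^sub>R d)" by (intro linearI) (simp_all add: algebra_simps)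
  have "closed_segment p q = (\<lambda>r. r *\<^sub>R d) ` closed_segment (- u * v0) ((1 - u) * v0)"
    using closed_segment_linear_image[OF lin, of "- u * v0" "(1 - u) * v0"] p q by simp
  also have "closed_segment (- u * v0) ((1 - u) * v0) = {a..b}"
    by (simp add: closed_segment_eq_real_ivl a_def b_def min_def max_def)
  also have "(\<lambda>r. r *\<^sub>R d) = (\<lambda>r. (r, r * (v1 / v0), r * (v2 / v0)))"
    by (simp add: d_def)
  finally have seg: "closed_segment p q = (\<lambda>r. (r, r * (v1 / v0), r * (v2 / v0))) ` {a..b}" .
  have ab: "a < b" using diff v00 by (auto simp: a_def b_def min_def max_def)
  have sgn: "a \<le> 0 \<and> 0 \<le> b"
  proof (cases "v0 > 0")
    case True
    then have "- u * v0 \<le> 0" "0 \<le> (1 - u) * v0" using u by simp_all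
    then show ?thesis by (auto simp: a_def b_def min_def max_def)
  next
    case False
    then have "0 \<le> - u * v0" "(1 - u) * v0 \<le> 0" using u by (simp_all add: mult_nonneg_nonpos)
    then show ?thesis by (auto simp: a_def b_def min_def max_def)
  qed
  have "(v1 / v0)\<^sup>2 + (v2 / v0)\<^sup>2 = 1"
  proof -
    have "(v1 * v1 + v2 * v2) / (v0 * v0) = 1" using n v00 by (metis divide_self mult_eq_0_iff)
    then show ?thesis
      unfolding power_divide unfolding power2_eq_square add_divide_distrib .
  qed
  with sgn ab seg show ?thesis using that by blast
qed

lemma pseries2_ray:
  fixes f :: "real \<Rightarrow> real \<Rightarrow> real"
  assumes f: "pseries2 c r f" and r: "r > 0" and d: "\<bar>d1\<bar> \<le> 1" "\<bar>d2\<bar> \<le> 1"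
  shows "((\<lambda>s. (f (s * d1) (s * d2) - c 0 0) / s) \<longlongrightarrow> c 1 0 * d1 + c 0 1 * d2) (at 0)"
proof -
  obtain f1 where f1: "pseries2 (\<lambda>m. c (Suc m)) r f1"
    "\<And>x y. \<bar>x\<bar> < r \<Longrightarrow> \<bar>y\<bar> < r \<Longrightarrow> f x y = f 0 y + x * f1 x y"
    using pseries2_shift[OF f] by metis
  obtain f2 where f2: "pseries2 (\<lambda>m. c (Suc (Suc m))) r f2"
    "\<And>x y. \<bar>x\<bar> < r \<Longrightarrow> \<bar>y\<bar> < r \<Longrightarrow> f1 x y = f1 0 y + x * f2 x y"
    using pseries2_shift[OF f1(1)] by metis
  have half: "0 \<le> r / 2" "r / 2 < r" using r by simp_all
  obtain M where M0: "0 \<le> M" and M: "\<And>x y. \<bar>x\<bar> \<le> r / 2 \<Longrightarrow> \<bar>y\<bar> \<le> r / 2 \<Longrightarrow> \<bar>f2 x y\<bar> \<le> M"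
    using pseries2_bounded_real[OF f2(1) half] by metis
  have z: "\<bar>0\<bar> < r" using r by simp
  have small: "\<bar>s * e\<bar> \<le> \<bar>s\<bar>" if "\<bar>e\<bar> \<le> 1" for s e :: real
    using mult_left_mono[OF that, of "\<bar>s\<bar>"] by (simp add: abs_mult)
  have D20: "D2 f 0 0 = c 0 1"
    using pseries2_at_0[OF pseries2_deriv2(1)[OF f] r] by (simp add: dcoeff2_def)
  have "((\<lambda>s. f 0 s) has_real_derivative c 0 1) (at (0 * d2))"
    using pseries2_deriv2(2)[OF f z z] D20 by simp
  moreover have "((\<lambda>s. s * d2) has_real_derivative d2) (at 0)"
    by (auto intro!: derivative_eq_intros)
  ultimately have "((\<lambda>s. f 0 (s * d2)) has_real_derivative c 0 1 * d2) (at 0)"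
    by (rule DERIV_chain2)
  then have l1: "((\<lambda>s. (f 0 (s * d2) - c 0 0) / s) \<longlongrightarrow> c 0 1 * d2) (at 0)"
    using pseries2_at_0[OF f r] by (simp add: DERIV_def)
  have "isCont (f1 0) 0"
    using DERIV_isCont[OF pseries2_deriv2(2)[OF f1(1) z z]] .
  moreover have "((\<lambda>s. s * d2) \<longlongrightarrow> 0) (at 0)"
    using tendsto_mult_left_zero[OF tendsto_ident_at, of d2] by simp
  ultimately have l2: "((\<lambda>s. f1 0 (s * d2)) \<longlongrightarrow> c 1 0) (at 0)"
    using isCont_tendsto_compose[of 0 "f1 0" "\<lambda>s. s * d2" "at 0"] pseries2_at_0[OF f1(1) r] by simp
  have l3: "((\<lambda>s. s * d1 * f2 (s * d1) (s * d2)) \<longlongrightarrow> 0) (at 0)"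
  proof (rule Lim_null_comparison)
    have "\<forall>\<^sub>F s in at 0. s \<in> {-(r/2)<..<r/2}"
      using r by (intro eventually_at_0_punctured(1)) simp
    then show "\<forall>\<^sub>F s in at 0. norm (s * d1 * f2 (s * d1) (s * d2)) \<le> \<bar>s\<bar> * M"
    proof eventually_elim
      case (elim s)
      then have "\<bar>s\<bar> \<le> r / 2" by (auto simp: abs_le_iff)
      then have "\<bar>f2 (s * d1) (s * d2)\<bar> \<le> M"
        using small[OF d(1), of s] small[OF d(2), of s] by (intro M) auto
      then show ?case
        unfolding real_norm_def abs_mult[of "s * d1"] using small[OF d(1), of s] M0 by (intro mult_mono) auto
    qed
    show "((\<lambda>s. \<bar>s\<bar> * M) \<longlongrightarrow> 0) (at 0)"
      by (intro tendsto_mult_left_zero tendsto_rabs_zero tendsto_ident_at)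
  qed
  have "((\<lambda>s. (f 0 (s * d2) - c 0 0) / s + d1 * (f1 0 (s * d2) + s * d1 * f2 (s * d1) (s * d2))) \<longlongrightarrow>
      c 0 1 * d2 + d1 * (c 1 0 + 0)) (at 0)"
    by (intro tendsto_intros l1 l2 l3)
  moreover from eventually_at_0_punctured[OF r]
  have "\<forall>\<^sub>F s in at 0. (f 0 (s * d2) - c 0 0) / s + d1 * (f1 0 (s * d2) + s * d1 * f2 (s * d1) (s * d2)) =
      (f (s * d1) (s * d2) - c 0 0) / s"
  proof eventually_elim
    case (elim s)
    then have "\<bar>s * d1\<bar> < r" "\<bar>s * d2\<bar> < r"
      using small[OF d(1), of s] small[OF d(2), of s] by (auto simp: abs_less_iff)
    note sd = this
    have "f (s * d1) (s * d2) = f 0 (s * d2) + s * d1 * (f1 0 (s * d2) + s * d1 * f2 (s * d1) (s * d2))"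
      unfolding f1(2)[OF sd] f2(2)[OF sd] ..
    then show ?case using elim(2) by (simp add: field_simps)
  qed
  ultimately have lim: "((\<lambda>s. (f (s * d1) (s * d2) - c 0 0) / s) \<longlongrightarrow> c 0 1 * d2 + d1 * (c 1 0 + 0)) (at 0)"
    by (rule Lim_transform_eventually)
  have "c 0 1 * d2 + d1 * (c 1 0 + 0) = c 1 0 * d1 + c 0 1 * d2" by simp
  with lim show ?thesis by metis
qed

text \<open>
  Along the segment \<open>g\<close> equals the time parameter. The origin may be an endpoint, hence the one-sided
  limit.
\<close>
lemma segment_gradient:
  fixes g :: "real \<Rightarrow> real \<Rightarrow> real"
  assumes c: "pseries2 c r g" and r: "r > 0" and ab: "a \<le> 0" "0 \<le> b" "a < b" and d: "d1\<^sup>2 + d2\<^sup>2 = 1"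
    and on: "(\<lambda>r. (r, r * d1, r * d2)) ` {a..b} \<subseteq> surface (graph_t g) \<Omega>"
  shows "c 0 0 = 0" "c 1 0 * d1 + c 0 1 * d2 = 1"
proof -
  have val: "g (s * d1) (s * d2) = s" if "s \<in> {a..b}" for s
  proof -
    have "(s, s * d1, s * d2) \<in> surface (graph_t g) \<Omega>" using on that by blast
    then show ?thesis by (auto simp: surface_def graph_t_def)
  qed
  show c0: "c 0 0 = 0" using pseries2_at_0[OF c r] val[of 0] ab by simp
  have "d1\<^sup>2 \<le> 1" "d2\<^sup>2 \<le> 1" using d zero_le_power2[of d1] zero_le_power2[of d2] by linarith+
  then have d': "\<bar>d1\<bar> \<le> 1" "\<bar>d2\<bar> \<le> 1" by (simp_all add: abs_square_le_1)
  have "((\<lambda>s. (g (s * d1) (s * d2) - c 0 0) / s) \<longlongrightarrow> c 1 0 * d1 + c 0 1 * d2) (at 0 within {a..b})"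
    using pseries2_ray[OF c r d'] by (rule tendsto_within_subset) simp
  moreover have "((\<lambda>s. (g (s * d1) (s * d2) - c 0 0) / s) \<longlongrightarrow> 1) (at 0 within {a..b})"
  proof (rule tendsto_eventually)
    show "\<forall>\<^sub>F s in at 0 within {a..b}. (g (s * d1) (s * d2) - c 0 0) / s = 1"
      unfolding eventually_at_filter by (rule always_eventually) (simp add: val c0)
  qed
  moreover have "at 0 within {a..b} \<noteq> bot"
    using ab by (simp add: trivial_limit_within islimpt_Icc)
  ultimately show "c 1 0 * d1 + c 0 1 * d2 = 1" using tendsto_unique by blast
qed

text \<open>
  The gradient at the origin is a unit vector because the point is lightlike, and it has product 1
  with the unit direction of the segment. Symmetry kills one of its components and thereby
  determines the direction of the segment.
\<close>
lemma gradient_at_origin: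
  fixes g :: "real \<Rightarrow> real \<Rightarrow> real"
  assumes \<Omega>: "open \<Omega>" "(0, 0) \<in> \<Omega>" and an: "real_analytic2_on g \<Omega>"
    and seg: "lightlike_segment (graph_t g) \<Omega> L" "(0, 0, 0) \<in> L"
  obtains a b d1 d2 c r where "a \<le> 0" "0 \<le> b" "a < b" "L = (\<lambda>r. (r, r * d1, r * d2)) ` {a..b}"
    "d1\<^sup>2 + d2\<^sup>2 = 1" "c 1 0 * d1 + c 0 1 * d2 = 1" "(c 1 0)\<^sup>2 + (c 0 1)\<^sup>2 = 1" "r > 0" "pseries2 c r g"
    "\<And>x y. \<bar>x\<bar> < r \<Longrightarrow> \<bar>y\<bar> < r \<Longrightarrow> (x, y) \<in> \<Omega>"
proof -
  obtain p q where pq: "p \<noteq> q" "lorentz (q - p) (q - p) = 0" "L = closed_segment p q"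
    using seg(1) unfolding lightlike_segment_def by blast
  have z: "(0, 0, 0) \<in> closed_segment p q" using seg(2) pq(3) by simp
  obtain a b d1 d2 where ab: "a \<le> 0" "0 \<le> b" "a < b" and d: "d1\<^sup>2 + d2\<^sup>2 = 1"
    and L': "closed_segment p q = (\<lambda>r. (r, r * d1, r * d2)) ` {a..b}"
    by (rule null_segment_through_origin[OF pq(1,2) z])
  have L: "L = (\<lambda>r. (r, r * d1, r * d2)) ` {a..b}" using L' pq(3) by simp
  obtain c r1 where r1: "r1 > 0" and c1: "pseries2 c r1 (\<lambda>u v. g (0 + u) (0 + v))"
    using an \<Omega>(2) unfolding real_analytic2_on_iff by blast
  obtain r2 where r2: "r2 > 0" "ball (0, 0) r2 \<subseteq> \<Omega>"
    using \<Omega> open_contains_ball by blast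
  define r where "r = min r1 (r2 / 2)"
  have r: "r > 0" "r \<le> r1" "r \<le> r2 / 2" using r1 r2 by (auto simp: r_def)
  have c: "pseries2 c r g" using pseries2_mono[OF c1 r(2)] by simp
  have box: "(x, y) \<in> \<Omega>" if "\<bar>x\<bar> < r" "\<bar>y\<bar> < r" for x y
  proof -
    have "dist (0, 0) (x, y) \<le> \<bar>0 - x\<bar> + \<bar>0 - y\<bar>"
      unfolding dist_Pair_Pair dist_real_def power2_abs by (rule sqrt_sum_squares_le_sum_abs)
    also have "\<dots> < r2" using that r(3) by simp
    finally show ?thesis using r2(2) by auto
  qed
  have on: "(\<lambda>r. (r, r * d1, r * d2)) ` {a..b} \<subseteq> surface (graph_t g) \<Omega>"
    using seg(1) unfolding lightlike_segment_def L by blast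
  have g0: "c 0 0 = 0" and dir: "c 1 0 * d1 + c 0 1 * d2 = 1"
    by (rule segment_gradient[OF c r(1) ab d on])+
  have "graph_t g 0 0 = (0, 0, 0)" using pseries2_at_0[OF c r(1)] g0 by (simp add: graph_t_def)
  then have light: "lightlike_at (graph_t g) 0 0"
    using seg \<Omega>(2) unfolding lightlike_segment_def by fastforce
  have c00: "pseries2 c r (\<lambda>u v. g (0 + u) (0 + v))" using c by simp
  have grad: "(c 1 0)\<^sup>2 + (c 0 1)\<^sup>2 = 1"
    using light lightlike_at_graph_t_iff[where g = g, OF pseries2_partials(10,11)[OF c00 r(1)]] by simp
  show ?thesis by (rule that[OF ab L d dir grad r(1) c box])
qed

section \<open>The two Wick rotations\<close>

text \<open>
  The gradient is \<open>(0, \<sigma>)\<close> and \<open>L\<close> is the line \<open>t = \<sigma> y\<close>. Rotating \<open>x\<close> changes the sign of the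
  coefficients \<open>c 2 n\<close>; this is compensated by the sign in \<open>\<alpha> = - H_xx(\<cdot>, 0)\<close>, up to a factor \<open>\<sigma>\<close> that
  does not affect \<open>\<alpha>(0)^2\<close>.
\<close>
lemma wick_rotation_even:
  fixes g :: "real \<Rightarrow> real \<Rightarrow> real"
  assumes \<Omega>: "open \<Omega>" "(0, 0) \<in> \<Omega>" and an: "real_analytic2_on g \<Omega>"
    and zmc: "zero_mean_curvature_on g \<Omega>"
    and seg: "lightlike_segment (graph_t g) \<Omega> L" "(0, 0, 0) \<in> L"
    and even: "\<forall>(x, y)\<in>\<Omega>. g (- x) y = g x y"
  shows "\<exists>U h L'. open U \<and> connected U \<and> (0, 0) \<in> U \<and>
      (\<forall>(t, x)\<in>U. (0, t) \<in> \<Omega> \<and> summable (wick_term g x t) \<and> complex_of_real (h t x) = wick g x t) \<and>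
      real_analytic2_on h U \<and> born_infeld_on h U \<and>
      lightlike_segment (graph_y h) U L' \<and> (0, 0, 0) \<in> L' \<and>
      (\<exists>C. class_along (surface (graph_t g) \<Omega>) L C) \<and>
      (\<forall>C. class_along (surface (graph_t g) \<Omega>) L C \<longleftrightarrow> class_along (surface (graph_y h) U) L' C)"
proof -
  obtain a b d1 d2 c0 r0 where ab: "a \<le> 0" "0 \<le> b" "a < b" and L: "L = (\<lambda>r. (r, r * d1, r * d2)) ` {a..b}"
    and d: "d1\<^sup>2 + d2\<^sup>2 = 1" and dir: "c0 1 0 * d1 + c0 0 1 * d2 = 1" and grad: "(c0 1 0)\<^sup>2 + (c0 0 1)\<^sup>2 = 1"
    and r0: "r0 > 0" and c0: "pseries2 c0 r0 g" and box0: "\<And>x y. \<bar>x\<bar> < r0 \<Longrightarrow> \<bar>y\<bar> < r0 \<Longrightarrow> (x, y) \<in> \<Omega>"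
    by (rule gradient_at_origin[OF \<Omega> an seg]) (rule that; assumption)
  \<comment> \<open>reflecting \<open>x\<close> changes the sign of this coefficient\<close>
  have c10: "c0 1 0 = 0"
  proof -
    have "pseries2 (\<lambda>m n. 1 * (c0 m n * (- 1) ^ m * 1 ^ n)) r0 (\<lambda>x y. 1 * g (- 1 * x) (1 * y))"
      by (rule pseries2_scale[OF c0]) auto
    then have "pseries2 (\<lambda>m n. 1 * (c0 m n * (- 1) ^ m * 1 ^ n)) r0 g"
      by (rule pseries2_cong) (use even box0 in fastforce)
    from pseries2_partials(2)[where f = g and x = 0 and y = 0, OF _ r0, of "\<lambda>m n. 1 * (c0 m n * (- 1) ^ m * 1 ^ n)"] this
      pseries2_partials(2)[where f = g and x = 0 and y = 0, OF _ r0, of c0] c0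
    show ?thesis by simp
  qed
  define \<sigma> where "\<sigma> = c0 0 1"
  have \<sigma>: "\<bar>\<sigma>\<bar> = 1" 
  proof -
    have "\<sigma>\<^sup>2 = 1" using grad c10 by (simp add: \<sigma>_def)
    then show ?thesis by (auto simp: power2_eq_1_iff)
  qed
  have "\<sigma> * d2 = 1" using dir c10 by (simp add: \<sigma>_def)
  then have "d2 = \<sigma>" using abs_one_square[OF \<sigma>] by algebra
  moreover from this have "d1 = 0" using d abs_one_square[OF \<sigma>] by (simp add: power2_eq_square)
  ultimately have L: "L = tilted_ray \<sigma> ` {a..b}"
    unfolding L by (simp add: tilted_ray_def mult.commute)
  obtain cG r where chart: "axis_chart (\<lambda>x y. g x (\<sigma> * y)) 0 cG r"
    and box: "\<And>x y. \<bar>x\<bar> < r \<Longrightarrow> \<bar>y\<bar> < r \<Longrightarrow> (x, y) \<in> \<Omega>"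
    and cls_tilted: "\<And>C. class_along (surface (graph_t g) \<Omega>) (tilted_ray \<sigma> ` {a..b}) C \<longleftrightarrow>
       class_cond C (2 * cG 2 0) (- 2 * cG 2 1 - (2 * cG 2 0)\<^sup>2)"
    by (rule class_along_tilted_graph_t[OF \<Omega>(1) an zmc \<sigma> ab seg(1)[unfolded L]]) (rule that; assumption)
  note cls = cls_tilted[folded L]
  have \<sigma>2: "\<sigma> * (\<sigma> * y) = y" for y
    using abs_one_square[OF \<sigma>] by (simp add: mult.assoc[symmetric])
  have r: "r > 0" and cG: "pseries2 cG r (\<lambda>x y. g x (\<sigma> * y))"
    and ax: "\<And>v. \<bar>v\<bar> < r \<Longrightarrow> g 0 (\<sigma> * v) = v" "\<And>v. \<bar>v\<bar> < r \<Longrightarrow> D1 g 0 (\<sigma> * v) = 0"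
    using chart by (simp_all add: axis_chart_def D1_def)
  define c where "c = (\<lambda>m n. cG m n * \<sigma> ^ n)"
  have c: "pseries2 c r g" using pseries2_reflect[OF cG \<sigma>] by (simp add: c_def \<sigma>2)
  obtain F where F: "pseries2 (\<lambda>m n. complex_of_real (c m n)) r F"
    using pseries2_complexification[OF c] by metis
  have even': "\<And>x y. \<bar>x\<bar> < r \<Longrightarrow> \<bar>y\<bar> < r \<Longrightarrow> g (- x) y = g x y" using even box by blast
  note rot = even_odd_real_rotation(1)[OF c F even']
  have zmc_box: "zero_mean_curvature_on g ({-r<..<r} \<times> {-r<..<r})"
  proof -
    have "{-r<..<r} \<times> {-r<..<r} \<subseteq> \<Omega>" using box by (auto simp: abs_less_iff)
    then show ?thesis using zmc unfolding zero_mean_curvature_on_def by blast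
  qed
  note zmcC = complex_zero_mean_curvature[OF c F zmc_box]
  define U where "U = {-r<..<r} \<times> {-r<..<r}"
  define h where "h = (\<lambda>t x. rotated (of_real 1) F x t)"
  define H where "H = (\<lambda>t x. rotated (of_real \<sigma>) F x t)"
  have hH: "h = (\<lambda>t x. \<sigma> * H t x)" by (simp add: h_def H_def rotated_def \<sigma>2)
  have bi: "born_infeld_on (\<lambda>t x. rotated (of_real k) F x t) U" if "\<bar>k\<bar> = 1" for k
    unfolding U_def
  proof (rule born_infeld_on_swap[OF pseries2_rotated[OF F]])
    have "(complex_of_real k)\<^sup>2 = 1"
      using abs_one_square[OF that] by (simp add: power2_eq_square flip: of_real_mult)
    from rotated_pde_square_one[OF rot this _ _ zmcC]
    show "(1 - (D2 (rotated (of_real k) F) x t)\<^sup>2) * D1 (D1 (rotated (of_real k) F)) x t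
        + 2 * D2 (rotated (of_real k) F) x t * D1 (rotated (of_real k) F) x t * D2 (D1 (rotated (of_real k) F)) x t
        - (1 + (D1 (rotated (of_real k) F) x t)\<^sup>2) * D2 (D2 (rotated (of_real k) F)) x t = 0"
      if "\<bar>x\<bar> < r" "\<bar>t\<bar> < r" for x t using that by simp
  qed
  have K: "pseries2 (rotated_coeff (of_real \<sigma>) c) r (\<lambda>x t. H t x)"
    unfolding H_def by (rule pseries2_rotated[OF F])
  have chartH: "axis_chart (\<lambda>x t. H t x) 0 (rotated_coeff (of_real \<sigma>) c) r"
    unfolding axis_chart_def
  proof (intro conjI r allI impI)
    show "pseries2 (rotated_coeff (of_real \<sigma>) c) r (\<lambda>u v. H (0 + v) u)" using K by simp
    fix v :: real assume v: "\<bar>v\<bar> < r"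
    have \<sigma>v: "\<bar>\<sigma> * v\<bar> < r" using v \<sigma> by (simp add: abs_mult)
    have 0: "\<bar>0\<bar> < r" using r by simp
    have "F (of_real 0) (of_real v) = of_real (g 0 v)"
      by (rule pseries2_complexification_value[OF F c 0 v])
    moreover have "g 0 v = \<sigma> * v" using ax(1)[OF \<sigma>v] by (simp add: \<sigma>2)
    ultimately show "H (0 + v) 0 = 0 + v" by (simp add: H_def rotated_def \<sigma>2)
    have "CD1 F (of_real 0) (of_real v) = of_real (D1 g 0 v)"
      by (rule pseries2_complexification_value[OF pseries2_CD1[OF F] pseries2_deriv1(1)[OF c] 0 v])
    moreover have "D1 g 0 v = 0" using ax(2)[OF \<sigma>v] by (simp add: \<sigma>2)
    ultimately have "rotated (of_real \<sigma> * \<i>) (CD1 F) 0 v = 0" by (simp add: rotated_def)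
    then show "D1 (\<lambda>x t. H t x) 0 (0 + v) = 0"
      using D1_rotated[OF F 0 v, of "of_real \<sigma>"] by (simp add: H_def)
  qed
  have biH: "born_infeld_on H ({-r<..<r} \<times> {-r<..<r})"
    using bi[OF \<sigma>] by (simp add: H_def U_def)
  obtain L' where L': "lightlike_segment (graph_y h) U L'" "(0, 0, 0) \<in> L'"
    and cls': "\<And>C. class_along (surface (graph_y h) U) L' C \<longleftrightarrow>
       class_cond C (- 2 * rotated_coeff (of_real \<sigma>) c 2 0)
         (2 * rotated_coeff (of_real \<sigma>) c 2 1 - (2 * rotated_coeff (of_real \<sigma>) c 2 0)\<^sup>2)"
    by (rule class_along_tilted_graph_y[OF chartH biH \<sigma> hH, folded U_def]) (rule that; assumption)
  have coeffs: "rotated_coeff (of_real \<sigma>) c 2 0 = - (\<sigma> * cG 2 0)" "rotated_coeff (of_real \<sigma>) c 2 1 = - cG 2 1"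
    using abs_one_square[OF \<sigma>] by (simp_all add: rotated_coeff_def c_def)
  have same: "class_along (surface (graph_t g) \<Omega>) L C \<longleftrightarrow> class_along (surface (graph_y h) U) L' C" for C
  proof -
    have eq: "2 * - cG 2 1 - (2 * - (\<sigma> * cG 2 0))\<^sup>2 = - 2 * cG 2 1 - (2 * cG 2 0)\<^sup>2"
      using abs_one_square[OF \<sigma>] by algebra
    show ?thesis
      unfolding cls cls' coeffs eq
      by (rule class_cond_sign) (use abs_one_square[OF \<sigma>] in algebra)
  qed
  have wick: "(0, t) \<in> \<Omega> \<and> summable (wick_term g x t) \<and> complex_of_real (h t x) = wick g x t" if "(t, x) \<in> U" for t x
  proof -
    have tx: "\<bar>x\<bar> < r" "\<bar>t\<bar> < r" using that by (auto simp: U_def abs_less_iff)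
    have "of_real 1 * F (\<i> * of_real x) (of_real t) = complex_of_real (h t x)"
      unfolding h_def by (rule real_rotation_value[OF rot tx])
    then show ?thesis using wick_eq[OF c F tx] box[of 0 t] tx r by simp
  qed
  have U: "open U" "connected U" "(0, 0) \<in> U"
    using r by (auto simp: U_def intro!: open_Times connected_Times)
  have wickU: "\<forall>(t, x)\<in>U. (0, t) \<in> \<Omega> \<and> summable (wick_term g x t) \<and> complex_of_real (h t x) = wick g x t"
    using wick by blast
  have anh: "real_analytic2_on h U"
    unfolding U_def h_def by (rule pseries2_imp_real_analytic2_on[OF pseries2_swap[OF pseries2_rotated[OF F]]])
  have bih: "born_infeld_on h U" unfolding h_def by (rule bi) simp
  have ex: "\<exists>C. class_along (surface (graph_t g) \<Omega>) L C"
    unfolding cls by (rule class_cond_exhaustive)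
  have same': "\<forall>C. class_along (surface (graph_t g) \<Omega>) L C \<longleftrightarrow> class_along (surface (graph_y h) U) L' C"
    using same by (rule allI)
  show ?thesis
    by (intro exI[of _ U] exI[of _ h] exI[of _ L'] conjI) (fact U wickU anh bih L' ex same')+
qed

text \<open>
  Now \<open>g\<close> vanishes for \<open>x = 0\<close>, the gradient is \<open>(\<sigma>, 0)\<close> and \<open>L\<close> is the line \<open>t = \<sigma> x\<close>; exchanging \<open>x\<close> and
  \<open>y\<close> brings it to standard position. The approximation function consists of the coefficients
  \<open>c n 2\<close>, which vanish for even \<open>n\<close>. The first two are therefore \<open>0\<close> and \<open>c 1 2\<close>, and the
  characteristic is \<open>- 2 \<sigma> c 1 2\<close>. Under the rotation of \<open>x\<close> the coefficient \<open>c 1 2\<close> stays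
  the same, while \<open>\<alpha> = - H_xx(\<cdot>, 0)\<close> introduces a sign.
\<close>
lemma wick_rotation_odd:
  fixes g :: "real \<Rightarrow> real \<Rightarrow> real"
  assumes \<Omega>: "open \<Omega>" "(0, 0) \<in> \<Omega>" and an: "real_analytic2_on g \<Omega>"
    and zmc: "zero_mean_curvature_on g \<Omega>"
    and seg: "lightlike_segment (graph_t g) \<Omega> L" "(0, 0, 0) \<in> L"
    and odd: "\<forall>(x, y)\<in>\<Omega>. g (- x) y = - g x y"
  shows "\<exists>U h L' \<mu>. open U \<and> connected U \<and> (0, 0) \<in> U \<and>
      (\<forall>(t, x)\<in>U. (0, x) \<in> \<Omega> \<and> summable (wick_term g t x) \<and> complex_of_real (h t x) = - \<i> * wick g t x) \<and>
      real_analytic2_on h U \<and> born_infeld_on h U \<and>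
      lightlike_segment (graph_y h) U L' \<and> (0, 0, 0) \<in> L' \<and>
      (\<forall>C. class_along (surface (graph_t g) \<Omega>) L C \<longleftrightarrow> class_cond C 0 \<mu>) \<and>
      (\<forall>C. class_along (surface (graph_y h) U) L' C \<longleftrightarrow> class_cond C 0 (- \<mu>))"
proof -
  obtain a b d1 d2 c0 r0 where ab: "a \<le> 0" "0 \<le> b" "a < b" and L: "L = (\<lambda>r. (r, r * d1, r * d2)) ` {a..b}"
    and d: "d1\<^sup>2 + d2\<^sup>2 = 1" and dir: "c0 1 0 * d1 + c0 0 1 * d2 = 1" and grad: "(c0 1 0)\<^sup>2 + (c0 0 1)\<^sup>2 = 1"
    and r0: "r0 > 0" and c0: "pseries2 c0 r0 g" and box0: "\<And>x y. \<bar>x\<bar> < r0 \<Longrightarrow> \<bar>y\<bar> < r0 \<Longrightarrow> (x, y) \<in> \<Omega>"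
    by (rule gradient_at_origin[OF \<Omega> an seg]) (rule that; assumption)
  have g0: "g 0 y = 0" if "(0, y) \<in> \<Omega>" for y using odd that by fastforce
  have c01: "c0 0 1 = 0"
    using pseries2_affine_axis(2)[OF c0 r0, of 0 0] g0 box0 r0 by simp
  define \<sigma> where "\<sigma> = c0 1 0"
  have \<sigma>: "\<bar>\<sigma>\<bar> = 1" 
  proof -
    have "\<sigma>\<^sup>2 = 1" using grad c01 by (simp add: \<sigma>_def)
    then show ?thesis by (auto simp: power2_eq_1_iff)
  qed
  have "\<sigma> * d1 = 1" using dir c01 by (simp add: \<sigma>_def)
  then have "d1 = \<sigma>" using abs_one_square[OF \<sigma>] by algebra
  moreover from this have "d2 = 0" using d abs_one_square[OF \<sigma>] by (simp add: power2_eq_square)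
  ultimately have L: "L = (\<lambda>r. (r, \<sigma> * r, 0)) ` {a..b}"
    unfolding L by (simp add: mult.commute)
  define S where "S = (\<lambda>(t, x, y). (t, y, x) :: L3)"
  have S: "linear_isometry_L3 S" "\<And>p. S (S p) = p"
    unfolding S_def by (rule linear_isometry_swap) auto
  have SL: "S ` L = tilted_ray \<sigma> ` {a..b}"
    unfolding L image_image by (simp add: S_def tilted_ray_def)
  define \<Omega>' where "\<Omega>' = {(x, y). (y, x) \<in> \<Omega>}"
  define g' where "g' = (\<lambda>x y. g y x)"
  have \<Omega>'_open: "open \<Omega>'" unfolding \<Omega>'_def using \<Omega>(1) by (rule open_swap)
  have an': "real_analytic2_on g' \<Omega>'" and zmc': "zero_mean_curvature_on g' \<Omega>'"
    unfolding g'_def \<Omega>'_def by (rule zmc_swap[OF an zmc])+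
  have surf: "S ` surface (graph_t g) \<Omega> = surface (graph_t g') \<Omega>'"
    unfolding S_def g'_def \<Omega>'_def by (rule surface_graph_t_swap)
  have seg': "lightlike_segment (graph_t g') \<Omega>' (tilted_ray \<sigma> ` {a..b})"
    unfolding SL[symmetric] unfolding S_def g'_def \<Omega>'_def
    by (rule lightlike_segment_swap[OF an seg(1)])
  obtain cG r where chart: "axis_chart (\<lambda>x y. g' x (\<sigma> * y)) 0 cG r"
    and box': "\<And>x y. \<bar>x\<bar> < r \<Longrightarrow> \<bar>y\<bar> < r \<Longrightarrow> (x, y) \<in> \<Omega>'"
    and cls': "\<And>C. class_along (surface (graph_t g') \<Omega>') (tilted_ray \<sigma> ` {a..b}) C \<longleftrightarrow>
       class_cond C (2 * cG 2 0) (- 2 * cG 2 1 - (2 * cG 2 0)\<^sup>2)"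
    by (rule class_along_tilted_graph_t[OF \<Omega>'_open an' zmc' \<sigma> ab seg']) (rule that; assumption)
  have cls: "class_along (surface (graph_t g) \<Omega>) L C \<longleftrightarrow>
       class_cond C (2 * cG 2 0) (- 2 * cG 2 1 - (2 * cG 2 0)\<^sup>2)" for C
    unfolding cls'[symmetric] surf[symmetric] SL[symmetric] by (rule class_along_isometry_iff[OF S(1) S(1,2)])
  have box: "(x, y) \<in> \<Omega>" if "\<bar>x\<bar> < r" "\<bar>y\<bar> < r" for x y
    using box'[OF that(2,1)] by (simp add: \<Omega>'_def)
  have \<sigma>2: "\<sigma> * (\<sigma> * y) = y" for y
    using abs_one_square[OF \<sigma>] by (simp add: mult.assoc[symmetric])
  have r: "r > 0" and cG: "pseries2 cG r (\<lambda>x y. g (\<sigma> * y) x)"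
    and ax: "\<And>v. \<bar>v\<bar> < r \<Longrightarrow> g (\<sigma> * v) 0 = v" "\<And>v. \<bar>v\<bar> < r \<Longrightarrow> D2 g (\<sigma> * v) 0 = 0"
    using chart by (simp_all add: axis_chart_def D1_def D2_def g'_def)
  define c where "c = (\<lambda>m n. cG n m * \<sigma> ^ m)"
  have c: "pseries2 c r g"
    using pseries2_swap[OF pseries2_reflect[OF cG \<sigma>]] by (simp add: c_def \<sigma>2)
  obtain F where F: "pseries2 (\<lambda>m n. complex_of_real (c m n)) r F"
    using pseries2_complexification[OF c] by metis
  have odd': "\<And>x y. \<bar>x\<bar> < r \<Longrightarrow> \<bar>y\<bar> < r \<Longrightarrow> g (- x) y = - g x y" using odd box by blast
  note rot = even_odd_real_rotation(2)[OF c F odd']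
  have cG20: "cG 2 0 = 0"
    using pseries2_affine_axis(3)[OF c r, of 0 0] g0 box r by (simp add: c_def)
  have zmc_box: "zero_mean_curvature_on g ({-r<..<r} \<times> {-r<..<r})"
  proof -
    have "{-r<..<r} \<times> {-r<..<r} \<subseteq> \<Omega>" using box by (auto simp: abs_less_iff)
    then show ?thesis using zmc unfolding zero_mean_curvature_on_def by blast
  qed
  note zmcC = complex_zero_mean_curvature[OF c F zmc_box]
  define U where "U = {-r<..<r} \<times> {-r<..<r}"
  define h where "h = rotated (- \<i> * of_real 1) F"
  define H where "H = rotated (- \<i> * of_real \<sigma>) F"
  have hH: "h = (\<lambda>t x. \<sigma> * H t x)" by (simp add: h_def H_def rotated_def \<sigma>2)
  have bi: "born_infeld_on (rotated (- \<i> * of_real k) F) U" if "\<bar>k\<bar> = 1" for k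
    unfolding born_infeld_on_def
  proof clarify
    fix t x assume "(t, x) \<in> U"
    then have tx: "\<bar>t\<bar> < r" "\<bar>x\<bar> < r" by (auto simp: U_def abs_less_iff)
    have "(complex_of_real k)\<^sup>2 = 1"
      using abs_one_square[OF that] by (simp add: power2_eq_square flip: of_real_mult)
    then have "(- \<i> * complex_of_real k)\<^sup>2 = - 1" by (simp add: power_mult_distrib)
    from rotated_pde_square_minus_one[OF rot this tx zmcC]
    show "(1 - (D1 (rotated (- \<i> * of_real k) F) t x)\<^sup>2) * D2 (D2 (rotated (- \<i> * of_real k) F)) t x
        + 2 * D1 (rotated (- \<i> * of_real k) F) t x * D2 (rotated (- \<i> * of_real k) F) t x * D2 (D1 (rotated (- \<i> * of_real k) F)) t x
        - (1 + (D2 (rotated (- \<i> * of_real k) F) t x)\<^sup>2) * D1 (D1 (rotated (- \<i> * of_real k) F)) t x = 0" .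
  qed
  define e where "e = (\<lambda>m n. rotated_coeff (- \<i> * of_real \<sigma>) c n m)"
  have K: "pseries2 e r (\<lambda>x t. H t x)"
    unfolding H_def e_def by (rule pseries2_swap[OF pseries2_rotated[OF F]])
  have r0: "norm (0::complex) < r" "\<bar>0\<bar> < r" using r by auto
  have chartH: "axis_chart (\<lambda>x t. H t x) 0 e r"
    unfolding axis_chart_def
  proof (intro conjI r allI impI)
    show "pseries2 e r (\<lambda>u v. H (0 + v) u)" using K by simp
    fix v :: real assume v: "\<bar>v\<bar> < r"
    have iv: "norm (\<i> * complex_of_real v) < r" using v by (simp add: norm_mult)
    have \<sigma>x: "\<bar>\<sigma> * x\<bar> < r" if "\<bar>x\<bar> < r" for x using that \<sigma> by (simp add: abs_mult)
    have "F (\<i> * of_real v) 0 - of_real \<sigma> * (\<i> * of_real v) = 0"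
    proof (rule holomorphic_zero_on_reals[of "\<lambda>z. F z 0 - of_real \<sigma> * z", OF _ _ iv])
      show "(\<lambda>z. F z 0 - of_real \<sigma> * z) holomorphic_on ball 0 r"
        by (intro holomorphic_intros pseries2_holomorphic1[OF F r0(1)])
      fix x :: real assume x: "\<bar>x\<bar> < r"
      have "g x 0 = \<sigma> * x" using ax(1)[OF \<sigma>x[OF x]] by (simp add: \<sigma>2)
      then show "F (of_real x) 0 - of_real \<sigma> * of_real x = 0"
        using pseries2_complexification_value[OF F c x r0(2)] by simp
    qed
    then have "F (\<i> * of_real v) 0 = of_real \<sigma> * (\<i> * of_real v)" by simp
    then show "H (0 + v) 0 = 0 + v" by (simp add: H_def rotated_def \<sigma>2)
    have "CD2 F (\<i> * of_real v) 0 = 0"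
    proof (rule holomorphic_zero_on_reals[OF _ _ iv])
      show "(\<lambda>z. CD2 F z 0) holomorphic_on ball 0 r"
        by (rule pseries2_holomorphic1[OF pseries2_CD2[OF F] r0(1)])
      fix x :: real assume x: "\<bar>x\<bar> < r"
      have "D2 g x 0 = 0" using ax(2)[OF \<sigma>x[OF x]] by (simp add: \<sigma>2)
      then show "CD2 F (of_real x) 0 = 0"
        using pseries2_complexification_value[OF pseries2_CD2[OF F] pseries2_deriv2(1)[OF c] x r0(2)] by simp
    qed
    then have "rotated (- \<i> * of_real \<sigma>) (CD2 F) v 0 = 0" by (simp add: rotated_def)
    then show "D1 (\<lambda>x t. H t x) 0 (0 + v) = 0"
      using D2_rotated[OF F v r0(2), of "- \<i> * of_real \<sigma>"] by (simp add: H_def D1_def D2_def)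
  qed
  have biH: "born_infeld_on H ({-r<..<r} \<times> {-r<..<r})"
    using bi[OF \<sigma>] by (simp add: H_def U_def)
  obtain L' where L': "lightlike_segment (graph_y h) U L'" "(0, 0, 0) \<in> L'"
    and clsH: "\<And>C. class_along (surface (graph_y h) U) L' C \<longleftrightarrow>
       class_cond C (- 2 * e 2 0) (2 * e 2 1 - (2 * e 2 0)\<^sup>2)"
    by (rule class_along_tilted_graph_y[OF chartH biH \<sigma> hH, folded U_def]) (rule that; assumption)
  have coeffs: "e 2 0 = 0" "e 2 1 = cG 2 1"
    using abs_one_square[OF \<sigma>] by (simp_all add: e_def rotated_coeff_def c_def)
  have wick: "(0, x) \<in> \<Omega> \<and> summable (wick_term g t x) \<and> complex_of_real (h t x) = - \<i> * wick g t x"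
    if "(t, x) \<in> U" for t x
  proof -
    have tx: "\<bar>t\<bar> < r" "\<bar>x\<bar> < r" using that by (auto simp: U_def abs_less_iff)
    have "- \<i> * of_real 1 * F (\<i> * of_real t) (of_real x) = complex_of_real (h t x)"
      unfolding h_def by (rule real_rotation_value[OF rot tx])
    then show ?thesis using wick_eq[OF c F tx] box[of 0 x] tx r by simp
  qed
  have U: "open U" "connected U" "(0, 0) \<in> U"
    using r by (auto simp: U_def intro!: open_Times connected_Times)
  have wickU: "\<forall>(t, x)\<in>U. (0, x) \<in> \<Omega> \<and> summable (wick_term g t x) \<and> complex_of_real (h t x) = - \<i> * wick g t x"
    using wick by blast
  have anh: "real_analytic2_on h U"
    unfolding U_def h_def by (rule pseries2_imp_real_analytic2_on[OF pseries2_rotated[OF F]])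
  have bih: "born_infeld_on h U" unfolding h_def by (rule bi) simp
  have clsg: "\<forall>C. class_along (surface (graph_t g) \<Omega>) L C \<longleftrightarrow> class_cond C 0 (- 2 * cG 2 1)"
    unfolding cls cG20 by simp
  have clsh: "\<forall>C. class_along (surface (graph_y h) U) L' C \<longleftrightarrow> class_cond C 0 (- (- 2 * cG 2 1))"
    unfolding clsH coeffs by simp
  show ?thesis
    by (intro exI[of _ U] exI[of _ h] exI[of _ L'] exI[of _ "- 2 * cG 2 1"] conjI)
      (fact U wickU anh bih L' clsg clsh)+
qed

theorem theorem2:
  fixes g :: "real \<Rightarrow> real \<Rightarrow> real" and \<Omega> :: "(real \<times> real) set" and L :: "L3 set"
  assumes domain: "open \<Omega>" "connected \<Omega>" "(0, 0) \<in> \<Omega>"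
    and symmetric: "\<And>x y. (x, y) \<in> \<Omega> \<Longrightarrow> (- x, y) \<in> \<Omega>"
    and analytic: "real_analytic2_on g \<Omega>"
    and zmc: "zero_mean_curvature_on g \<Omega>"
    and segment: "lightlike_segment (graph_t g) \<Omega> L" "(0, 0, 0) \<in> L"
  shows
    "((\<forall>(x, y)\<in>\<Omega>. g (- x) y = g x y) \<longrightarrow>
       (\<exists>U h L'. open U \<and> connected U \<and> (0, 0) \<in> U \<and>
          (\<forall>(t, x)\<in>U. (0, t) \<in> \<Omega> \<and> summable (wick_term g x t) \<and>
             complex_of_real (h t x) = wick g x t) \<and>
          real_analytic2_on h U \<and> born_infeld_on h U \<and>
          lightlike_segment (graph_y h) U L' \<and> (0, 0, 0) \<in> L' \<and>
          (\<exists>C. class_along (surface (graph_t g) \<Omega>) L C) \<and>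
          (\<forall>C. class_along (surface (graph_t g) \<Omega>) L C \<longleftrightarrow>
               class_along (surface (graph_y h) U) L' C))) \<and>
     ((\<forall>(x, y)\<in>\<Omega>. g (- x) y = - g x y) \<longrightarrow>
       (\<exists>U h L'. open U \<and> connected U \<and> (0, 0) \<in> U \<and>
          (\<forall>(t, x)\<in>U. (0, x) \<in> \<Omega> \<and> summable (wick_term g t x) \<and>
             complex_of_real (h t x) = - \<i> * wick g t x) \<and>
          real_analytic2_on h U \<and> born_infeld_on h U \<and>
          lightlike_segment (graph_y h) U L' \<and> (0, 0, 0) \<in> L' \<and>
          (\<exists>C\<in>{Alpha_plus, Alpha_zero_I, Alpha_minus_I}.
             class_along (surface (graph_t g) \<Omega>) L C) \<and>
          (\<exists>C\<in>{Alpha_plus, Alpha_zero_I, Alpha_minus_I}.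
             class_along (surface (graph_y h) U) L' C) \<and>
          (class_along (surface (graph_t g) \<Omega>) L Alpha_plus \<longrightarrow>
             class_along (surface (graph_y h) U) L' Alpha_minus_I) \<and>
          (class_along (surface (graph_t g) \<Omega>) L Alpha_minus_I \<longrightarrow>
             class_along (surface (graph_y h) U) L' Alpha_plus) \<and>
          (class_along (surface (graph_t g) \<Omega>) L Alpha_zero_I \<longrightarrow>
             class_along (surface (graph_y h) U) L' Alpha_zero_I)))"
proof (intro conjI impI, goal_cases)
  case 1
  then show ?case by (rule wick_rotation_even[OF domain(1,3) analytic zmc segment])
next
  case 2
  obtain U h L' \<mu> where U: "open U" "connected U" "(0, 0) \<in> U"
    "\<forall>(t, x)\<in>U. (0, x) \<in> \<Omega> \<and> summable (wick_term g t x) \<and> complex_of_real (h t x) = - \<i> * wick g t x"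
    "real_analytic2_on h U" "born_infeld_on h U" "lightlike_segment (graph_y h) U L'" "(0, 0, 0) \<in> L'"
    and cls: "\<forall>C. class_along (surface (graph_t g) \<Omega>) L C \<longleftrightarrow> class_cond C 0 \<mu>"
    and cls': "\<forall>C. class_along (surface (graph_y h) U) L' C \<longleftrightarrow> class_cond C 0 (- \<mu>)"
    using wick_rotation_odd[OF domain(1,3) analytic zmc segment 2] by (elim exE conjE) (rule that)
  have ex: "\<exists>C\<in>{Alpha_plus, Alpha_zero_I, Alpha_minus_I}. class_cond C 0 m" for m
    by (cases m "0::real" rule: linorder_cases) auto
  show ?case
    by (intro exI[of _ U] exI[of _ h] exI[of _ L'] conjI)
      (fact U | use ex[of \<mu>] ex[of "- \<mu>"] cls cls' in simp)+
qed

end
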